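(* Let $M$ be a compact contact manifold of dimension $2n+1$, let $p\ge 1$ and let $s$ be an integer. If $s\ge 2n+4$, then there is a constant $C>0$ such that $$\|f_1\cdots f_p\|_{M,s}\le C\,\|f_1\|_{M,s}\cdots\|f_p\|_{M,s}$$ for all $f_j\in\Gamma^s(M)$, $j=1,\dots,p$. If $s>2n+4$, then there is a constant $C>0$ such that $$\|f_1\cdots f_p\|_{M,s}\le C\sum_{j=1}^{p}\|f_1\|_{M,s-1}\cdots\|f_{j-1}\|_{M,s-1}\,\|f_j\|_{M,s}\,\|f_{j+1}\|_{M,s-1}\cdots\|f_p\|_{M,s-1}$$ for all $f_j\in\Gamma^s(M)$, $j=1,\dots,p$.
   Context: On $\mathbb{R}^{2n+1}$ with coordinates $(x^1,\dots,x^{2n+1})$ let $\eta_0=dx^{2n+1}-\sum_{j=1}^n x^{n+j}dx^j$, $dV_0=\frac{1}{n!}\eta_0\wedge(d\eta_0)^n$, and, for $1\le j\le n$, $X_j=\partial_{x^j}+x^{n+j}\partial_{x^{2n+1}}$, $X_{n+j}=\partial_{x^{n+j}}$ (a framing of $\ker\eta_0$). For a multi-index $I=(i_1,\dots,i_t)$, $1\le i_j\le 2n$, put $|I|=t$ and $X_If=X_{i_1}\cdots X_{i_t}f$ ($X_If=f$ if $t=0$). For a bounded domain $D\subset\mathbb{R}^{2n+1}$ and an integer $s\ge0$, the Folland-Stein space $\Gamma^s(D,\mathbb{R}^m)$ is the Hilbert space completion of the smooth $\mathbb{R}^m$-valued functions on $\overline D$ for the inner product $(f,g)_{D,s}=\sum_{0\le|I|\le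 s}\int_D (X_If,X_Ig)\,dV_0$. $M$ is a smooth compact contact manifold of dimension $2n+1$ with a fixed global contact form $\eta$. An adapted chart is a chart $\phi:U\to\mathbb{R}^{2n+1}$ with $\phi^*\eta_0=\eta$. An adapted atlas is a finite atlas of adapted charts $\phi_\alpha:U_\alpha\to\mathbb{R}^{2n+1}$ together with open regions $D_\alpha$ compactly contained in $\phi_\alpha(U_\alpha)$ such that the sets $\phi_\alpha^{-1}(D_\alpha)$ cover $M$. Fix one. $\Gamma^s(M,\mathbb{R}^m)$ is the space of $f:M\to\mathbb{R}^m$ with $f_\alpha=f\circ\phi_\alpha^{-1}\in\Gamma^s(D_\alpha,\mathbb{R}^m)$ for all $\alpha$, with inner product $(f,g)_{M,s}=\sum_\alpha(f_\alpha,g_\alpha)_{D_\alpha,s}$ and norm $\|\cdot\|_{M,s}$; $\Gamma^s(M)=\Gamma^s(M,\mathbb{R})$. *)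

theory Defs
  imports "HOL-Analysis.Analysis"
begin

section \<open>Smooth maps\<close>

text \<open>These are meant for open \<open>S\<close>, where \<open>at x\<close> and \<open>at x within S\<close> agree.\<close>

fun Ck_on :: "nat \<Rightarrow> 'e::euclidean_space set \<Rightarrow> ('e \<Rightarrow> 'b::real_normed_vector) \<Rightarrow> bool" where
  "Ck_on 0 S f \<longleftrightarrow> continuous_on S f"
| "Ck_on (Suc k) S f \<longleftrightarrow>
     (\<forall>x\<in>S. f differentiable (at x)) \<and> (\<forall>v. Ck_on k S (\<lambda>x. frechet_derivative f (at x) v))"

definition smooth_on :: "'e::euclidean_space set \<Rightarrow> ('e \<Rightarrow> 'b::real_normed_vector) \<Rightarrow> bool" where
  "smooth_on S f \<longleftrightarrow> (\<forall>k. Ck_on k S f)"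

definition smooth_closure :: "'e::euclidean_space set \<Rightarrow> ('e \<Rightarrow> 'b::real_normed_vector) \<Rightarrow> bool" where
  "smooth_closure D f \<longleftrightarrow> (\<exists>W. open W \<and> closure D \<subseteq> W \<and> smooth_on W f)"


section \<open>Coordinates and differential forms on Euclidean space\<close>

text \<open>With \<open>n = CARD('n)\<close>, a point of \<open>\<real>\<^sup>2\<^sup>n\<^sup>+\<^sup>1\<close> is grouped as
  \<open>(a, b, z)\<close> with \<open>a = (x\<^sup>1, \<dots>, x\<^sup>n)\<close>, \<open>b = (x\<^sup>n\<^sup>+\<^sup>1, \<dots>, x\<^sup>2\<^sup>n)\<close>
  and \<open>z = x\<^sup>2\<^sup>n\<^sup>+\<^sup>1\<close>. Indices \<open>j\<close> and \<open>n+j\<close> (\<open>1 \<le> j \<le> n\<close>) are \<open>Inl j\<close> and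
  \<open>Inr j\<close> in \<open>'n + 'n\<close>; the index \<open>2n+1\<close> is \<open>None\<close> in \<open>('n + 'n) option\<close>.\<close>

type_synonym 'n R2n1 = "(real^'n) \<times> (real^'n) \<times> real"

fun coord_vec :: "('n::finite + 'n) option \<Rightarrow> 'n R2n1" where
  "coord_vec None = (0, 0, 1)"
| "coord_vec (Some (Inl j)) = (axis j 1, 0, 0)"
| "coord_vec (Some (Inr j)) = (0, axis j 1, 0)"

text \<open>A 1-form is a map \<open>\<omega>\<close> with \<open>\<omega> x v\<close> its value at the point \<open>x\<close> on the tangent
  vector \<open>v\<close>.\<close>

definition pullback :: "('e::euclidean_space \<Rightarrow> 'f::euclidean_space) \<Rightarrow> ('f \<Rightarrow> 'f \<Rightarrow> real)
    \<Rightarrow> 'e \<Rightarrow> 'e \<Rightarrow> real" where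
  "pullback F \<omega> x v = \<omega> (F x) (frechet_derivative F (at x) v)"

definition ext_deriv :: "('e::euclidean_space \<Rightarrow> 'e \<Rightarrow> real) \<Rightarrow> 'e \<Rightarrow> 'e \<Rightarrow> 'e \<Rightarrow> real" where
  "ext_deriv \<omega> x v w =
     frechet_derivative (\<lambda>y. \<omega> y w) (at x) v - frechet_derivative (\<lambda>y. \<omega> y v) (at x) w"

text \<open>The value of \<open>\<alpha> \<and> \<beta>\<^sup>n\<close>, for a covector \<open>\<alpha>\<close> and an alternating bilinear form \<open>\<beta>\<close>,
  on \<open>2n+1\<close> vectors listed in the slot order \<open>2n+1, 1, n+1, 2, n+2, \<dots>, n, 2n\<close>. Another slot
  order changes only a global sign. The normalisation is the usual one,
  \<open>(dx\<^sup>1 \<and> \<dots> \<and> dx\<^sup>m)(\<partial>\<^sub>1, \<dots>, \<partial>\<^sub>m) = 1\<close>, which is why the alternating sum is divided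
  by \<open>1! (2!)\<^sup>n\<close>.\<close>

definition wedge_power :: "('e \<Rightarrow> real) \<Rightarrow> ('e \<Rightarrow> 'e \<Rightarrow> real) \<Rightarrow> (('n::finite + 'n) option \<Rightarrow> 'e) \<Rightarrow> real" where
  "wedge_power \<alpha> \<beta> v =
     (\<Sum>\<sigma> | \<sigma> permutes (UNIV :: ('n + 'n) option set).
        of_int (sign \<sigma>) * \<alpha> (v (\<sigma> None)) *
        (\<Prod>j\<in>(UNIV :: 'n set). \<beta> (v (\<sigma> (Some (Inl j)))) (v (\<sigma> (Some (Inr j))))))
     / 2 ^ CARD('n)"

definition eta0 :: "'n::finite R2n1 \<Rightarrow> 'n R2n1 \<Rightarrow> real" where
  "eta0 = (\<lambda>(a, b, z) (va, vb, vz). vz - (\<Sum>j\<in>UNIV. b $ j * va $ j))"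

text \<open>The coefficient of \<open>dV\<^sub>0 = (1/n!) \<eta>\<^sub>0 \<and> (d\<eta>\<^sub>0)\<^sup>n\<close> in the coordinates; integration against
  \<open>dV\<^sub>0\<close> uses the orientation for which it is positive, hence its absolute value.\<close>

definition dV0_coeff :: "'n::finite R2n1 \<Rightarrow> real" where
  "dV0_coeff x = wedge_power (eta0 x) (ext_deriv eta0 x) (coord_vec :: ('n + 'n) option \<Rightarrow> 'n R2n1)
     / fact CARD('n)"

definition dV0 :: "'n::finite R2n1 measure" where
  "dV0 = density lebesgue (\<lambda>x. ennreal \<bar>dV0_coeff x\<bar>)"


section \<open>Folland-Stein spaces of domains\<close>

fun contact_frame :: "'n::finite + 'n \<Rightarrow> 'n R2n1 \<Rightarrow> 'n R2n1" where
  "contact_frame (Inl j) x =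
     coord_vec (Some (Inl j)) + (fst (snd x) $ j) *\<^sub>R coord_vec None"
| "contact_frame (Inr j) x = coord_vec (Some (Inr j))"

definition X_field :: "'n::finite + 'n \<Rightarrow> ('n R2n1 \<Rightarrow> 'b::real_normed_vector) \<Rightarrow> 'n R2n1 \<Rightarrow> 'b" where
  "X_field i f x = frechet_derivative f (at x) (contact_frame i x)"

definition X_multi :: "('n::finite + 'n) list \<Rightarrow> ('n R2n1 \<Rightarrow> 'b::real_normed_vector) \<Rightarrow> 'n R2n1 \<Rightarrow> 'b" where
  "X_multi I f = foldr X_field I f"

definition pre_inner :: "nat \<Rightarrow> 'n::finite R2n1 set \<Rightarrow> ('n R2n1 \<Rightarrow> 'b::euclidean_space)
    \<Rightarrow> ('n R2n1 \<Rightarrow> 'b) \<Rightarrow> real" where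
  "pre_inner s D f g =
     (\<Sum>I | length I \<le> s. set_lebesgue_integral dV0 D (\<lambda>x. X_multi I f x \<bullet> X_multi I g x))"

definition pre_norm :: "nat \<Rightarrow> 'n::finite R2n1 set \<Rightarrow> ('n R2n1 \<Rightarrow> 'b::euclidean_space) \<Rightarrow> real" where
  "pre_norm s D f = sqrt (pre_inner s D f f)"

text \<open>The completion is realised by functions on \<open>D\<close>. The norm dominates the \<open>L\<^sup>2\<close> norm, so a
  Cauchy sequence of smooth functions on \<open>closure D\<close> has an \<open>L\<^sup>2(D)\<close> limit, and since the operators
  \<open>X\<^sub>I\<close> are closable in \<open>L\<^sup>2(D)\<close>, inequivalent Cauchy sequences have limits that differ on a set of
  positive measure. Thus \<open>fs_represents s D f u\<close> says that the element of the completion given by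
  the Cauchy sequence \<open>u\<close> is (the a.e. class of) \<open>f\<close>, and inner products in the completion are
  limits of inner products along representing sequences.\<close>

definition fs_represents :: "nat \<Rightarrow> 'n::finite R2n1 set \<Rightarrow> ('n R2n1 \<Rightarrow> 'b::euclidean_space)
    \<Rightarrow> (nat \<Rightarrow> 'n R2n1 \<Rightarrow> 'b) \<Rightarrow> bool" where
  "fs_represents s D f u \<longleftrightarrow>
     (\<forall>k. smooth_closure D (u k)) \<and>
     (\<forall>e>0. \<exists>N. \<forall>k\<ge>N. \<forall>l\<ge>N. pre_norm s D (\<lambda>x. u k x - u l x) < e) \<and>
     set_borel_measurable dV0 D f \<and>
     (\<lambda>k. \<integral>\<^sup>+x\<in>D. ennreal ((norm (u k x - f x))\<^sup>2) \<partial>dV0) \<longlonglongrightarrow> 0"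

definition Gamma_dom :: "nat \<Rightarrow> 'n::finite R2n1 set \<Rightarrow> ('n R2n1 \<Rightarrow> 'b::euclidean_space) set" where
  "Gamma_dom s D = {f. \<exists>u. fs_represents s D f u}"

definition inner_dom :: "nat \<Rightarrow> 'n::finite R2n1 set \<Rightarrow> ('n R2n1 \<Rightarrow> 'b::euclidean_space)
    \<Rightarrow> ('n R2n1 \<Rightarrow> 'b) \<Rightarrow> real" where
  "inner_dom s D f g =
     (THE r. \<forall>u v. fs_represents s D f u \<longrightarrow> fs_represents s D g v \<longrightarrow>
               (\<lambda>k. pre_inner s D (u k) (v k)) \<longlonglongrightarrow> r)"


section \<open>Contact manifolds\<close>

type_synonym ('a, 'e) chart = "'a set \<times> ('a \<Rightarrow> 'e)"

abbreviation chart_dom :: "('a, 'e) chart \<Rightarrow> 'a set" where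
  "chart_dom \<equiv> fst"

abbreviation chart_map :: "('a, 'e) chart \<Rightarrow> 'a \<Rightarrow> 'e" where
  "chart_map \<equiv> snd"

definition chart_img :: "('a, 'e) chart \<Rightarrow> 'e set" where
  "chart_img c = chart_map c ` chart_dom c"

definition chart_inv :: "('a, 'e) chart \<Rightarrow> 'e \<Rightarrow> 'a" where
  "chart_inv c = inv_into (chart_dom c) (chart_map c)"

definition is_chart :: "'a topology \<Rightarrow> ('a, 'e::euclidean_space) chart \<Rightarrow> bool" where
  "is_chart M c \<longleftrightarrow> openin M (chart_dom c) \<and> open (chart_img c) \<and>
     homeomorphic_map (subtopology M (chart_dom c)) (top_of_set (chart_img c)) (chart_map c)"

text \<open>\<open>transition c d\<close> is \<open>d \<circ> c\<inverse>\<close>, used on \<open>overlap c d\<close>, the image under \<open>c\<close> of the common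
  domain.\<close>

definition transition :: "('a, 'e) chart \<Rightarrow> ('a, 'e) chart \<Rightarrow> 'e \<Rightarrow> 'e" where
  "transition c d = chart_map d \<circ> chart_inv c"

definition overlap :: "('a, 'e) chart \<Rightarrow> ('a, 'e) chart \<Rightarrow> 'e set" where
  "overlap c d = chart_map c ` (chart_dom c \<inter> chart_dom d)"

definition compatible :: "('a, 'e::euclidean_space) chart \<Rightarrow> ('a, 'e) chart \<Rightarrow> bool" where
  "compatible c d \<longleftrightarrow>
     smooth_on (overlap c d) (transition c d) \<and> smooth_on (overlap d c) (transition d c)"

locale smooth_manifold =
  fixes M :: "'a topology" and \<A> :: "('a, 'e::euclidean_space) chart set"
  assumes hausdorff: "Hausdorff_space M"
    and second_countable: "second_countable M"
    and charts: "c \<in> \<A> \<Longrightarrow> is_chart M c"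
    and cover: "topspace M = (\<Union>c\<in>\<A>. chart_dom c)"
    and compat: "c \<in> \<A> \<Longrightarrow> d \<in> \<A> \<Longrightarrow> compatible c d"
    and maximal: "is_chart M c \<Longrightarrow> (\<And>d. d \<in> \<A> \<Longrightarrow> compatible c d) \<Longrightarrow> c \<in> \<A>"

text \<open>A 1-form on a manifold is given by its coordinate expressions \<open>\<eta> c\<close> on \<open>chart_img c\<close>,
  one for each chart \<open>c\<close>, which correspond under transition maps.\<close>

type_synonym ('a, 'e) form1 = "('a, 'e) chart \<Rightarrow> 'e \<Rightarrow> 'e \<Rightarrow> real"

definition smooth_form1 :: "('a, 'e::euclidean_space) chart set \<Rightarrow> ('a, 'e) form1 \<Rightarrow> bool" where
  "smooth_form1 \<A> \<eta> \<longleftrightarrow>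
     (\<forall>c\<in>\<A>. (\<forall>x\<in>chart_img c. linear (\<eta> c x)) \<and>
             (\<forall>v. smooth_on (chart_img c) (\<lambda>x. \<eta> c x v))) \<and>
     (\<forall>c\<in>\<A>. \<forall>d\<in>\<A>. \<forall>x\<in>overlap c d. \<eta> c x = pullback (transition c d) (\<eta> d) x)"

definition contact_form :: "('a, 'n::finite R2n1) chart set \<Rightarrow> ('a, 'n R2n1) form1 \<Rightarrow> bool" where
  "contact_form \<A> \<eta> \<longleftrightarrow> smooth_form1 \<A> \<eta> \<and>
     (\<forall>c\<in>\<A>. \<forall>x\<in>chart_img c. \<exists>v :: ('n + 'n) option \<Rightarrow> 'n R2n1.
        wedge_power (\<eta> c x) (ext_deriv (\<eta> c) x) v \<noteq> 0)"

locale compact_contact_manifold = smooth_manifold M \<A>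
  for M :: "'a topology" and \<A> :: "('a, 'n::finite R2n1) chart set" +
  fixes \<eta> :: "('a, 'n R2n1) form1"
  assumes compact: "compact_space M"
    and contact: "contact_form \<A> \<eta>"

text \<open>For a chart \<open>\<phi> : U \<rightarrow> \<real>\<^sup>2\<^sup>n\<^sup>+\<^sup>1\<close>, the coordinate expression of \<open>\<phi>\<^sup>*\<eta>\<^sub>0\<close> in a
  chart \<open>d\<close> is the pullback of \<open>\<eta>\<^sub>0\<close> under \<open>\<phi> \<circ> d\<inverse>\<close>.\<close>

definition adapted_chart :: "('a, 'n::finite R2n1) chart set \<Rightarrow> ('a, 'n R2n1) form1
    \<Rightarrow> ('a, 'n R2n1) chart \<Rightarrow> bool" where
  "adapted_chart \<A> \<eta> \<phi> \<longleftrightarrow> \<phi> \<in> \<A> \<and>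
     (\<forall>d\<in>\<A>. \<forall>x\<in>overlap d \<phi>. pullback (transition d \<phi>) eta0 x = \<eta> d x)"

definition adapted_atlas :: "'a topology \<Rightarrow> ('a, 'n::finite R2n1) chart set \<Rightarrow> ('a, 'n R2n1) form1
    \<Rightarrow> 'k set \<Rightarrow> ('k \<Rightarrow> ('a, 'n R2n1) chart) \<Rightarrow> ('k \<Rightarrow> 'n R2n1 set) \<Rightarrow> bool" where
  "adapted_atlas M \<A> \<eta> K \<phi> D \<longleftrightarrow> finite K \<and>
     (\<forall>\<alpha>\<in>K. adapted_chart \<A> \<eta> (\<phi> \<alpha>) \<and>
        open (D \<alpha>) \<and> compact (closure (D \<alpha>)) \<and> closure (D \<alpha>) \<subseteq> chart_img (\<phi> \<alpha>)) \<and>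
     topspace M = (\<Union>\<alpha>\<in>K. chart_inv (\<phi> \<alpha>) ` D \<alpha>)"


section \<open>Folland-Stein spaces of a contact manifold\<close>

text \<open>These depend on the charts \<open>\<phi> \<alpha>\<close> and regions \<open>D \<alpha>\<close>, \<open>\<alpha> \<in> K\<close>, of an adapted atlas.
  Functions that agree almost everywhere are not identified.\<close>

definition Gamma_man :: "'k set \<Rightarrow> ('k \<Rightarrow> ('a, 'n::finite R2n1) chart) \<Rightarrow> ('k \<Rightarrow> 'n R2n1 set) \<Rightarrow> nat
    \<Rightarrow> ('a \<Rightarrow> 'b::euclidean_space) set" where
  "Gamma_man K \<phi> D s = {f. \<forall>\<alpha>\<in>K. f \<circ> chart_inv (\<phi> \<alpha>) \<in> Gamma_dom s (D \<alpha>)}"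

definition inner_man :: "'k set \<Rightarrow> ('k \<Rightarrow> ('a, 'n::finite R2n1) chart) \<Rightarrow> ('k \<Rightarrow> 'n R2n1 set) \<Rightarrow> nat
    \<Rightarrow> ('a \<Rightarrow> 'b::euclidean_space) \<Rightarrow> ('a \<Rightarrow> 'b) \<Rightarrow> real" where
  "inner_man K \<phi> D s f g =
     (\<Sum>\<alpha>\<in>K. inner_dom s (D \<alpha>) (f \<circ> chart_inv (\<phi> \<alpha>)) (g \<circ> chart_inv (\<phi> \<alpha>)))"

definition norm_man :: "'k set \<Rightarrow> ('k \<Rightarrow> ('a, 'n::finite R2n1) chart) \<Rightarrow> ('k \<Rightarrow> 'n R2n1 set) \<Rightarrow> nat
    \<Rightarrow> ('a \<Rightarrow> 'b::euclidean_space) \<Rightarrow> real" where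
  "norm_man K \<phi> D s f = sqrt (inner_man K \<phi> D s f f)"

end

theory Submission
  imports Defs
begin

text \<open>
  The estimate is local: near each point a function in \<open>\<Gamma>\<^sup>s(M)\<close> is seen from some chart region
  that contains the point in its interior, so only interior Sobolev estimates are needed, although the
  regions may have arbitrarily bad boundaries. A partition of unity on a neighbourhood of the closure of
  one region \<open>D\<^sub>\<alpha>\<close> writes a product there as a sum of pieces \<open>\<psi> \<cdot> (u v) \<circ> T\<close>, with \<open>T\<close> a contact
  transformation carrying the support of \<open>\<psi>\<close> into a compact subset of another region. As \<open>T\<close>
  preserves \<open>\<eta>\<^sub>0\<close>, the derivatives \<open>X\<^sub>I\<close> of a piece are combinations of the \<open>(X\<^sub>J (u v)) \<circ> T\<close> with
  \<open>|J| \<le> |I|\<close>. In \<open>X\<^sub>J (u v)\<close> one factor carries at most \<open>s/2\<close> derivatives and is bounded uniformly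
  by the norm of order \<open>s/2 + n + 2\<close>.

  For the Sobolev embedding put \<open>g(r) = \<integral> u(x \<cdot> \<delta>\<^sub>r y) \<Phi>(y) dy\<close>. Since the generator of the dilations
  \<open>\<delta>\<^sub>r\<close> is a combination of the \<open>X\<^sub>i\<close> and one commutator of them, integration by parts gives
  \<open>g'(r) = \<Sum>\<^sub>i \<integral> (X\<^sub>i u)(x \<cdot> \<delta>\<^sub>r y) \<Phi>\<^sub>i(y) dy\<close>. Iterating, \<open>g\<^sup>(\<^sup>k\<^sup>)(r)\<close> is bounded by
  \<open>r\<^sup>-\<^sup>(\<^sup>n\<^sup>+\<^sup>1\<^sup>)\<close> times the \<open>L\<^sup>2\<close> norms of the derivatives of order \<open>k\<close>, so for \<open>k = n + 2\<close> the
  remainder in the Taylor expansion of \<open>g(0)\<close> about \<open>r = R\<close> is bounded.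
\<close>

section \<open>Smooth maps and bump functions\<close>

text \<open>The threshold is arithmetic. A factor with at most \<open>s div 2\<close> derivatives
  needs \<open>n + 2\<close> more for a uniform bound, so it is measured in a norm of order
  \<open>t\<close> with \<open>s div 2 + n + 2 \<le> t \<le> s\<close>. For
  \<open>s \<ge> 2n + 4\<close> the choice \<open>t = s\<close> is admissible, for
  \<open>s > 2n + 4\<close> also \<open>t = s - 1\<close>; induction then gives \<open>p\<close>
  factors.

  The obstacle is the completion. An element of it is known only as an L^2 limit of smooth
  functions, and L^2 convergence of two factors does not identify the limit of their product. Here
  the Sobolev bound works a second time: on compact subsets of a region, representing sequences
  converge uniformly, so the products of approximants converge to the product almost everywhere.
  That the norm of an element is the limit of norms along every representing sequence is the
  closability of the \<open>X_I\<close>, which rests on integration by parts against cutoffs.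

  Approximants on a region are uncontrolled near its boundary. Those of a product on
  \<open>D \<alpha>\<close> are therefore assembled from sequences on regions that contain the
  points of its closure in their interior.\<close>

lemma frechet_derivative_eqI:
  "(f has_derivative f') (at x) \<Longrightarrow> frechet_derivative f (at x) = f'"
  by (metis frechet_derivative_at)

lemma frechet_derivative_cong_open:
  assumes "open S" "x \<in> S" "\<And>y. y \<in> S \<Longrightarrow> f y = g y"
  shows "frechet_derivative f (at x) = frechet_derivative g (at x)"
proof -
  have "(f has_derivative D) (at x) \<longleftrightarrow> (g has_derivative D) (at x)" for D
    using assms by (metis has_derivative_transform_within_open)
  then show ?thesis unfolding frechet_derivative_def by simp
qed

lemma differentiable_cong_open:
  assumes "open S" "x \<in> S" "\<And>y. y \<in> S \<Longrightarrow> f y = g y"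
  shows "f differentiable (at x) \<longleftrightarrow> g differentiable (at x)"
  unfolding differentiable_def using assms by (metis has_derivative_transform_within_open)

lemma Ck_on_cong:
  assumes "open S" "\<And>y. y \<in> S \<Longrightarrow> f y = g y"
  shows "Ck_on k S f \<longleftrightarrow> Ck_on k S g"
  using assms(2)
proof (induction k arbitrary: f g)
  case 0
  then show ?case by (auto cong: continuous_on_cong)
next
  case (Suc k)
  have "Ck_on k S (\<lambda>x. frechet_derivative f (at x) v) \<longleftrightarrow> Ck_on k S (\<lambda>x. frechet_derivative g (at x) v)" for v
    by (rule Suc.IH) (metis frechet_derivative_cong_open[OF assms(1)] Suc.prems)
  then show ?case
    using differentiable_cong_open[OF assms(1) _ Suc.prems] by auto
qed

lemma smooth_on_cong:
  assumes "open S" "\<And>y. y \<in> S \<Longrightarrow> f y = g y"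
  shows "smooth_on S f \<longleftrightarrow> smooth_on S g"
  by (simp add: smooth_on_def Ck_on_cong[OF assms(1), of f g] assms(2))

lemma Ck_on_subset: "Ck_on k S f \<Longrightarrow> T \<subseteq> S \<Longrightarrow> Ck_on k T f"
  by (induction k arbitrary: f) (auto intro: continuous_on_subset)

lemma smooth_on_subset: "smooth_on S f \<Longrightarrow> T \<subseteq> S \<Longrightarrow> smooth_on T f"
  unfolding smooth_on_def using Ck_on_subset by blast

lemma Ck_on_imp_continuous_on: "Ck_on k S f \<Longrightarrow> continuous_on S f"
  by (cases k) (auto intro!: continuous_at_imp_continuous_on differentiable_imp_continuous_within)

lemma Ck_on_SucD: "Ck_on (Suc k) S f \<Longrightarrow> Ck_on k S f"
proof (induction k arbitrary: f)
  case 0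
  then show ?case using Ck_on_imp_continuous_on by (metis Ck_on.simps(1))
next
  case (Suc k)
  then show ?case by (metis Ck_on.simps(2))
qed

lemma smooth_on_imp_continuous_on: "smooth_on S f \<Longrightarrow> continuous_on S f"
  unfolding smooth_on_def using Ck_on_imp_continuous_on by blast

lemma smooth_on_imp_differentiable: "smooth_on S f \<Longrightarrow> x \<in> S \<Longrightarrow> f differentiable (at x)"
  unfolding smooth_on_def by (metis Ck_on.simps(2))

lemma smooth_on_imp_has_derivative:
  "smooth_on S f \<Longrightarrow> x \<in> S \<Longrightarrow> (f has_derivative frechet_derivative f (at x)) (at x)"
  using smooth_on_imp_differentiable frechet_derivative_works by blast

lemma smooth_on_frechet_derivative:
  "smooth_on S f \<Longrightarrow> smooth_on S (\<lambda>x. frechet_derivative f (at x) v)"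
  unfolding smooth_on_def by (metis Ck_on.simps(2))

lemma Ck_on_Un:
  "open S \<Longrightarrow> open T \<Longrightarrow> Ck_on k S f \<Longrightarrow> Ck_on k T f \<Longrightarrow> Ck_on k (S \<union> T) f"
  by (induction k arbitrary: f) (auto intro: continuous_on_open_Un)

lemma smooth_on_Un:
  "open S \<Longrightarrow> open T \<Longrightarrow> smooth_on S f \<Longrightarrow> smooth_on T f \<Longrightarrow> smooth_on (S \<union> T) f"
  unfolding smooth_on_def using Ck_on_Un by blast

lemma Ck_on_SucI:
  assumes "open S"
    and "\<And>x. x \<in> S \<Longrightarrow> (f has_derivative f' x) (at x)"
    and "\<And>v. Ck_on k S (\<lambda>x. f' x v)"
  shows "Ck_on (Suc k) S f"
proof -
  have "frechet_derivative f (at x) = f' x" if "x \<in> S" for x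
    using assms(2)[OF that] frechet_derivative_eqI by blast
  then have "Ck_on k S (\<lambda>x. frechet_derivative f (at x) v)" for v
    using Ck_on_cong[OF assms(1), of "\<lambda>x. frechet_derivative f (at x) v" "\<lambda>x. f' x v"] assms(3)
    by simp
  then show ?thesis using assms(2) by (auto simp: differentiable_def)
qed

lemma Ck_on_has_derivative:
  "Ck_on (Suc k) S f \<Longrightarrow> x \<in> S \<Longrightarrow> (f has_derivative frechet_derivative f (at x)) (at x)"
  using frechet_derivative_works by auto

lemma Ck_on_const: "Ck_on k S (\<lambda>x. c)"
  by (induction k arbitrary: c) (auto simp: frechet_derivative_const)

lemma smooth_on_const [simp]: "smooth_on S (\<lambda>x. c)"
  by (simp add: smooth_on_def Ck_on_const)

lemma Ck_on_bounded_linear: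
  assumes "open S" "bounded_linear L"
  shows "Ck_on k S L"
proof (cases k)
  case 0
  then show ?thesis
    using linear_continuous_on[OF assms(2)] by simp
next
  case (Suc m)
  show ?thesis unfolding Suc
    by (rule Ck_on_SucI[where f'="\<lambda>_. L"])
      (use assms in \<open>auto simp: Ck_on_const bounded_linear_imp_has_derivative\<close>)
qed

lemma smooth_on_bounded_linear: "open S \<Longrightarrow> bounded_linear L \<Longrightarrow> smooth_on S L"
  by (simp add: smooth_on_def Ck_on_bounded_linear)

lemma Ck_on_add:
  assumes "open S" "Ck_on k S f" "Ck_on k S g"
  shows "Ck_on k S (\<lambda>x. f x + g x)"
  using assms(2,3)
proof (induction k arbitrary: f g)
  case 0
  then show ?case by (auto intro: continuous_on_add)
next
  case (Suc k)
  show ?case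
    by (rule Ck_on_SucI[OF assms(1), where
          f'="\<lambda>x v. frechet_derivative f (at x) v + frechet_derivative g (at x) v"])
       (auto intro!: has_derivative_add Suc.IH intro: Ck_on_has_derivative[OF Suc.prems(1)]
          Ck_on_has_derivative[OF Suc.prems(2)] simp: Suc.prems[simplified])
qed

lemma Ck_on_compose_bounded_linear:
  assumes "open S" "bounded_linear L" "Ck_on k S f"
  shows "Ck_on k S (\<lambda>x. L (f x))"
  using assms(3)
proof (induction k arbitrary: f)
  case 0
  then show ?case using assms(2) by (auto intro: bounded_linear.continuous_on)
next
  case (Suc k)
  show ?case
    by (rule Ck_on_SucI[OF assms(1), where f'="\<lambda>x v. L (frechet_derivative f (at x) v)"])
       (auto intro!: bounded_linear.has_derivative[OF assms(2)] Suc.IH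
          intro: Ck_on_has_derivative[OF Suc.prems(1)] simp: Suc.prems[simplified])
qed

lemma Ck_on_scaleR:
  assumes "open S" "Ck_on k S f" "Ck_on k S g"
  shows "Ck_on k S (\<lambda>x. f x *\<^sub>R g x)"
  using assms(2,3)
proof (induction k arbitrary: f g)
  case 0
  then show ?case by (auto intro: continuous_on_scaleR)
next
  case (Suc k)
  have 1: "Ck_on k S f" "Ck_on k S g" using Suc.prems Ck_on_SucD by auto
  show ?case
    by (rule Ck_on_SucI[OF assms(1), where
          f'="\<lambda>x v. f x *\<^sub>R frechet_derivative g (at x) v + frechet_derivative f (at x) v *\<^sub>R g x"])
       (auto intro!: has_derivative_scaleR Ck_on_add[OF assms(1)] Suc.IH
          intro: Ck_on_has_derivative[OF Suc.prems(1)]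
          Ck_on_has_derivative[OF Suc.prems(2)] simp: Suc.prems[simplified] 1)
qed

lemma Ck_on_sum:
  assumes "open S" "\<And>i. i \<in> A \<Longrightarrow> Ck_on k S (f i)"
  shows "Ck_on k S (\<lambda>x. \<Sum>i\<in>A. f i x)"
  using assms(2)
  by (induction A rule: infinite_finite_induct) (auto simp: Ck_on_const intro!: Ck_on_add[OF assms(1)])

text \<open>\<open>Ck_on\<close> differentiates in constant directions only, whereas the chain rule
  produces the moving direction \<open>T'(x) v\<close>. Expanding it in the basis gives a sum of
  products of coordinates of \<open>T'(x) v\<close> with derivatives of \<open>f\<close> in fixed
  directions, to which the induction hypothesis applies.\<close>

lemma Ck_on_compose:
  fixes f :: "'b::euclidean_space \<Rightarrow> 'c::real_normed_vector" and T :: "'e::euclidean_space \<Rightarrow> 'b"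
  assumes "open S" "open U" "T ` S \<subseteq> U" "Ck_on k S T" "Ck_on k U f"
  shows "Ck_on k S (\<lambda>x. f (T x))"
  using assms(4,5)
proof (induction k arbitrary: f)
  case 0
  then show ?case using assms(3) by (auto intro: continuous_on_compose2)
next
  case (Suc k)
  let ?f' = "\<lambda>x v. frechet_derivative f (at (T x)) (frechet_derivative T (at x) v)"
  have der: "((\<lambda>x. f (T x)) has_derivative ?f' x) (at x)" if "x \<in> S" for x
    using diff_chain_at[OF Ck_on_has_derivative[OF Suc.prems(1) that], of f]
      Ck_on_has_derivative[OF Suc.prems(2), of "T x"] assms(3) that
    by (auto simp: o_def)
  have expand: "?f' x v = (\<Sum>b\<in>Basis. (frechet_derivative T (at x) v \<bullet> b) *\<^sub>R frechet_derivative f (at (T x)) b)"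
    if "x \<in> S" for x v
  proof -
    have lin: "linear (frechet_derivative f (at (T x)))"
      using Ck_on_has_derivative[OF Suc.prems(2), of "T x"] assms(3) that has_derivative_linear by blast
    have "frechet_derivative T (at x) v = (\<Sum>b\<in>Basis. (frechet_derivative T (at x) v \<bullet> b) *\<^sub>R b)"
      by (simp add: euclidean_representation)
    then have "?f' x v = frechet_derivative f (at (T x)) (\<Sum>b\<in>Basis. (frechet_derivative T (at x) v \<bullet> b) *\<^sub>R b)"
      by simp
    also have "\<dots> = (\<Sum>b\<in>Basis. (frechet_derivative T (at x) v \<bullet> b) *\<^sub>R frechet_derivative f (at (T x)) b)"
      by (simp add: linear_sum[OF lin] linear_scale[OF lin])
    finally show ?thesis .
  qed
  have T: "Ck_on k S T" using Suc.prems(1) Ck_on_SucD by blast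
  have "Ck_on k S (\<lambda>x. \<Sum>b\<in>Basis. (frechet_derivative T (at x) v \<bullet> b) *\<^sub>R frechet_derivative f (at (T x)) b)" for v
    using Suc.prems
    by (intro Ck_on_sum[OF assms(1)] Ck_on_scaleR[OF assms(1)] Suc.IH[OF T]
        Ck_on_compose_bounded_linear[OF assms(1) bounded_linear_inner_left]) auto
  then have "Ck_on k S (\<lambda>x. ?f' x v)" for v
    using Ck_on_cong[OF assms(1), of "\<lambda>x. ?f' x v"] expand by simp
  with der show ?case by (rule Ck_on_SucI[OF assms(1)])
qed

lemma smooth_on_add: "open S \<Longrightarrow> smooth_on S f \<Longrightarrow> smooth_on S g \<Longrightarrow> smooth_on S (\<lambda>x. f x + g x)"
  by (simp add: smooth_on_def Ck_on_add)

lemma smooth_on_scaleR: "open S \<Longrightarrow> smooth_on S f \<Longrightarrow> smooth_on S g \<Longrightarrow> smooth_on S (\<lambda>x. f x *\<^sub>R g x)"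
  by (simp add: smooth_on_def Ck_on_scaleR)

lemma smooth_on_mult:
  fixes f g :: "'e::euclidean_space \<Rightarrow> real"
  shows "open S \<Longrightarrow> smooth_on S f \<Longrightarrow> smooth_on S g \<Longrightarrow> smooth_on S (\<lambda>x. f x * g x)"
  using smooth_on_scaleR[of S f g] by simp

lemma smooth_on_cmult:
  fixes f :: "'e::euclidean_space \<Rightarrow> real"
  shows "open S \<Longrightarrow> smooth_on S f \<Longrightarrow> smooth_on S (\<lambda>x. c * f x)"
  by (rule smooth_on_mult) auto

lemma smooth_on_minus:
  fixes f :: "'e::euclidean_space \<Rightarrow> real"
  shows "open S \<Longrightarrow> smooth_on S f \<Longrightarrow> smooth_on S (\<lambda>x. - f x)"
  using smooth_on_cmult[of S f "-1"] by simp

lemma smooth_on_diff: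
  fixes f :: "'e::euclidean_space \<Rightarrow> real"
  shows "open S \<Longrightarrow> smooth_on S f \<Longrightarrow> smooth_on S g \<Longrightarrow> smooth_on S (\<lambda>x. f x - g x)"
  using smooth_on_add[of S f "\<lambda>x. - g x"] smooth_on_minus[of S g] by simp

lemma smooth_on_sum:
  "open S \<Longrightarrow> (\<And>i. i \<in> A \<Longrightarrow> smooth_on S (f i)) \<Longrightarrow> smooth_on S (\<lambda>x. \<Sum>i\<in>A. f i x)"
  by (simp add: smooth_on_def Ck_on_sum)

lemma smooth_on_compose_bounded_linear:
  "open S \<Longrightarrow> bounded_linear L \<Longrightarrow> smooth_on S f \<Longrightarrow> smooth_on S (\<lambda>x. L (f x))"
  by (simp add: smooth_on_def Ck_on_compose_bounded_linear)

lemma smooth_on_compose: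
  fixes f :: "'b::euclidean_space \<Rightarrow> 'c::real_normed_vector" and T :: "'e::euclidean_space \<Rightarrow> 'b"
  assumes "open S" "open U" "T ` S \<subseteq> U" "smooth_on S T" "smooth_on U f"
  shows "smooth_on S (\<lambda>x. f (T x))"
  using assms by (simp add: smooth_on_def Ck_on_compose)

text \<open>\<open>W\<close> is the union of the open sets \<open>W - L\<close>, where
  \<open>f\<close> vanishes identically, and \<open>W \<inter> U\<close>. Products with a cutoff
  become globally smooth in this way although one factor is smooth only near the support.\<close>

lemma smooth_on_extend_zero:
  fixes f :: "'e::euclidean_space \<Rightarrow> 'b::real_normed_vector"
  assumes "open W" "open U" "smooth_on (W \<inter> U) f" "closed L" "L \<subseteq> U" "\<And>x. x \<in> W \<Longrightarrow> x \<notin> L \<Longrightarrow> f x = 0"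
  shows "smooth_on W f"
proof -
  have o: "open (W - L)" using assms by (simp add: open_Diff)
  have "smooth_on (W - L) f"
    using smooth_on_cong[OF o, of f "\<lambda>_. 0"] assms(6) by simp
  then have "smooth_on ((W - L) \<union> (W \<inter> U)) f"
    using assms o by (intro smooth_on_Un) auto
  then show ?thesis by (rule smooth_on_subset) (use assms in auto)
qed

section \<open>Smooth functions of one variable and bump functions\<close>

lemma Ck_on_Suc_real:
  fixes f :: "real \<Rightarrow> real"
  assumes "open S" "\<And>x. x \<in> S \<Longrightarrow> (f has_real_derivative f' x) (at x)" "Ck_on k S f'"
  shows "Ck_on (Suc k) S f"
proof (rule Ck_on_SucI[OF assms(1), where f'="\<lambda>x v. f' x * v"])
  fix v
  show "Ck_on k S (\<lambda>x. f' x * v)"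
    using Ck_on_scaleR[OF assms(1,3) Ck_on_const[of k S v]] by simp
qed (use assms(2) has_field_derivative_def in auto)

text \<open>The powers of \<open>inverse t\<close> close the family under differentiation, so
  smoothness of all members follows by one induction on the order; only \<open>m = 0\<close> is used
  for bumps.\<close>

definition bump_fun :: "nat \<Rightarrow> real \<Rightarrow> real" where
  "bump_fun m t = (if t > 0 then inverse t ^ m * exp (- inverse t) else 0)"

lemma tendsto_bump_fun: "(bump_fun m \<longlongrightarrow> 0) (at_right 0)"
proof -
  have "((\<lambda>u::real. u ^ m / exp u) \<longlongrightarrow> 0) at_top"
    by (rule tendsto_power_div_exp_0)
  then have "((\<lambda>t::real. inverse t ^ m / exp (inverse t)) \<longlongrightarrow> 0) (at_right 0)"
    by (rule filterlim_compose[OF _ filterlim_inverse_at_top_right])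
  then show ?thesis
    by (rule Lim_transform_eventually)
      (auto simp: bump_fun_def exp_minus divide_inverse eventually_at_right_less
        intro: eventually_mono[OF eventually_at_right_less[of 0]])
qed

lemma bump_fun_derivative:
  "(bump_fun m has_real_derivative (bump_fun (m + 2) t - m * bump_fun (m + 1) t)) (at t)"
proof -
  consider "t > 0" | "t < 0" | "t = 0" by linarith
  then show ?thesis
  proof cases
    case 1
    have "((\<lambda>t. inverse t ^ m * exp (- inverse t)) has_real_derivative
        (bump_fun (m + 2) t - m * bump_fun (m + 1) t)) (at t)"
    proof -
      have "((\<lambda>t. inverse t ^ m * exp (- inverse t)) has_real_derivative
          (real m * (- (inverse t)\<^sup>2 * inverse t ^ (m - 1)) * exp (- inverse t)
            + (inverse t)\<^sup>2 * exp (- inverse t) * inverse t ^ m)) (at t)"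
        using 1 by (auto intro!: derivative_eq_intros simp: power2_eq_square)
      moreover have "real m * (- (inverse t)\<^sup>2 * inverse t ^ (m - 1)) * exp (- inverse t)
            + (inverse t)\<^sup>2 * exp (- inverse t) * inverse t ^ m = bump_fun (m + 2) t - m * bump_fun (m + 1) t"
        using 1 by (cases m) (simp_all add: bump_fun_def power2_eq_square algebra_simps)
      ultimately show ?thesis by metis
    qed
    then show ?thesis
      by (rule has_field_derivative_transform_within_open[where S="{0<..}"]) (use 1 in \<open>auto simp: bump_fun_def\<close>)
  next
    case 2
    have "((\<lambda>t. 0) has_real_derivative (bump_fun (m + 2) t - m * bump_fun (m + 1) t)) (at t)"
      using 2 by (auto simp: bump_fun_def)
    then show ?thesis
      by (rule has_field_derivative_transform_within_open[where S="{..<0}"]) (use 2 in \<open>auto simp: bump_fun_def\<close>)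
  next
    case 3
    have "((\<lambda>h. (bump_fun m (0 + h) - bump_fun m 0) / h) \<longlongrightarrow> 0) (at 0)"
    proof (rule filterlim_split_at)
      show "((\<lambda>h. (bump_fun m (0 + h) - bump_fun m 0) / h) \<longlongrightarrow> 0) (at_left 0)"
        by (rule Lim_transform_eventually[OF tendsto_const])
          (auto simp: bump_fun_def eventually_at_filter)
      \<comment> \<open>For positive \<open>h\<close> the difference quotient at 0 is again a member
        of the family, \<open>bump_fun (m + 1) h\<close>.\<close>
      show "((\<lambda>h. (bump_fun m (0 + h) - bump_fun m 0) / h) \<longlongrightarrow> 0) (at_right 0)"
        by (rule Lim_transform_eventually[OF tendsto_bump_fun[of "m + 1"]])
          (auto simp: bump_fun_def field_simps intro: eventually_mono[OF eventually_at_right_less[of 0]])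
    qed
    then show ?thesis using 3 by (simp add: DERIV_def bump_fun_def)
  qed
qed

lemma smooth_on_bump_fun: "smooth_on UNIV (bump_fun m)"
proof -
  have "Ck_on k UNIV (bump_fun m)" for k
  proof (induction k arbitrary: m)
    case 0
    show ?case using DERIV_isCont[OF bump_fun_derivative]
      by (simp add: continuous_at_imp_continuous_on)
  next
    case (Suc k)
    have "Ck_on k UNIV (\<lambda>t. bump_fun (m + 2) t + (- real m) *\<^sub>R bump_fun (m + 1) t)"
      by (intro Ck_on_add Ck_on_scaleR Ck_on_const Suc.IH) auto
    then show ?case
      by (intro Ck_on_Suc_real[where f'="\<lambda>t. bump_fun (m + 2) t - real m * bump_fun (m + 1) t"])
        (auto intro: bump_fun_derivative[simplified])
  qed
  then show ?thesis by (simp add: smooth_on_def)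
qed

lemma smooth_on_exp: "smooth_on UNIV (exp :: real \<Rightarrow> real)"
proof -
  have "Ck_on k UNIV (exp :: real \<Rightarrow> real)" for k
  proof (induction k)
    case 0
    then show ?case by (simp add: continuous_on_exp)
  next
    case (Suc k)
    then show ?case by (intro Ck_on_Suc_real[where f'=exp]) (auto intro: DERIV_exp)
  qed
  then show ?thesis by (simp add: smooth_on_def)
qed

lemma inverse_power_derivative:
  fixes x :: real
  assumes "0 < x"
  shows "((\<lambda>x. inverse x ^ m) has_real_derivative - (real m * (inverse x * inverse x ^ m))) (at x)"
proof -
  have "((\<lambda>x. inverse x ^ m) has_real_derivative
      (real m * (- (inverse x)\<^sup>2 * inverse x ^ (m - 1)))) (at x)"
    using assms by (auto intro!: derivative_eq_intros simp: power2_eq_square)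
  moreover have "real m * (- (inverse x)\<^sup>2 * inverse x ^ (m - 1)) = - (real m * (inverse x * inverse x ^ m))"
    by (cases m) (auto simp: power2_eq_square)
  ultimately show ?thesis by metis
qed

text \<open>Again a family closed under differentiation: all powers of \<open>inverse\<close> are
  treated at once. It serves to normalise the partition of unity.\<close>

lemma smooth_on_inverse_pos: "smooth_on {0<..} (inverse :: real \<Rightarrow> real)"
proof -
  have "Ck_on k {0<..} (\<lambda>x::real. inverse x ^ m)" for k m
  proof (induction k arbitrary: m)
    case 0
    then show ?case by (auto intro!: continuous_intros)
  next
    case (Suc k)
    have "Ck_on k {0<..} (\<lambda>x::real. (- real m) *\<^sub>R inverse x ^ (m + 1))"
      by (intro Ck_on_scaleR Ck_on_const Suc.IH) auto
    then show ?case
      by (intro Ck_on_Suc_real[where f'="\<lambda>x. - real m * inverse x ^ (m + 1)"])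
        (auto intro: inverse_power_derivative)
  qed
  from this[of _ 1] show ?thesis by (simp add: smooth_on_def)
qed

lemma ex_bump:
  fixes x :: "'e::euclidean_space"
  assumes "0 < e"
  shows "\<exists>f::'e \<Rightarrow> real. smooth_on UNIV f \<and> (\<forall>y. 0 \<le> f y) \<and> (\<forall>y\<in>ball x e. 0 < f y) \<and>
           (\<forall>y. y \<notin> cball x e \<longrightarrow> f y = 0)"
proof -
  \<comment> \<open>This is \<open>e\<^sup>2 - (dist x y)\<^sup>2\<close>, written as a polynomial
    in the coordinates so that its smoothness is immediate.\<close>
  let ?q = "\<lambda>y. e\<^sup>2 - (\<Sum>b\<in>Basis. (y \<bullet> b - x \<bullet> b) * (y \<bullet> b - x \<bullet> b))"
  have q: "?q y = e\<^sup>2 - (dist x y)\<^sup>2" for y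
  proof -
    have "(dist x y)\<^sup>2 = (y - x) \<bullet> (y - x)"
      by (metis dist_commute dist_norm power2_norm_eq_inner)
    also have "\<dots> = (\<Sum>b\<in>Basis. (y \<bullet> b - x \<bullet> b) * (y \<bullet> b - x \<bullet> b))"
      by (subst euclidean_inner) (simp add: inner_diff_left)
    finally show ?thesis by simp
  qed
  have "smooth_on UNIV ?q"
    by (intro smooth_on_diff smooth_on_sum smooth_on_mult smooth_on_const
        smooth_on_bounded_linear bounded_linear_inner_left) auto
  then have s: "smooth_on UNIV (\<lambda>y. bump_fun 0 (?q y))"
    by (intro smooth_on_compose[OF _ _ _ _ smooth_on_bump_fun]) auto
  have "0 < ?q y \<longleftrightarrow> dist x y < e" for y
    unfolding q using assms abs_le_square_iff[of e "dist x y"] by (simp add: not_le[symmetric])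
  then show ?thesis
    by (intro exI[of _ "\<lambda>y. bump_fun 0 (?q y)"] conjI s) (auto simp: bump_fun_def)
qed

section \<open>Cutoff functions and the contact frame\<close>

text \<open>A sum of bumps over a finite subcover of \<open>L\<close> by balls whose closures lie in
  \<open>W\<close>; the union of the closed balls is the compact set \<open>L'\<close>.\<close>

lemma smooth_pos_on_compact:
  fixes L W :: "'e::euclidean_space set"
  assumes "compact L" "L \<subseteq> W" "open W"
  obtains S :: "'e \<Rightarrow> real" and L' where "smooth_on UNIV S" "\<And>x. 0 \<le> S x" "\<And>x. x \<in> L \<Longrightarrow> 0 < S x"
    "compact L'" "L' \<subseteq> W" "\<And>x. x \<notin> L' \<Longrightarrow> S x = 0"
proof -
  have "\<exists>e>0. cball x e \<subseteq> W" if "x \<in> L" for x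
    using assms that open_contains_cball by blast
  then obtain e where e: "\<And>x. x \<in> L \<Longrightarrow> 0 < e x" "\<And>x. x \<in> L \<Longrightarrow> cball x (e x) \<subseteq> W"
    by metis
  have "\<exists>f. smooth_on UNIV f \<and> (\<forall>y. 0 \<le> f y) \<and> (\<forall>y\<in>ball x (e x). 0 < f y) \<and>
           (\<forall>y. y \<notin> cball x (e x) \<longrightarrow> f y = (0::real))" if "x \<in> L" for x
    using ex_bump[OF e(1)[OF that]] .
  then obtain f where f: "\<And>x. x \<in> L \<Longrightarrow> smooth_on UNIV (f x)" "\<And>x y. x \<in> L \<Longrightarrow> 0 \<le> f x y"
      "\<And>x y. x \<in> L \<Longrightarrow> y \<in> ball x (e x) \<Longrightarrow> 0 < f x y"
      "\<And>x y. x \<in> L \<Longrightarrow> y \<notin> cball x (e x) \<Longrightarrow> f x y = (0::real)"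
    by metis
  obtain F where F: "F \<subseteq> L" "finite F" "L \<subseteq> (\<Union>x\<in>F. ball x (e x))"
    using compactE_image[OF assms(1), of L "\<lambda>x. ball x (e x)"] e(1) by (metis (no_types, lifting)
        UN_iff centre_in_ball open_ball subsetI)
  show ?thesis
  proof
    show "smooth_on UNIV (\<lambda>y. \<Sum>x\<in>F. f x y)"
      using F f by (intro smooth_on_sum) auto
    show "0 \<le> (\<Sum>x\<in>F. f x y)" for y
      using F f by (intro sum_nonneg) auto
    show "0 < (\<Sum>x\<in>F. f x y)" if y: "y \<in> L" for y
    proof -
      obtain x where "x \<in> F" "y \<in> ball x (e x)" using F y by blast
      then show ?thesis using F f by (intro sum_pos2[of F x]) (auto simp: subset_iff)
    qed
    show "compact (\<Union>x\<in>F. cball x (e x))" using F by (intro compact_UN) auto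
    show "(\<Union>x\<in>F. cball x (e x)) \<subseteq> W" using F e by blast
    show "(\<Sum>x\<in>F. f x y) = 0" if "y \<notin> (\<Union>x\<in>F. cball x (e x))" for y
    proof (intro sum.neutral ballI)
      fix x assume x: "x \<in> F"
      then show "f x y = 0" using f(4)[of x y] F(1) that by blast
    qed
  qed
qed

lemma set_integrable_continuous:
  fixes f :: "'e::euclidean_space \<Rightarrow> real"
  assumes "compact K" "D \<subseteq> K" "D \<in> sets lebesgue" "continuous_on K f"
  shows "set_integrable lebesgue D f"
proof -
  have "integrable lborel (\<lambda>x. indicator K x *\<^sub>R f x)"
    by (rule borel_integrable_compact[OF assms(1,4)])
  then have "set_integrable lebesgue K f"
    unfolding set_integrable_def using integrable_completion by blast
  then show ?thesis using set_integrable_subset assms(2,3) by blast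
qed

text \<open>For cutting off in L^2 a plateau of height 1 is more than is asked. With
  \<open>S\<close> positive on a compact \<open>K\<close> that fills \<open>D\<close> up to small
  measure, \<open>1 - exp (- m S)\<close> vanishes wherever \<open>S\<close> does and is as close to
  1 on \<open>K\<close> as desired for large \<open>m\<close>.\<close>

lemma smooth_cutoff:
  fixes D :: "'e::euclidean_space set"
  assumes "open D" "bounded D" "0 < e"
  obtains \<xi> :: "'e \<Rightarrow> real" and L where "smooth_on UNIV \<xi>" "\<And>x. 0 \<le> \<xi> x" "\<And>x. \<xi> x \<le> 1"
    "compact L" "L \<subseteq> D" "\<And>x. x \<notin> L \<Longrightarrow> \<xi> x = 0"
    "(LINT x:D|lebesgue. (1 - \<xi> x)\<^sup>2) \<le> e"
proof -
  have Dm: "D \<in> lmeasurable"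
    using assms by (intro bounded_set_imp_lmeasurable) auto
  obtain K where K': "closed K" "K \<subseteq> D" "D - K \<in> lmeasurable" "emeasure lebesgue (D - K) < ennreal (e / 2)"
    using sets_lebesgue_inner_closed[of D "e / 2"] assms Dm by (auto simp: fmeasurableD)
  have K: "K \<in> lmeasurable" "compact K" "K \<subseteq> D" "measure lebesgue (D - K) < e / 2"
    using K' assms bounded_subset[of D K]
    by (auto simp: compact_eq_bounded_closed lmeasurable_compact emeasure_eq_measure2 ennreal_less_iff)
  obtain S :: "'e \<Rightarrow> real" and L where S: "smooth_on UNIV S" "\<And>x. 0 \<le> S x" "\<And>x. x \<in> K \<Longrightarrow> 0 < S x"
    "compact L" "L \<subseteq> D" "\<And>x. x \<notin> L \<Longrightarrow> S x = 0"
    using smooth_pos_on_compact[OF K(2,3) assms(1)] by metis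
  obtain d where d: "0 < d" "\<And>x. x \<in> K \<Longrightarrow> d \<le> S x"
  proof (cases "K = {}")
    case False
    then obtain x where "x \<in> K" "\<And>y. y \<in> K \<Longrightarrow> S x \<le> S y"
      using continuous_attains_inf[OF K(2) False, of S] smooth_on_imp_continuous_on[OF S(1)]
        continuous_on_subset by blast
    then show ?thesis using that[of "S x"] S(3) by blast
  qed (use that[of 1] in auto)
  define \<mu> where "\<mu> = measure lebesgue D"
  have mu: "0 \<le> \<mu>" by (simp add: \<mu>_def)
  have "((\<lambda>m. exp (- (real m * d)) * \<mu>) \<longlonglongrightarrow> 0 * \<mu>)"
  proof (rule tendsto_mult_right)
    have "(\<lambda>m. exp (- d) ^ m) \<longlonglongrightarrow> 0" using d by (intro LIMSEQ_realpow_zero) auto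
    then show "(\<lambda>m. exp (- (real m * d))) \<longlonglongrightarrow> 0" by (simp add: exp_of_nat_mult[symmetric])
  qed
  then have "\<forall>\<^sub>F m in sequentially. exp (- (real m * d)) * \<mu> < e / 2"
    using assms(3) by (intro order_tendstoD) auto
  then obtain m where m: "exp (- (real m * d)) * \<mu> < e / 2"
    using eventually_happens by force
  \<comment> \<open>On \<open>K\<close> the square of \<open>1 - \<xi>\<close> is at most
    \<open>exp (- m d)\<close>, which contributes less than \<open>e / 2\<close> by the choice of
    \<open>m\<close>; on \<open>D - K\<close> it is at most 1, and that set has measure below
    \<open>e / 2\<close>.\<close>
  define \<xi> where "\<xi> = (\<lambda>x. 1 - exp (- real m * S x))"
  have sm: "smooth_on UNIV \<xi>" unfolding \<xi>_def
    by (intro smooth_on_diff smooth_on_const smooth_on_compose[OF _ _ _ _ smooth_on_exp] smooth_on_cmult S) auto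
  have "(LINT x:D|lebesgue. (1 - \<xi> x)\<^sup>2)
      \<le> (LINT x:D|lebesgue. indicator (D - K) x + exp (- (real m * d)))"
  proof (rule set_integral_mono)
    have c: "continuous_on UNIV (\<lambda>x. (1 - \<xi> x)\<^sup>2)"
      by (intro continuous_intros smooth_on_imp_continuous_on[OF sm])
    show "set_integrable lebesgue D (\<lambda>x. (1 - \<xi> x)\<^sup>2)"
      using assms(1,2) by (intro set_integrable_continuous[of "closure D"] continuous_on_subset[OF c])
        (auto simp: closure_subset)
    have "(\<lambda>x. indicator D x *\<^sub>R (indicator (D - K) x + exp (- (real m * d)))) =
       (\<lambda>x. indicator (D - K) x + exp (- (real m * d)) * indicator D x)"
      by (auto simp: indicator_def)
    moreover have "integrable lebesgue (indicator (D - K) :: 'e \<Rightarrow> real)"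
        "integrable lebesgue (indicator D :: 'e \<Rightarrow> real)"
      using Dm K'(3) by (auto simp: lmeasurable_iff_integrable)
    ultimately show "set_integrable lebesgue D (\<lambda>x. indicator (D - K) x + exp (- (real m * d)))"
      unfolding set_integrable_def by simp
    fix x assume "x \<in> D"
    show "(1 - \<xi> x)\<^sup>2 \<le> indicator (D - K) x + exp (- (real m * d))"
    proof (cases "x \<in> K")
      case True
      have "(1 - \<xi> x)\<^sup>2 \<le> (1 - \<xi> x) * 1"
        unfolding power2_eq_square using S(2)[of x] by (intro mult_left_mono) (auto simp: \<xi>_def)
      also have "\<dots> \<le> exp (- (real m * d))"
        using d(2)[OF True] by (simp add: \<xi>_def mult_left_mono)
      finally show ?thesis by (simp add: indicator_def True)
    next
      case False
      have "(1 - \<xi> x)\<^sup>2 \<le> 1" using S(2)[of x] by (simp add: \<xi>_def power_le_one_iff)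
      then show ?thesis using False \<open>x \<in> D\<close> by (simp add: add_increasing2)
    qed
  qed
  also have "\<dots> = measure lebesgue (D - K) + exp (- (real m * d)) * \<mu>"
  proof -
    have "(\<lambda>x. indicator D x *\<^sub>R (indicator (D - K) x + exp (- (real m * d)))) =
       (\<lambda>x. indicator (D - K) x + exp (- (real m * d)) * indicator D x)"
      by (auto simp: indicator_def)
    moreover have "integrable lebesgue (indicator (D - K) :: 'e \<Rightarrow> real)"
        "integrable lebesgue (indicator D :: 'e \<Rightarrow> real)"
      using Dm K'(3) by (auto simp: lmeasurable_iff_integrable)
    ultimately show ?thesis unfolding set_lebesgue_integral_def
      by (simp add: \<mu>_def)
  qed
  also have "\<dots> \<le> e" using K(4) m by simp
  finally have "(LINT x:D|lebesgue. (1 - \<xi> x)\<^sup>2) \<le> e" .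
  then show ?thesis
    using that[of \<xi> L] sm S by (auto simp: \<xi>_def)
qed


section \<open>The frame fields as differential operators\<close>

definition bcoord :: "'n::finite \<Rightarrow> 'n R2n1 \<Rightarrow> real" where
  "bcoord j x = fst (snd x) $ j"

lemma bounded_linear_bcoord: "bounded_linear (bcoord j)"
  unfolding bcoord_def
  by (intro bounded_linear_compose[OF bounded_linear_vec_nth]
      bounded_linear_compose[OF bounded_linear_fst] bounded_linear_snd)

lemma smooth_on_bcoord: "open S \<Longrightarrow> smooth_on S (bcoord j)"
  by (rule smooth_on_bounded_linear[OF _ bounded_linear_bcoord])

lemma X_field_Inl:
  assumes "f differentiable (at x)"
  shows "X_field (Inl j) f x = frechet_derivative f (at x) (coord_vec (Some (Inl j)))
    + bcoord j x *\<^sub>R frechet_derivative f (at x) (coord_vec None)"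
proof -
  have "linear (frechet_derivative f (at x))"
    using assms by (simp add: linear_frechet_derivative)
  then show ?thesis by (simp add: X_field_def bcoord_def linear_add linear_scale del: coord_vec.simps)
qed

lemma X_field_Inr: "X_field (Inr j) f x = frechet_derivative f (at x) (coord_vec (Some (Inr j)))"
  by (simp add: X_field_def)

lemma smooth_on_X_field:
  assumes "open S" "smooth_on S f"
  shows "smooth_on S (X_field i f)"
proof (cases i)
  case (Inl j)
  have "smooth_on S (\<lambda>x. frechet_derivative f (at x) (coord_vec (Some (Inl j)))
    + bcoord j x *\<^sub>R frechet_derivative f (at x) (coord_vec None))"
    by (rule smooth_on_add[OF assms(1) smooth_on_frechet_derivative[OF assms(2)]
          smooth_on_scaleR[OF assms(1) smooth_on_bcoord[OF assms(1)] smooth_on_frechet_derivative[OF assms(2)]]])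
  moreover have "X_field (Inl j) f x = frechet_derivative f (at x) (coord_vec (Some (Inl j)))
    + bcoord j x *\<^sub>R frechet_derivative f (at x) (coord_vec None)" if "x \<in> S" for x
    by (rule X_field_Inl[OF smooth_on_imp_differentiable[OF assms(2) that]])
  ultimately show ?thesis unfolding Inl by (subst smooth_on_cong[OF assms(1)])
next
  case (Inr j)
  show ?thesis unfolding Inr X_field_Inr[abs_def]
    by (rule smooth_on_frechet_derivative[OF assms(2)])
qed

lemma X_multi_Nil [simp]: "X_multi [] f = f"
  by (simp add: X_multi_def)

lemma X_multi_Cons [simp]: "X_multi (i # I) f = X_field i (X_multi I f)"
  by (simp add: X_multi_def)

lemma X_multi_append: "X_multi (I @ J) f = X_multi I (X_multi J f)"
  by (simp add: X_multi_def)

lemma smooth_on_X_multi: "open S \<Longrightarrow> smooth_on S f \<Longrightarrow> smooth_on S (X_multi I f)"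
  by (induction I) (auto intro: smooth_on_X_field)

lemma X_field_cong:
  "open S \<Longrightarrow> x \<in> S \<Longrightarrow> (\<And>y. y \<in> S \<Longrightarrow> f y = g y) \<Longrightarrow> X_field i f x = X_field i g x"
  unfolding X_field_def by (metis frechet_derivative_cong_open)

lemma X_multi_cong:
  "open S \<Longrightarrow> x \<in> S \<Longrightarrow> (\<And>y. y \<in> S \<Longrightarrow> f y = g y) \<Longrightarrow> X_multi I f x = X_multi I g x"
  by (induction I arbitrary: x) (auto intro: X_field_cong)

lemma X_field_eqI: "(f has_derivative f') (at x) \<Longrightarrow> X_field i f x = f' (contact_frame i x)"
  by (simp add: X_field_def frechet_derivative_eqI)

lemma X_field_const [simp]: "X_field i (\<lambda>x. c) x = 0"
  by (simp add: X_field_def frechet_derivative_const)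

lemma X_field_add:
  assumes "f differentiable (at x)" "g differentiable (at x)"
  shows "X_field i (\<lambda>x. f x + g x) x = X_field i f x + X_field i g x"
  by (subst X_field_eqI[OF has_derivative_add[OF assms[unfolded frechet_derivative_works]]])
    (simp add: X_field_def)

lemma X_field_mult:
  fixes f g :: "'n::finite R2n1 \<Rightarrow> real"
  assumes "f differentiable (at x)" "g differentiable (at x)"
  shows "X_field i (\<lambda>x. f x * g x) x = X_field i f x * g x + f x * X_field i g x"
  by (subst X_field_eqI[OF has_derivative_mult[OF assms[unfolded frechet_derivative_works]]])
    (simp add: X_field_def algebra_simps)

lemma X_field_cmult:
  fixes f :: "'n::finite R2n1 \<Rightarrow> real"
  assumes "f differentiable (at x)"
  shows "X_field i (\<lambda>x. c * f x) x = c * X_field i f x"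
  using X_field_mult[OF differentiable_const assms, of i c] by simp

lemma X_field_sum:
  assumes "\<And>a. a \<in> A \<Longrightarrow> f a differentiable (at x)"
  shows "X_field i (\<lambda>x. \<Sum>a\<in>A. f a x) x = (\<Sum>a\<in>A. X_field i (f a) x)"
  using assms
  by (induction A rule: infinite_finite_induct) (auto simp: X_field_add)

context
  fixes S :: "'n::finite R2n1 set"
  assumes S: "open S"
begin

lemma X_multi_add:
  assumes "smooth_on S f" "smooth_on S g" "x \<in> S"
  shows "X_multi I (\<lambda>x. f x + g x) x = X_multi I f x + X_multi I g x"
  using assms(3)
proof (induction I arbitrary: x)
  case (Cons i I)
  have "X_multi (i # I) (\<lambda>x. f x + g x) x = X_field i (\<lambda>x. X_multi I f x + X_multi I g x) x"
    using Cons by (auto intro: X_field_cong[OF S])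
  then show ?case
    using X_field_add[OF smooth_on_imp_differentiable[OF smooth_on_X_multi[OF S assms(1)] Cons.prems]
      smooth_on_imp_differentiable[OF smooth_on_X_multi[OF S assms(2)] Cons.prems]] by simp
qed auto

lemma X_multi_cmult:
  fixes f :: "'n R2n1 \<Rightarrow> real"
  assumes "smooth_on S f" "x \<in> S"
  shows "X_multi I (\<lambda>x. c * f x) x = c * X_multi I f x"
  using assms(2)
proof (induction I arbitrary: x)
  case (Cons i I)
  have "X_multi (i # I) (\<lambda>x. c * f x) x = X_field i (\<lambda>x. c * X_multi I f x) x"
    using Cons by (auto intro: X_field_cong[OF S])
  then show ?case
    using X_field_cmult[OF smooth_on_imp_differentiable[OF smooth_on_X_multi[OF S assms(1)] Cons.prems]]
    by simp
qed auto

lemma X_multi_diff: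
  fixes f g :: "'n R2n1 \<Rightarrow> real"
  assumes "smooth_on S f" "smooth_on S g" "x \<in> S"
  shows "X_multi I (\<lambda>x. f x - g x) x = X_multi I f x - X_multi I g x"
  using X_multi_add[OF assms(1) smooth_on_cmult[OF S assms(2), of "-1"] assms(3)]
    X_multi_cmult[OF assms(2,3), of I "-1"] by simp

end

section \<open>The volume form\<close>

text \<open>The matrix of \<open>d\<eta>\<^sub>0\<close> in the coordinate basis: the standard
  symplectic form on the first \<open>2n\<close> coordinates, with the last coordinate direction in
  its kernel.\<close>

fun symp :: "('n + 'n) option \<Rightarrow> ('n + 'n) option \<Rightarrow> real" where
  "symp (Some (Inl i)) (Some (Inr j)) = of_bool (i = j)"
| "symp (Some (Inr i)) (Some (Inl j)) = - of_bool (i = j)"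
| "symp _ _ = 0"

lemma symp_antisym: "symp p q = - symp q p"
  by (cases "(p, q)" rule: symp.cases) auto

lemma symp_nonzero:
  "symp p q \<noteq> 0 \<Longrightarrow> (\<exists>i. p = Some (Inl i) \<and> q = Some (Inr i)) \<or> (\<exists>i. p = Some (Inr i) \<and> q = Some (Inl i))"
  by (cases "(p, q)" rule: symp.cases) (auto split: if_splits)

lemma has_derivative_eta0: "((\<lambda>y. eta0 y w) has_derivative (\<lambda>v. - (\<Sum>j\<in>UNIV. bcoord j v * fst w $ j))) (at x)"
proof -
  have e: "(\<lambda>y. eta0 y w) = (\<lambda>y. snd (snd w) - (\<Sum>j\<in>UNIV. bcoord j y * fst w $ j))"
    by (auto simp: eta0_def bcoord_def split: prod.splits)
  show ?thesis unfolding e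
    by (auto intro!: derivative_eq_intros bounded_linear_imp_has_derivative bounded_linear_bcoord)
qed

lemma ext_deriv_eta0:
  "ext_deriv eta0 x v w = (\<Sum>j\<in>UNIV. bcoord j w * fst v $ j) - (\<Sum>j\<in>UNIV. bcoord j v * fst w $ j)"
  unfolding ext_deriv_def by (simp add: frechet_derivative_eqI[OF has_derivative_eta0])

lemma ext_deriv_coord_vec:
  fixes x :: "'a::finite R2n1"
  shows "ext_deriv eta0 x (coord_vec p) (coord_vec q) = symp p q"
proof -
  have "ext_deriv eta0 x v w = fst (snd w) \<bullet> fst v - fst (snd v) \<bullet> fst w" for v w :: "'a R2n1"
    by (simp add: ext_deriv_eta0 inner_vec_def bcoord_def)
  then show ?thesis
    by (cases "(p, q)" rule: symp.cases) (auto simp: inner_axis_axis)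
qed

text \<open>If the product does not vanish, \<open>\<sigma>\<close> permutes the pairs \<open>{j, n+j}\<close> and swaps some of them. A swap
  changes the sign of \<open>\<sigma>\<close> and of one factor; without swaps \<open>\<sigma>\<close> acts in the same way on \<open>1, \<dots>, n\<close> and on
  \<open>n+1, \<dots>, 2n\<close>, hence is even.\<close>

lemma sign_symp_nonneg:
  fixes \<sigma> :: "('n::finite + 'n) option \<Rightarrow> ('n + 'n) option"
  assumes "\<sigma> permutes UNIV"
  shows "0 \<le> of_int (sign \<sigma>) * (\<Prod>j\<in>UNIV. symp (\<sigma> (Some (Inl j))) (\<sigma> (Some (Inr j))))"
  using assms
proof (induction "card {j. \<exists>i. \<sigma> (Some (Inl j)) = Some (Inr i)}" arbitrary: \<sigma> rule: less_induct)
  case (less \<sigma>)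
  let ?A = "\<lambda>\<sigma>::('n + 'n) option \<Rightarrow> ('n + 'n) option. {j. \<exists>i. \<sigma> (Some (Inl j)) = Some (Inr i)}"
  let ?P = "\<lambda>\<sigma>. \<Prod>j\<in>UNIV. symp (\<sigma> (Some (Inl j))) (\<sigma> (Some (Inr j)))"
  have perm: "permutation f" if "bij f" for f :: "('n + 'n) option \<Rightarrow> ('n + 'n) option"
    using that bij_imp_permutes[of f UNIV] by (auto simp: permutation_permutes intro: exI[of _ UNIV])
  show ?case
  proof (cases "?P \<sigma> = 0")
    case True
    then show ?thesis by (metis mult_zero_right order_refl)
  next
    case False
    then have nz: "symp (\<sigma> (Some (Inl j))) (\<sigma> (Some (Inr j))) \<noteq> 0" for j
      by (auto simp: prod_zero_iff)
    show ?thesis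
    proof (cases "?A \<sigma> = {}")
      case False
      then obtain j i where ji: "\<sigma> (Some (Inl j)) = Some (Inr i)" by blast
      then have ji': "\<sigma> (Some (Inr j)) = Some (Inl i)" using symp_nonzero[OF nz[of j]] by auto
      define \<tau> where "\<tau> = Transposition.transpose (Some (Inl j)) (Some (Inr j) :: ('n + 'n) option)"
      have bij: "bij (\<sigma> \<circ> \<tau>)"
        unfolding \<tau>_def by (intro bij_comp bij_transpose permutes_bij[OF less.prems])
      have "?A (\<sigma> \<circ> \<tau>) = ?A \<sigma> - {j}"
        using ji ji' by (auto simp: \<tau>_def Transposition.transpose_def)
      moreover have "j \<in> ?A \<sigma>" using ji by blast
      ultimately have "card (?A (\<sigma> \<circ> \<tau>)) < card (?A \<sigma>)"
        using card_Diff1_less[OF finite] by (simp only:)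
      then have "0 \<le> of_int (sign (\<sigma> \<circ> \<tau>)) * ?P (\<sigma> \<circ> \<tau>)"
        using less.hyps[of "\<sigma> \<circ> \<tau>"] bij bij_imp_permutes[of _ UNIV] by auto
      moreover have "sign (\<sigma> \<circ> \<tau>) = - sign \<sigma>"
        unfolding \<tau>_def
        by (subst sign_compose) (auto simp: sign_swap_id permutation_swap_id intro!: perm permutes_bij less.prems)
      moreover have "?P (\<sigma> \<circ> \<tau>) = - ?P \<sigma>"
      proof -
        have "?P (\<sigma> \<circ> \<tau>) = (\<Prod>k\<in>UNIV. (if k = j then - 1 else 1) * symp (\<sigma> (Some (Inl k))) (\<sigma> (Some (Inr k))))"
          using symp_antisym[of "\<sigma> (Some (Inr j))"] by (intro prod.cong) (auto simp: \<tau>_def Transposition.transpose_def)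
        then show ?thesis by (simp add: prod.distrib)
      qed
      ultimately show ?thesis by simp
    next
      case True
      have "\<exists>i. \<sigma> (Some (Inl j)) = Some (Inl i) \<and> \<sigma> (Some (Inr j)) = Some (Inr i)" for j
        using symp_nonzero[OF nz[of j]] True by blast
      then obtain t where t: "\<And>j. \<sigma> (Some (Inl j)) = Some (Inl (t j))" "\<And>j. \<sigma> (Some (Inr j)) = Some (Inr (t j))"
        by metis
      have N: "\<sigma> None = None"
      proof (rule ccontr)
        assume "\<sigma> None \<noteq> None"
        moreover obtain p where "\<sigma> p = None" using permutes_surj[OF less.prems] by (metis surjD)
        ultimately show False using t by (metis option.distinct(1) option.exhaust old.sum.exhaust)
      qed
      have inj: "inj t"
        by (rule injI) (metis t(1) permutes_inj[OF less.prems] injD option.inject sum.inject(1))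
      \<comment> \<open>\<open>k\<close> exchanges the two halves and \<open>L\<close> acts by
        \<open>t\<close> on the first half only, so the conjugate of \<open>L\<close> by
        \<open>k\<close> is the same action on the second half. In the sign of
        \<open>\<sigma> = L \<circ> (k \<circ> L \<circ> k)\<close> both \<open>k\<close> and
        \<open>L\<close> occur twice.\<close>
      define k :: "('n + 'n) option \<Rightarrow> ('n + 'n) option" where "k = map_option (case_sum Inr Inl)"
      define L :: "('n + 'n) option \<Rightarrow> ('n + 'n) option" where "L = map_option (map_sum t id)"
      have kk: "k \<circ> k = id" by (rule ext) (auto simp: k_def option.map_comp split: option.splits sum.splits intro!: option.map_ident_strong)
      have bk: "bij k" using kk by (metis bij_betw_def o_bij)
      have "inj (map_sum t (id :: 'n \<Rightarrow> 'n))" using inj by (intro sum.inj_map) auto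
      then have "inj L" unfolding L_def by (intro option.inj_map)
      then have bL: "bij L" by (simp add: bij_betw_def finite_UNIV_inj_surj)
      have "\<sigma> = L \<circ> (k \<circ> L \<circ> k)"
      proof
        fix p show "\<sigma> p = (L \<circ> (k \<circ> L \<circ> k)) p"
          by (cases p; cases "the p") (auto simp: N L_def k_def t)
      qed
      then have "sign \<sigma> = sign L * (sign k * sign L * sign k)"
        using perm bk bL by (simp add: sign_compose permutation_compose bij_comp)
      moreover have "sign k * sign k = 1" "sign L * sign L = 1"
        by (simp_all add: sign_def)
      ultimately have "sign \<sigma> = 1" by (simp add: mult_ac)
      then show ?thesis by (simp add: t)
    qed
  qed
qed

text \<open>Unless \<open>\<sigma>\<close> fixes \<open>None\<close>, the value \<open>None\<close>
  lands in a slot of the symplectic form and kills the product; if it does, \<open>eta0\<close> is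
  evaluated on the last coordinate vector, where it is 1 at every point. Hence the coefficient does
  not depend on \<open>x\<close>, and it is a sum of nonnegative terms.\<close>

lemma dV0_coeff_const:
  obtains c :: real where "0 < c" "\<And>x :: 'n::finite R2n1. dV0_coeff x = c"
proof -
  let ?P = "\<lambda>\<sigma>::('n + 'n) option \<Rightarrow> ('n + 'n) option. \<Prod>j\<in>UNIV. symp (\<sigma> (Some (Inl j))) (\<sigma> (Some (Inr j)))"
  define c where "c = (\<Sum>\<sigma> | \<sigma> permutes (UNIV :: ('n + 'n) option set). of_int (sign \<sigma>) * ?P \<sigma>)
     / 2 ^ CARD('n) / fact CARD('n)"
  have "eta0 x (coord_vec (\<sigma> None)) * ?P \<sigma> = ?P \<sigma>"
    if \<sigma>: "\<sigma> permutes (UNIV :: ('n + 'n) option set)" for \<sigma> and x :: "'n R2n1"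
  proof (cases "\<sigma> None")
    case None
    then show ?thesis by (simp add: eta0_def split: prod.splits)
  next
    case (Some _)
    obtain p where p: "\<sigma> p = None" using permutes_surj[OF \<sigma>] by (metis surjD)
    then obtain j where "p = Some (Inl j) \<or> p = Some (Inr j)"
      using Some by (metis option.distinct(1) option.exhaust old.sum.exhaust)
    then have "symp (\<sigma> (Some (Inl j))) (\<sigma> (Some (Inr j))) = 0"
      using p symp_nonzero by (metis option.distinct(1))
    then have "?P \<sigma> = 0" by (meson UNIV_I finite prod_zero)
    then show ?thesis by simp
  qed
  then have const: "dV0_coeff x = c" for x :: "'n R2n1"
    unfolding dV0_coeff_def wedge_power_def c_def ext_deriv_coord_vec
    by (intro arg_cong2[of _ _ _ _ "(/)"] refl sum.cong) (simp add: mult.assoc)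
  \<comment> \<open>The identity contributes 1, so the sum of nonnegative terms is positive.\<close>
  have "(\<Sum>\<sigma>\<in>{id}. of_int (sign \<sigma>) * ?P \<sigma>)
      \<le> (\<Sum>\<sigma> | \<sigma> permutes (UNIV :: ('n + 'n) option set). of_int (sign \<sigma>) * ?P \<sigma>)"
    using sign_symp_nonneg by (intro sum_mono2 finite_permutations) (auto simp: permutes_id)
  then have "0 < c" by (simp add: c_def)
  then show ?thesis using that[of c] const by simp
qed

lemma dV0_eq:
  shows "0 < dV0_coeff (0 :: 'n::finite R2n1)"
    and "(dV0 :: 'n R2n1 measure) = density lebesgue (\<lambda>_. ennreal (dV0_coeff (0 :: 'n R2n1)))"
proof -
  obtain c where c: "0 < c" "\<And>x :: 'n R2n1. dV0_coeff x = c"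
    by (rule dV0_coeff_const) blast
  then show "0 < dV0_coeff (0 :: 'n R2n1)"
    and "(dV0 :: 'n R2n1 measure) = density lebesgue (\<lambda>_. ennreal (dV0_coeff (0 :: 'n R2n1)))"
    by (simp_all add: dV0_def)
qed

section \<open>Integration by parts\<close>

lemma cauchy_schwarz_integral:
  fixes f g :: "'a \<Rightarrow> real"
  assumes [measurable]: "f \<in> borel_measurable M" "g \<in> borel_measurable M"
    and f: "integrable M (\<lambda>x. (f x)\<^sup>2)" and g: "integrable M (\<lambda>x. (g x)\<^sup>2)"
  shows "integrable M (\<lambda>x. f x * g x)"
    and "\<bar>\<integral>x. f x * g x \<partial>M\<bar> \<le> sqrt (\<integral>x. (f x)\<^sup>2 \<partial>M) * sqrt (\<integral>x. (g x)\<^sup>2 \<partial>M)"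
proof -
  have young: "2 * \<bar>a * b\<bar> \<le> a\<^sup>2 + b\<^sup>2" for a b :: real
    using zero_le_power2[of "\<bar>a\<bar> - \<bar>b\<bar>"] by (simp add: power2_eq_square algebra_simps abs_mult)
  have fg: "norm (f x * g x) \<le> norm ((f x)\<^sup>2 + (g x)\<^sup>2)" for x
    using young[of "f x" "g x"] zero_le_power2[of "f x"] zero_le_power2[of "g x"]
    unfolding real_norm_def by linarith
  show i: "integrable M (\<lambda>x. f x * g x)"
    by (rule Bochner_Integration.integrable_bound[OF Bochner_Integration.integrable_add[OF f g]])
      (use fg in auto)
  define A B C where "A = (\<integral>x. (f x)\<^sup>2 \<partial>M)" and "B = (\<integral>x. (g x)\<^sup>2 \<partial>M)" and "C = (\<integral>x. f x * g x \<partial>M)"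
  have AB: "0 \<le> A" "0 \<le> B" by (simp_all add: A_def B_def)
  \<comment> \<open>Cauchy-Schwarz by the discriminant. The form is evaluated at
    \<open>(B, -C)\<close>, and for \<open>B = 0\<close> at \<open>(C, -(A + 1))\<close>, where it
    would be negative unless \<open>C = 0\<close>.\<close>
  have q: "0 \<le> s\<^sup>2 * A + 2 * s * t * C + t\<^sup>2 * B" for s t
  proof -
    have "0 \<le> (\<integral>x. (s * f x + t * g x)\<^sup>2 \<partial>M)" by simp
    also have "(\<lambda>x. (s * f x + t * g x)\<^sup>2) = (\<lambda>x. s\<^sup>2 * (f x)\<^sup>2 + (2 * s * t) * (f x * g x) + t\<^sup>2 * (g x)\<^sup>2)"
      by (auto simp: power2_eq_square algebra_simps)
    also have "(\<integral>x. \<dots> x \<partial>M) = s\<^sup>2 * A + 2 * s * t * C + t\<^sup>2 * B"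
      unfolding A_def B_def C_def using f g i by simp
    finally show ?thesis .
  qed
  have "C\<^sup>2 \<le> A * B"
  proof (cases "B = 0")
    case True
    show ?thesis
    proof (cases "C = 0")
      case False
      have "0 \<le> C\<^sup>2 * (- A - 2)"
        using q[of C "- (A + 1)"] True by (simp add: power2_eq_square algebra_simps)
      then have "C\<^sup>2 \<le> 0" using AB by (simp add: zero_le_mult_iff)
      then show ?thesis using False by simp
    qed (use AB in auto)
  next
    case False
    have "0 \<le> B * (A * B - C\<^sup>2)"
      using q[of B "- C"] by (simp add: power2_eq_square algebra_simps)
    then show ?thesis using False AB by (simp add: zero_le_mult_iff)
  qed
  then have "sqrt (C\<^sup>2) \<le> sqrt (A * B)" by (rule real_sqrt_le_mono)
  then show "\<bar>\<integral>x. f x * g x \<partial>M\<bar> \<le> sqrt (\<integral>x. (f x)\<^sup>2 \<partial>M) * sqrt (\<integral>x. (g x)\<^sup>2 \<partial>M)"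
    by (simp add: A_def B_def C_def real_sqrt_mult)
qed

lemma integrable_lborel_compact_support:
  fixes h :: "'e::euclidean_space \<Rightarrow> real"
  assumes "compact L" "continuous_on L h" "\<And>x. x \<notin> L \<Longrightarrow> h x = 0"
  shows "integrable lborel h"
proof -
  have "(\<lambda>x. indicator L x *\<^sub>R h x) = h"
    using assms(3) by (intro ext) (auto simp: indicator_def)
  then show ?thesis using borel_integrable_compact[OF assms(1,2)] by simp
qed

lemma lborel_integral_eq_box:
  fixes h :: "'e::euclidean_space \<Rightarrow> real"
  assumes "continuous_on (cbox l u) h" "\<And>x. x \<notin> cbox l u \<Longrightarrow> h x = 0"
  shows "(LINT x|lborel. h x) = integral (cbox l u) h"
proof -
  have "integrable lborel h"
    using integrable_lborel_compact_support[OF compact_cbox assms] .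
  then have "(LINT x|lborel. h x) = integral UNIV h" by (simp add: integral_lborel)
  also have "\<dots> = integral UNIV (\<lambda>x. if x \<in> cbox l u then h x else 0)"
    by (rule arg_cong[where f="integral UNIV"]) (use assms(2) in auto)
  finally show ?thesis by (simp add: integral_restrict_UNIV)
qed

lemma lborel_integral_translate:
  fixes h :: "'e::euclidean_space \<Rightarrow> real"
  assumes "h \<in> borel_measurable borel"
  shows "(LINT x|lborel. h (x + v)) = (LINT x|lborel. h x)"
  using integral_distr[of "(+) v" lborel borel h] assms by (simp add: lborel_distr_plus add.commute)

text \<open>The integral of \<open>h (x + t v)\<close> is constant in \<open>t\<close> by
  translation invariance; differentiation under the integral sign at \<open>t = 0\<close> gives the
  claim.\<close>

lemma integral_frechet_derivative_eq_0:
  fixes h :: "'e::euclidean_space \<Rightarrow> real"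
  assumes sm: "smooth_on UNIV h" and L: "compact L" "\<And>x. x \<notin> L \<Longrightarrow> h x = 0"
  shows "(LINT x|lborel. frechet_derivative h (at x) v) = 0"
proof -
  \<comment> \<open>The region swept by the support during the translations with parameter in
    \<open>[-1, 1]\<close>. A box around it serves all these \<open>t\<close> at once, which turns
    the integrals into integrals over a fixed box.\<close>
  let ?K = "(\<lambda>(x, t). x - t *\<^sub>R v) ` (L \<times> {-1..1})"
  have "compact ?K"
    by (intro compact_continuous_image compact_Times L) (auto intro!: continuous_intros simp: case_prod_beta)
  then obtain a where a: "?K \<subseteq> cbox (-a) a"
    using bounded_subset_cbox_symmetric compact_imp_bounded by blast
  have out: "h (x + t *\<^sub>R v) = 0" if "x \<notin> cbox (-a) a" "t \<in> {-1..1}" for x t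
  proof (rule L(2), rule notI)
    assume "x + t *\<^sub>R v \<in> L"
    then have "x \<in> ?K" using that(2) by (intro image_eqI[where x="(x + t *\<^sub>R v, t)"]) auto
    then show False using a that by blast
  qed
  have c: "continuous_on UNIV h" using smooth_on_imp_continuous_on[OF sm] .
  have c': "continuous_on UNIV (\<lambda>x. frechet_derivative h (at x) v)"
    using smooth_on_imp_continuous_on[OF smooth_on_frechet_derivative[OF sm]] .
  have G: "integral (cbox (-a) a) (\<lambda>x. h (x + t *\<^sub>R v)) = (LINT x|lborel. h x)" if "t \<in> {-1..1}" for t
  proof -
    have "integral (cbox (-a) a) (\<lambda>x. h (x + t *\<^sub>R v)) = (LINT x|lborel. h (x + t *\<^sub>R v))"
      using out[OF _ that]
      by (intro lborel_integral_eq_box[symmetric] continuous_on_compose2[OF c]) (auto intro!: continuous_intros)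
    then show ?thesis using lborel_integral_translate[of h] c by (simp add: borel_measurable_continuous_onI)
  qed
  have "((\<lambda>t. integral (cbox (-a) a) (\<lambda>x. h (x + t *\<^sub>R v))) has_field_derivative
      integral (cbox (-a) a) (\<lambda>x. frechet_derivative h (at (x + 0 *\<^sub>R v)) v)) (at 0 within {-1..1})"
  proof (rule leibniz_rule_field_derivative)
    show "((\<lambda>t. h (x + t *\<^sub>R v)) has_field_derivative frechet_derivative h (at (x + t *\<^sub>R v)) v) (at t within {-1..1})"
      for t x
    proof -
      have hd: "(h has_derivative frechet_derivative h (at (x + t *\<^sub>R v))) (at (x + t *\<^sub>R v))"
        by (rule smooth_on_imp_has_derivative[OF sm]) auto
      have "((\<lambda>t. h (x + t *\<^sub>R v)) has_derivative (\<lambda>s. frechet_derivative h (at (x + t *\<^sub>R v)) (s *\<^sub>R v))) (at t)"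
        by (rule has_derivative_compose[where f="\<lambda>t. x + t *\<^sub>R v" and g=h, OF _ hd]) (auto intro!: derivative_eq_intros)
      then have "((\<lambda>t. h (x + t *\<^sub>R v)) has_field_derivative frechet_derivative h (at (x + t *\<^sub>R v)) v) (at t)"
        using linear_scale[OF has_derivative_linear[OF hd]]
        by (simp add: has_field_derivative_def mult.commute[of _ "frechet_derivative h (at (x + t *\<^sub>R v)) v"])
      then show ?thesis by (rule has_field_derivative_at_within)
    qed
    show "(\<lambda>x. h (x + t *\<^sub>R v)) integrable_on cbox (- a) a" for t
      by (intro integrable_continuous continuous_on_compose2[OF c]) (auto intro!: continuous_intros)
    show "continuous_on ({-1..1} \<times> cbox (- a) a) (\<lambda>(t, x). frechet_derivative h (at (x + t *\<^sub>R v)) v)"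
      unfolding case_prod_beta
      by (rule continuous_on_compose2[OF c']) (auto intro!: continuous_intros)
  qed auto
  then have der: "((\<lambda>t. integral (cbox (-a) a) (\<lambda>x. h (x + t *\<^sub>R v))) has_field_derivative
      integral (cbox (-a) a) (\<lambda>x. frechet_derivative h (at x) v)) (at 0 within {-1..1})"
    by simp
  have "((\<lambda>t. LINT x|lborel. h x) has_field_derivative
      integral (cbox (-a) a) (\<lambda>x. frechet_derivative h (at x) v)) (at 0 within {-1..1})"
    by (rule has_field_derivative_transform_within[OF der, of 1]) (use G in auto)
  then have "((\<lambda>t. LINT x|lborel. h x) has_field_derivative
      integral (cbox (-a) a) (\<lambda>x. frechet_derivative h (at x) v)) (at 0)"
    using at_within_interior[of "0::real" "{-1..1}"] by simp
  then have 0: "integral (cbox (-a) a) (\<lambda>x. frechet_derivative h (at x) v) = 0"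
    using DERIV_unique DERIV_const by blast
  have "frechet_derivative h (at x) v = 0" if "x \<notin> cbox (-a) a" for x
    using frechet_derivative_cong_open[of "- cbox (-a) a" x h "\<lambda>_. 0"] out[of _ 0] that
    by (simp add: frechet_derivative_const open_Compl closed_cbox)
  then have "(LINT x|lborel. frechet_derivative h (at x) v) = integral (cbox (-a) a) (\<lambda>x. frechet_derivative h (at x) v)"
    by (intro lborel_integral_eq_box continuous_on_subset[OF c']) auto
  then show ?thesis using 0 by simp
qed

lemma X_field_supported:
  assumes "closed L" "\<And>x. x \<notin> L \<Longrightarrow> f x = 0" "x \<notin> L"
  shows "X_field i f x = 0"
  using X_field_cong[of "- L" x f "\<lambda>_. 0" i] assms by (simp add: open_Compl)

lemma X_multi_supported:
  assumes "closed L" "\<And>x. x \<notin> L \<Longrightarrow> f x = 0"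
  shows "x \<notin> L \<Longrightarrow> X_multi I f x = 0"
  using assms by (induction I arbitrary: x) (auto intro: X_field_supported)

text \<open>The frame fields are divergence free.\<close>

lemma integral_X_field_eq_0:
  fixes h :: "'n::finite R2n1 \<Rightarrow> real"
  assumes sm: "smooth_on UNIV h" and L: "compact L" "\<And>x. x \<notin> L \<Longrightarrow> h x = 0"
  shows "(LINT x|lborel. X_field i h x) = 0"
proof (cases i)
  case (Inr j)
  show ?thesis
    unfolding Inr X_field_Inr by (rule integral_frechet_derivative_eq_0[OF sm L])
next
  case (Inl j)
  \<comment> \<open>The coefficient \<open>bcoord j\<close> does not involve the last coordinate, so
    it can be pulled inside the derivative in that direction; the field then is a sum of two
    constant-direction derivatives.\<close>
  let ?h = "\<lambda>x. bcoord j x * h x"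
  have sm': "smooth_on UNIV ?h"
    by (intro smooth_on_mult smooth_on_bcoord sm) auto
  have D: "frechet_derivative ?h (at x) (coord_vec None) = bcoord j x * frechet_derivative h (at x) (coord_vec None)" for x
    by (subst frechet_derivative_eqI[OF has_derivative_mult[OF
            bounded_linear_imp_has_derivative[OF bounded_linear_bcoord] smooth_on_imp_has_derivative[OF sm UNIV_I]]])
      (simp add: bcoord_def)
  have eq: "X_field (Inl j) h x = frechet_derivative h (at x) (coord_vec (Some (Inl j)))
      + frechet_derivative ?h (at x) (coord_vec None)" for x
    unfolding D using X_field_Inl[OF smooth_on_imp_differentiable[OF sm UNIV_I]] by simp
  have int: "integrable lborel (\<lambda>x. frechet_derivative h (at x) v)"
    if "smooth_on UNIV h" "\<And>x. x \<notin> L \<Longrightarrow> h x = 0" for v and h :: "'n R2n1 \<Rightarrow> real"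
  proof (rule integrable_lborel_compact_support[OF L(1)])
    show "continuous_on L (\<lambda>x. frechet_derivative h (at x) v)"
      using smooth_on_imp_continuous_on[OF smooth_on_frechet_derivative[OF that(1)]] continuous_on_subset by blast
    show "frechet_derivative h (at x) v = 0" if "x \<notin> L" for x
      using frechet_derivative_cong_open[of "- L" x h "\<lambda>_. 0"] that \<open>\<And>x. x \<notin> L \<Longrightarrow> h x = 0\<close> L(1)
      by (simp add: compact_imp_closed open_Compl frechet_derivative_const)
  qed
  have sup: "\<And>x. x \<notin> L \<Longrightarrow> ?h x = 0" using L(2) by simp
  show ?thesis
    unfolding Inl eq
    using int[OF sm L(2)] int[OF sm' sup] integral_frechet_derivative_eq_0[OF sm L]
      integral_frechet_derivative_eq_0[OF sm' L(1) sup]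
    by (simp del: coord_vec.simps)
qed

context
  fixes U L :: "'n::finite R2n1 set" and \<psi> :: "'n R2n1 \<Rightarrow> real"
  assumes U: "open U" and L: "compact L" "L \<subseteq> U"
begin

lemma smooth_on_mult_supported:
  fixes f :: "'n R2n1 \<Rightarrow> real"
  assumes "smooth_on U f" "smooth_on UNIV \<psi>" "\<And>x. x \<notin> L \<Longrightarrow> \<psi> x = 0"
  shows "smooth_on UNIV (\<lambda>x. f x * \<psi> x)"
  using assms U L
  by (intro smooth_on_extend_zero[of UNIV U _ L] smooth_on_mult smooth_on_subset[OF assms(2)])
    (auto simp: compact_imp_closed)

lemma integrable_mult_supported:
  fixes f :: "'n R2n1 \<Rightarrow> real"
  assumes "smooth_on U f" "smooth_on UNIV \<psi>" "\<And>x. x \<notin> L \<Longrightarrow> \<psi> x = 0"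
  shows "integrable lborel (\<lambda>x. f x * \<psi> x)"
  using continuous_on_subset[OF smooth_on_imp_continuous_on[OF smooth_on_mult_supported[OF assms]] subset_UNIV] assms(3)
  by (intro integrable_lborel_compact_support[OF L(1)]) auto

text \<open>\<open>f\<close> is smooth on \<open>U\<close> only, but \<open>f \<psi>\<close> extends
  smoothly by zero, so its frame derivative integrates to 0. Outside \<open>U\<close> the product
  rule holds because every term with \<open>\<psi>\<close> or its derivatives vanishes
  there.\<close>

lemma X_field_by_parts:
  fixes f :: "'n R2n1 \<Rightarrow> real"
  assumes f: "smooth_on U f" and p: "smooth_on UNIV \<psi>" "\<And>x. x \<notin> L \<Longrightarrow> \<psi> x = 0"
  shows "(LINT x|lborel. X_field i f x * \<psi> x) = - (LINT x|lborel. f x * X_field i \<psi> x)"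
proof -
  have cl: "closed L" using L compact_imp_closed by blast
  have eq: "X_field i (\<lambda>x. f x * \<psi> x) x = X_field i f x * \<psi> x + f x * X_field i \<psi> x" for x
  proof (cases "x \<in> U")
    case True
    then show ?thesis
      using X_field_mult[OF smooth_on_imp_differentiable[OF f True] smooth_on_imp_differentiable[OF p(1) UNIV_I]]
      by simp
  next
    case False
    then have x: "x \<notin> L" using L by blast
    show ?thesis
      using X_field_supported[OF cl p(2) x] X_field_supported[OF cl _ x, of "\<lambda>x. f x * \<psi> x"] p(2) x by simp
  qed
  have "(LINT x|lborel. X_field i f x * \<psi> x + f x * X_field i \<psi> x) = 0"
    using integral_X_field_eq_0[OF smooth_on_mult_supported[OF f p] L(1), of i] p(2) by (simp add: eq)
  moreover have "integrable lborel (\<lambda>x. X_field i f x * \<psi> x)"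
    by (rule integrable_mult_supported[OF smooth_on_X_field[OF U f] p])
  moreover have "integrable lborel (\<lambda>x. f x * X_field i \<psi> x)"
  proof -
    have "integrable lborel (\<lambda>x. X_field i (\<lambda>x. f x * \<psi> x) x)"
      using X_field_supported[OF cl, of "\<lambda>x. f x * \<psi> x"] p(2)
        continuous_on_subset[OF smooth_on_imp_continuous_on[OF
            smooth_on_X_field[OF open_UNIV smooth_on_mult_supported[OF f p]]] subset_UNIV]
      by (intro integrable_lborel_compact_support[OF L(1)]) auto
    then have "integrable lborel (\<lambda>x. X_field i (\<lambda>x. f x * \<psi> x) x - X_field i f x * \<psi> x)"
      using \<open>integrable lborel (\<lambda>x. X_field i f x * \<psi> x)\<close> by simp
    then show ?thesis by (simp add: eq)
  qed
  ultimately show ?thesis by simp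
qed

end

text \<open>The outermost field is moved first and thus ends up innermost on \<open>\<psi>\<close>;
  as the fields do not commute, the word is reversed.\<close>

lemma X_multi_by_parts:
  fixes f \<psi> :: "'n::finite R2n1 \<Rightarrow> real"
  assumes U: "open U" and L: "compact L" "L \<subseteq> U" and f: "smooth_on U f"
    and p: "smooth_on UNIV \<psi>" "\<And>x. x \<notin> L \<Longrightarrow> \<psi> x = 0"
  shows "(LINT x|lborel. X_multi I f x * \<psi> x) = (-1) ^ length I * (LINT x|lborel. f x * X_multi (rev I) \<psi> x)"
  using p
proof (induction I arbitrary: \<psi>)
  case (Cons i I)
  have "(LINT x|lborel. X_multi (i # I) f x * \<psi> x) = - (LINT x|lborel. X_multi I f x * X_field i \<psi> x)"
    using X_field_by_parts[OF U L smooth_on_X_multi[OF U f] Cons.prems] by simp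
  also have "(LINT x|lborel. X_multi I f x * X_field i \<psi> x)
     = (-1) ^ length I * (LINT x|lborel. f x * X_multi (rev I) (X_field i \<psi>) x)"
    using Cons.prems L by (intro Cons.IH smooth_on_X_field X_field_supported) (auto simp: compact_imp_closed)
  finally show ?case by (simp add: X_multi_append)
qed auto

section \<open>Symmetry of second derivatives and the commutator\<close>

lemma smooth_on_line_derivative:
  fixes f :: "'e::euclidean_space \<Rightarrow> real"
  assumes "smooth_on S f" "p + t *\<^sub>R w \<in> S"
  shows "((\<lambda>t. f (p + t *\<^sub>R w)) has_real_derivative frechet_derivative f (at (p + t *\<^sub>R w)) w) (at t)"
proof -
  have hd: "(f has_derivative frechet_derivative f (at (p + t *\<^sub>R w))) (at (p + t *\<^sub>R w))"
    by (rule smooth_on_imp_has_derivative[OF assms])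
  have "((\<lambda>t. f (p + t *\<^sub>R w)) has_derivative (\<lambda>s. frechet_derivative f (at (p + t *\<^sub>R w)) (s *\<^sub>R w))) (at t)"
    by (rule has_derivative_compose[where f="\<lambda>t. p + t *\<^sub>R w" and g=f, OF _ hd]) (auto intro!: derivative_eq_intros)
  then show ?thesis
    using linear_scale[OF has_derivative_linear[OF hd]]
    by (simp add: has_field_derivative_def mult.commute[of _ "frechet_derivative f (at (p + t *\<^sub>R w)) w"])
qed

text \<open>The left side is symmetric in \<open>v\<close> and \<open>w\<close>, while two
  applications of the mean value theorem, in the direction \<open>v\<close> and then
  \<open>w\<close>, exhibit it as an iterated derivative taken in this order.\<close>

lemma second_difference:
  fixes f :: "'e::euclidean_space \<Rightarrow> real"
  assumes sm: "smooth_on S f" and h: "0 < h"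
    and S: "\<And>s t. 0 \<le> s \<Longrightarrow> s \<le> h \<Longrightarrow> 0 \<le> t \<Longrightarrow> t \<le> h \<Longrightarrow> x + s *\<^sub>R v + t *\<^sub>R w \<in> S"
  obtains s t where "0 < s" "s < h" "0 < t" "t < h"
    "f (x + h *\<^sub>R v + h *\<^sub>R w) - f (x + h *\<^sub>R v) - f (x + h *\<^sub>R w) + f x
      = h * h * frechet_derivative (\<lambda>y. frechet_derivative f (at y) v) (at (x + s *\<^sub>R v + t *\<^sub>R w)) w"
proof -
  let ?f' = "\<lambda>y. frechet_derivative f (at y) v"
  have "\<exists>s>0. s < h \<and> (f ((x + h *\<^sub>R w) + h *\<^sub>R v) - f (x + h *\<^sub>R v)) - (f ((x + h *\<^sub>R w) + 0 *\<^sub>R v) - f (x + 0 *\<^sub>R v))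
      = (h - 0) * (?f' ((x + h *\<^sub>R w) + s *\<^sub>R v) - ?f' (x + s *\<^sub>R v))"
  proof (rule MVT2[OF h])
    fix s assume "0 \<le> s" "s \<le> h"
    then show "((\<lambda>s. f ((x + h *\<^sub>R w) + s *\<^sub>R v) - f (x + s *\<^sub>R v)) has_real_derivative
        ?f' ((x + h *\<^sub>R w) + s *\<^sub>R v) - ?f' (x + s *\<^sub>R v)) (at s)"
      using S[of s h] S[of s 0] h
      by (intro DERIV_diff smooth_on_line_derivative[OF sm]) (auto simp: algebra_simps)
  qed
  then obtain s where s: "0 < s" "s < h"
    "f (x + h *\<^sub>R v + h *\<^sub>R w) - f (x + h *\<^sub>R v) - f (x + h *\<^sub>R w) + f x = h * (?f' ((x + h *\<^sub>R w) + s *\<^sub>R v) - ?f' (x + s *\<^sub>R v))"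
    by (auto simp: algebra_simps)
  have "\<exists>t>0. t < h \<and> ?f' ((x + s *\<^sub>R v) + h *\<^sub>R w) - ?f' ((x + s *\<^sub>R v) + 0 *\<^sub>R w)
     = (h - 0) * frechet_derivative ?f' (at ((x + s *\<^sub>R v) + t *\<^sub>R w)) w"
  proof (rule MVT2[OF h])
    fix t assume "0 \<le> t" "t \<le> h"
    then show "((\<lambda>t. ?f' ((x + s *\<^sub>R v) + t *\<^sub>R w)) has_real_derivative
        frechet_derivative ?f' (at ((x + s *\<^sub>R v) + t *\<^sub>R w)) w) (at t)"
      using S[of s t] s
      by (intro smooth_on_line_derivative[OF smooth_on_frechet_derivative[OF sm]]) auto
  qed
  then obtain t where t: "0 < t" "t < h" "?f' ((x + s *\<^sub>R v) + h *\<^sub>R w) - ?f' (x + s *\<^sub>R v)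
     = h * frechet_derivative ?f' (at ((x + s *\<^sub>R v) + t *\<^sub>R w)) w" by auto
  have "(x + h *\<^sub>R w) + s *\<^sub>R v = (x + s *\<^sub>R v) + h *\<^sub>R w" by (simp add: algebra_simps)
  then show ?thesis using that[OF s(1,2) t(1,2)] s(3) t(3) by (metis mult.assoc)
qed

text \<open>In every small ball the two iterated derivatives share a value, since both compute the
  same second difference. By continuity they agree at the centre.\<close>

lemma second_derivative_symmetric:
  fixes f :: "'e::euclidean_space \<Rightarrow> real"
  assumes S: "open S" and sm: "smooth_on S f" and x: "x \<in> S"
  shows "frechet_derivative (\<lambda>y. frechet_derivative f (at y) v) (at x) w
    = frechet_derivative (\<lambda>y. frechet_derivative f (at y) w) (at x) v" (is "?A x = ?B x")
proof -
  have cA: "continuous_on S ?A" and cB: "continuous_on S ?B"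
    by (intro smooth_on_imp_continuous_on smooth_on_frechet_derivative sm)+
  have close: "\<exists>p\<in>ball x e. \<exists>q\<in>ball x e. ?A p = ?B q" if e: "0 < e" "ball x e \<subseteq> S" for e
  proof -
    \<comment> \<open>Small enough that the parallelogram with sides \<open>h v\<close> and
      \<open>h w\<close> lies in the ball of radius \<open>e\<close>; the summand 1 covers the case
      \<open>v = w = 0\<close>.\<close>
    define h where "h = e / (norm v + norm w + 1)"
    have h: "0 < h" using e by (simp add: h_def add_nonneg_pos)
    have hb: "h * (norm v + norm w) < e"
    proof -
      have "0 < norm v + norm w + 1" by (simp add: add_nonneg_pos)
      then have "h * (norm v + norm w + 1) = e" unfolding h_def by simp
      then show ?thesis using h by (simp add: algebra_simps)
    qed
    have inb: "x + s *\<^sub>R v + t *\<^sub>R w \<in> ball x e" if "0 \<le> s" "s \<le> h" "0 \<le> t" "t \<le> h" for s t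
    proof -
      have "norm (s *\<^sub>R v + t *\<^sub>R w) \<le> s * norm v + t * norm w"
        using norm_triangle_ineq[of "s *\<^sub>R v" "t *\<^sub>R w"] that by simp
      also have "\<dots> \<le> h * norm v + h * norm w"
        using that by (intro add_mono mult_right_mono) auto
      also have "\<dots> < e" using hb by (simp add: algebra_simps)
      finally show ?thesis
        by (simp add: dist_norm algebra_simps) (metis add.commute norm_minus_cancel minus_add_distrib uminus_add_conv_diff)
    qed
    obtain s t where st: "0 < s" "s < h" "0 < t" "t < h"
      "f (x + h *\<^sub>R v + h *\<^sub>R w) - f (x + h *\<^sub>R v) - f (x + h *\<^sub>R w) + f x = h * h * ?A (x + s *\<^sub>R v + t *\<^sub>R w)"
      by (rule second_difference[OF sm h, of x v w]) (use inb e in blast)+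
    have inb': "x + s *\<^sub>R w + t *\<^sub>R v \<in> ball x e" if "0 \<le> s" "s \<le> h" "0 \<le> t" "t \<le> h" for s t
      using inb[of t s] that by (simp add: algebra_simps)
    obtain s' t' where st': "0 < s'" "s' < h" "0 < t'" "t' < h"
      "f (x + h *\<^sub>R w + h *\<^sub>R v) - f (x + h *\<^sub>R w) - f (x + h *\<^sub>R v) + f x = h * h * ?B (x + s' *\<^sub>R w + t' *\<^sub>R v)"
      by (rule second_difference[OF sm h, of x w v]) (use inb' e in blast)+
    have eq: "x + h *\<^sub>R w + h *\<^sub>R v = x + h *\<^sub>R v + h *\<^sub>R w" by (simp add: algebra_simps)
    have "h * h * ?A (x + s *\<^sub>R v + t *\<^sub>R w) = h * h * ?B (x + s' *\<^sub>R w + t' *\<^sub>R v)"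
      using st(5) st'(5)[unfolded eq] by linarith
    then have "?A (x + s *\<^sub>R v + t *\<^sub>R w) = ?B (x + s' *\<^sub>R w + t' *\<^sub>R v)" using h by simp
    then show ?thesis using inb[of s t] inb'[of s' t'] st st' by fastforce
  qed
  show ?thesis
  proof (rule ccontr)
    assume ne: "?A x \<noteq> ?B x"
    define d where "d = dist (?A x) (?B x) / 2"
    have d: "0 < d" using ne by (simp add: d_def)
    obtain e1 where e1: "0 < e1" "\<And>y. y \<in> S \<Longrightarrow> dist y x < e1 \<Longrightarrow> dist (?A y) (?A x) < d"
      using cA x d unfolding continuous_on_iff by blast
    obtain e2 where e2: "0 < e2" "\<And>y. y \<in> S \<Longrightarrow> dist y x < e2 \<Longrightarrow> dist (?B y) (?B x) < d"
      using cB x d unfolding continuous_on_iff by blast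
    obtain e3 where e3: "0 < e3" "ball x e3 \<subseteq> S" using S x open_contains_ball by blast
    obtain p q where pq: "p \<in> ball x (min e1 (min e2 e3))" "q \<in> ball x (min e1 (min e2 e3))" "?A p = ?B q"
      using close[of "min e1 (min e2 e3)"] e1 e2 e3 by (auto simp: subset_iff)
    have "dist (?A p) (?A x) < d" "dist (?B q) (?B x) < d"
      using pq e1(2)[of p] e2(2)[of q] e3 by (auto simp: subset_iff dist_commute)
    then show False
      using dist_triangle[of "?A x" "?B x" "?A p"] pq(3) by (simp add: d_def dist_commute)
  qed
qed

text \<open>The second derivatives cancel by symmetry. What survives is the derivative of the
  coefficient \<open>bcoord j\<close> of \<open>X_j\<close> along \<open>X_{n+j}\<close>. So the
  missing direction costs two frame derivatives.\<close>

lemma X_commutator: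
  fixes f :: "'n::finite R2n1 \<Rightarrow> real"
  assumes S: "open S" and sm: "smooth_on S f" and x: "x \<in> S"
  shows "frechet_derivative f (at x) (coord_vec None)
    = X_field (Inr j) (X_field (Inl j) f) x - X_field (Inl j) (X_field (Inr j) f) x"
proof -
  let ?D = "\<lambda>v y. frechet_derivative f (at y) v"
  let ?a = "coord_vec (Some (Inl j)) :: 'n R2n1" and ?b = "coord_vec (Some (Inr j)) :: 'n R2n1"
    and ?z = "coord_vec None :: 'n R2n1"
  have sD: "(?D v has_derivative frechet_derivative (?D v) (at x)) (at x)" for v
    by (rule smooth_on_imp_has_derivative[OF smooth_on_frechet_derivative[OF sm] x])
  have "X_field (Inr j) (X_field (Inl j) f) x = X_field (Inr j) (\<lambda>y. ?D ?a y + bcoord j y * ?D ?z y) x"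
    using X_field_Inl[OF smooth_on_imp_differentiable[OF sm]]
    by (intro X_field_cong[OF S x]) (simp del: coord_vec.simps)
  also have "\<dots> = frechet_derivative (?D ?a) (at x) ?b + (bcoord j x * frechet_derivative (?D ?z) (at x) ?b + ?D ?z x)"
    unfolding X_field_Inr
    by (subst frechet_derivative_eqI[OF has_derivative_add[OF sD has_derivative_mult[OF
            bounded_linear_imp_has_derivative[OF bounded_linear_bcoord] sD]]])
      (simp add: bcoord_def)
  finally have 1: "X_field (Inr j) (X_field (Inl j) f) x = \<dots>" .
  have "X_field (Inr j) f = ?D ?b" by (rule ext) (rule X_field_Inr)
  then have 2: "X_field (Inl j) (X_field (Inr j) f) x = frechet_derivative (?D ?b) (at x) ?a
      + bcoord j x * frechet_derivative (?D ?b) (at x) ?z"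
    using X_field_Inl[of "?D ?b" x j] smooth_on_imp_differentiable[OF smooth_on_frechet_derivative[OF sm] x]
    by (simp del: coord_vec.simps)
  show ?thesis
    unfolding 1 2 second_derivative_symmetric[OF S sm x, of ?b] by simp
qed

section \<open>Interior Sobolev embedding\<close>

text \<open>The point \<open>x \<cdot> \<delta>\<^sub>r y\<close> for the group law that leaves the frame invariant and the
  parabolic dilations \<open>\<delta>\<^sub>r (a, b, z) = (r a, r b, r\<^sup>2 z)\<close>.\<close>

definition ray :: "'n::finite R2n1 \<Rightarrow> 'n R2n1 \<Rightarrow> real \<Rightarrow> 'n R2n1" where
  "ray x y r = (fst x + r *\<^sub>R fst y, fst (snd x) + r *\<^sub>R fst (snd y),
     snd (snd x) + r\<^sup>2 * snd (snd y) + r * (fst (snd x) \<bullet> fst y))"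

definition qcoord :: "'n::finite R2n1 \<Rightarrow> real" where
  "qcoord y = 2 * snd (snd y) - fst (snd y) \<bullet> fst y"

text \<open>The operators \<open>\<Phi> \<mapsto> \<Phi>\<^sub>i\<close> in the formula for \<open>g'(r)\<close>. The coefficient of \<open>\<partial>\<^sub>z\<close> in the
  generator of the dilations is \<open>qcoord\<close>; for an arbitrary index \<open>k\<close>, \<open>\<partial>\<^sub>z = [X\<^sub>n\<^sub>+\<^sub>k, X\<^sub>k]\<close>, and one of
  the two frame fields is moved onto \<open>qcoord \<Phi>\<close> by parts.\<close>

fun shift :: "'n::finite \<Rightarrow> 'n + 'n \<Rightarrow> ('n R2n1 \<Rightarrow> real) \<Rightarrow> 'n R2n1 \<Rightarrow> real" where
  "shift k (Inl j) \<Phi> = (\<lambda>y. fst y $ j * \<Phi> y - of_bool (j = k) * X_field (Inr k) (\<lambda>y. qcoord y * \<Phi> y) y)"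
| "shift k (Inr j) \<Phi> = (\<lambda>y. bcoord j y * \<Phi> y + of_bool (j = k) * X_field (Inl k) (\<lambda>y. qcoord y * \<Phi> y) y)"

lemma ray_0 [simp]: "ray x y 0 = x"
  by (simp add: ray_def)

lemma continuous_ray: "continuous_on S (\<lambda>p. ray x (snd p) (fst p))"
  unfolding ray_def by (intro continuous_intros)

lemma continuous_ray2: "continuous_on S (\<lambda>y. ray x y r)"
  unfolding ray_def by (intro continuous_intros)

lemma bounded_linear_acoord: "bounded_linear (\<lambda>y::'n::finite R2n1. fst y $ j)"
  by (intro bounded_linear_compose[OF bounded_linear_vec_nth] bounded_linear_fst)

lemma smooth_on_qcoord: "smooth_on UNIV (qcoord :: 'n::finite R2n1 \<Rightarrow> real)"
proof -
  have "qcoord = (\<lambda>y::'n R2n1. 2 * snd (snd y) - (\<Sum>j\<in>UNIV. bcoord j y * fst y $ j))"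
    by (auto simp: qcoord_def inner_vec_def bcoord_def)
  moreover have "smooth_on UNIV (\<lambda>y::'n R2n1. snd (snd y))"
    by (intro smooth_on_bounded_linear bounded_linear_compose[OF bounded_linear_snd] bounded_linear_snd) auto
  then have "smooth_on UNIV (\<lambda>y::'n R2n1. 2 * snd (snd y) - (\<Sum>j\<in>UNIV. bcoord j y * fst y $ j))"
    by (intro smooth_on_diff smooth_on_cmult smooth_on_sum smooth_on_mult smooth_on_bcoord
        smooth_on_bounded_linear[OF _ bounded_linear_acoord]) auto
  ultimately show ?thesis by simp
qed

lemma smooth_on_shift:
  assumes "smooth_on UNIV \<Phi>"
  shows "smooth_on UNIV (shift k i \<Phi>)"
proof -
  have q: "smooth_on UNIV (\<lambda>y. qcoord y * \<Phi> y)"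
    by (intro smooth_on_mult smooth_on_qcoord assms) auto
  show ?thesis
    by (cases i) (auto intro!: smooth_on_diff smooth_on_add smooth_on_cmult smooth_on_mult assms
        smooth_on_X_field[OF _ q] smooth_on_bcoord smooth_on_bounded_linear[OF _ bounded_linear_acoord])
qed

lemma shift_supported:
  assumes "closed L" "\<And>y. y \<notin> L \<Longrightarrow> \<Phi> y = 0" "y \<notin> L"
  shows "shift k i \<Phi> y = 0"
  using assms X_field_supported[OF assms(1), of "\<lambda>y. qcoord y * \<Phi> y" y]
  by (cases i) auto

lemma has_derivative_ray:
  "((\<lambda>y. ray x y r) has_derivative (\<lambda>v. (r *\<^sub>R fst v, r *\<^sub>R fst (snd v), r\<^sup>2 * snd (snd v) + r * (fst (snd x) \<bullet> fst v)))) (at y)"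
  unfolding ray_def by (auto intro!: derivative_eq_intros)

lemma smooth_on_ray:
  fixes x :: "'n::finite R2n1"
  assumes S: "open S"
  shows "smooth_on S (\<lambda>y. ray x y r)"
proof -
  have e: "(\<lambda>y. ray x y r) = (\<lambda>y. ray x 0 r + (r *\<^sub>R fst y, r *\<^sub>R fst (snd y), r\<^sup>2 * snd (snd y) + r * (fst (snd x) \<bullet> fst y)))"
    by (intro ext) (simp add: ray_def prod_eq_iff)
  have "bounded_linear (\<lambda>y::'n R2n1. (r *\<^sub>R fst y, r *\<^sub>R fst (snd y), r\<^sup>2 * snd (snd y) + r * (fst (snd x) \<bullet> fst y)))"
    using has_derivative_bounded_linear[OF has_derivative_ray] .
  then show ?thesis unfolding e
    by (intro smooth_on_add S smooth_on_const smooth_on_bounded_linear)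
qed

text \<open>Left translations preserve the frame and the dilation multiplies it by \<open>r\<close>;
  on vectors this is the identity that the \<open>also\<close> step checks.\<close>

lemma X_field_ray:
  fixes w :: "'n::finite R2n1 \<Rightarrow> real"
  assumes "w differentiable (at (ray x y r))"
  shows "X_field i (\<lambda>y. w (ray x y r)) y = r * X_field i w (ray x y r)"
proof -
  let ?d = "frechet_derivative w (at (ray x y r))"
  have lin: "linear ?d" using assms by (rule linear_frechet_derivative)
  have hd: "(w has_derivative ?d) (at (ray x y r))" using assms frechet_derivative_works by blast
  have "X_field i (\<lambda>y. w (ray x y r)) y = ?d (r *\<^sub>R fst (contact_frame i y), r *\<^sub>R fst (snd (contact_frame i y)),
      r\<^sup>2 * snd (snd (contact_frame i y)) + r * (fst (snd x) \<bullet> fst (contact_frame i y)))"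
    by (rule X_field_eqI[OF has_derivative_compose[OF has_derivative_ray hd]])
  also have "(r *\<^sub>R fst (contact_frame i y), r *\<^sub>R fst (snd (contact_frame i y)),
      r\<^sup>2 * snd (snd (contact_frame i y)) + r * (fst (snd x) \<bullet> fst (contact_frame i y)))
      = r *\<^sub>R contact_frame i (ray x y r)"
    by (cases i) (auto simp: ray_def inner_axis power2_eq_square algebra_simps)
  finally show ?thesis by (simp add: X_field_def linear_scale[OF lin])
qed

text \<open>The velocity of the ray is expanded in the frame at the point reached, not at
  \<open>y\<close>. Only the coefficient of the last coordinate direction then carries a factor
  \<open>r\<close>, and this factor later pays for one integration by parts.\<close>

lemma ray_derivative:
  fixes w :: "'n::finite R2n1 \<Rightarrow> real"
  assumes "w differentiable (at (ray x y r))"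
  shows "((\<lambda>r. w (ray x y r)) has_real_derivative
     (\<Sum>j\<in>UNIV. fst y $ j * X_field (Inl j) w (ray x y r)) + (\<Sum>j\<in>UNIV. bcoord j y * X_field (Inr j) w (ray x y r))
      + r * qcoord y * frechet_derivative w (at (ray x y r)) (coord_vec None)) (at r)"
proof -
  let ?d = "frechet_derivative w (at (ray x y r))"
  have lin: "linear ?d" using assms by (rule linear_frechet_derivative)
  have hd: "(w has_derivative ?d) (at (ray x y r))" using assms frechet_derivative_works by blast
  let ?v = "(fst y, fst (snd y), 2 * r * snd (snd y) + fst (snd x) \<bullet> fst y)"
  have "((\<lambda>r. ray x y r) has_derivative (\<lambda>s. s *\<^sub>R ?v)) (at r)"
    unfolding ray_def by (auto intro!: derivative_eq_intros simp: algebra_simps)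
  note has_derivative_compose[OF this hd]
  moreover have "(\<lambda>s. ?d (s *\<^sub>R ?v)) = (*) (?d ?v)"
    by (rule ext) (simp only: linear_scale[OF lin] real_scaleR_def mult.commute)
  ultimately have "((\<lambda>r. w (ray x y r)) has_real_derivative ?d ?v) (at r)"
    by (simp only: has_field_derivative_def)
  moreover have "?v = (\<Sum>j\<in>UNIV. fst y $ j *\<^sub>R contact_frame (Inl j) (ray x y r))
      + (\<Sum>j\<in>UNIV. bcoord j y *\<^sub>R contact_frame (Inr j) (ray x y r)) + (r * qcoord y) *\<^sub>R coord_vec None"
  proof -
    have s: "(\<Sum>j\<in>UNIV. a $ j *\<^sub>R axis j 1) = a" for a :: "real ^ 'n"
      using basis_expansion[of a] by (simp add: scalar_mult_eq_scaleR)
    have 1: "(\<Sum>j\<in>UNIV. fst y $ j *\<^sub>R contact_frame (Inl j) (ray x y r))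
        = (fst y, 0, (fst (snd x) + r *\<^sub>R fst (snd y)) \<bullet> fst y)"
      by (simp add: ray_def sum_prod s inner_vec_def mult.commute)
    have 2: "(\<Sum>j\<in>UNIV. bcoord j y *\<^sub>R contact_frame (Inr j) (ray x y r)) = (0, fst (snd y), 0)"
      by (simp add: sum_prod s bcoord_def)
    show ?thesis unfolding 1 2
      by (simp add: qcoord_def inner_add_left algebra_simps)
  qed
  ultimately show ?thesis
    by (simp add: linear_add[OF lin] linear_sum[OF lin] linear_scale[OF lin] X_field_def
        del: coord_vec.simps contact_frame.simps)
qed

lemma nn_integral_affine:
  fixes f :: "'e::euclidean_space \<Rightarrow> ennreal"
  assumes [measurable]: "f \<in> borel_measurable borel" and "c \<noteq> 0"
  shows "(\<integral>\<^sup>+x. f x \<partial>lborel) = ennreal (\<bar>c\<bar> ^ DIM('e)) * (\<integral>\<^sup>+x. f (t + c *\<^sub>R x) \<partial>lborel)"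
  by (subst lborel_affine[OF assms(2), of t])
    (simp add: nn_integral_density nn_integral_distr nn_integral_cmult)

text \<open>The exponent is the homogeneous dimension \<open>n + n + 2\<close>. Integrating
  coordinate block by coordinate block avoids a Jacobian: for fixed \<open>a\<close> and
  \<open>b\<close> the shear \<open>r (b0 \<bullet> a)\<close> is a mere translation in
  \<open>z\<close>.\<close>

lemma nn_integral_ray:
  fixes f :: "'n::finite R2n1 \<Rightarrow> ennreal"
  assumes f [measurable]: "f \<in> borel_measurable borel" and r: "0 < r"
  shows "ennreal (r ^ (2 * CARD('n) + 2)) * (\<integral>\<^sup>+y. f (ray x y r) \<partial>lborel) = (\<integral>\<^sup>+y. f y \<partial>lborel)"
proof -
  let ?n = "CARD('n)"
  obtain a0 b0 z0 where x: "x = (a0, b0, z0)" by (cases x) auto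
  have prod: "(\<integral>\<^sup>+y. g y \<partial>lborel) = (\<integral>\<^sup>+a. \<integral>\<^sup>+b. \<integral>\<^sup>+z. g (a, b, z) \<partial>lborel \<partial>lborel \<partial>lborel)"
    if [measurable]: "g \<in> borel_measurable borel" for g :: "'n R2n1 \<Rightarrow> ennreal"
  proof -
    have "(\<integral>\<^sup>+y. g y \<partial>lborel) = (\<integral>\<^sup>+a. \<integral>\<^sup>+p. g (a, p) \<partial>lborel \<partial>lborel)"
      unfolding lborel_prod[symmetric, where 'a="real ^ 'n" and 'b="(real ^ 'n) \<times> real"]
      by (intro lborel.nn_integral_fst[symmetric]) (simp add: lborel_prod)
    also have "\<dots> = (\<integral>\<^sup>+a. \<integral>\<^sup>+b. \<integral>\<^sup>+z. g (a, b, z) \<partial>lborel \<partial>lborel \<partial>lborel)"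
      unfolding lborel_prod[symmetric, where 'a="real ^ 'n" and 'b="real"]
      by (intro nn_integral_cong lborel.nn_integral_fst[symmetric]) (simp add: lborel_prod)
    finally show ?thesis .
  qed
  have m: "(\<lambda>y. f (ray x y r)) \<in> borel_measurable borel"
    by (intro measurable_compose[OF _ f] borel_measurable_continuous_onI continuous_ray2)
  have "(\<integral>\<^sup>+y. f y \<partial>lborel) = (\<integral>\<^sup>+a. \<integral>\<^sup>+b. \<integral>\<^sup>+z. f (a, b, z) \<partial>lborel \<partial>lborel \<partial>lborel)"
    by (rule prod[OF f])
  also have "\<dots> = ennreal (r ^ ?n) * (\<integral>\<^sup>+a. \<integral>\<^sup>+b. \<integral>\<^sup>+z. f (a0 + r *\<^sub>R a, b, z) \<partial>lborel \<partial>lborel \<partial>lborel)"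
    using r by (subst nn_integral_affine[where c=r and t=a0]) auto
  also have "\<dots> = ennreal (r ^ ?n) * (\<integral>\<^sup>+a. ennreal (r ^ ?n) * (\<integral>\<^sup>+b. \<integral>\<^sup>+z. f (a0 + r *\<^sub>R a, b0 + r *\<^sub>R b, z) \<partial>lborel \<partial>lborel) \<partial>lborel)"
    using r by (subst nn_integral_affine[where c=r and t=b0]) auto
  also have "\<dots> = ennreal (r ^ ?n) * (\<integral>\<^sup>+a. ennreal (r ^ ?n) * (\<integral>\<^sup>+b. ennreal (r\<^sup>2) *
      (\<integral>\<^sup>+z. f (a0 + r *\<^sub>R a, b0 + r *\<^sub>R b, (z0 + r * (b0 \<bullet> a)) + r\<^sup>2 *\<^sub>R z) \<partial>lborel) \<partial>lborel) \<partial>lborel)"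
    (is "_ = _ * (\<integral>\<^sup>+a. _ * (\<integral>\<^sup>+b. ?F a b \<partial>lborel) \<partial>lborel)")
  proof -
    have "(\<integral>\<^sup>+z. f (a0 + r *\<^sub>R a, b0 + r *\<^sub>R b, z) \<partial>lborel) = ?F a b" for a b
      using r by (subst nn_integral_affine[where c="r\<^sup>2" and t="z0 + r * (b0 \<bullet> a)"]) auto
    then show ?thesis by simp
  qed
  also have "\<dots> = ennreal (r ^ ?n) * (ennreal (r ^ ?n) * (ennreal (r\<^sup>2) * (\<integral>\<^sup>+a. \<integral>\<^sup>+b.
      \<integral>\<^sup>+z. f (a0 + r *\<^sub>R a, b0 + r *\<^sub>R b, (z0 + r * (b0 \<bullet> a)) + r\<^sup>2 *\<^sub>R z) \<partial>lborel \<partial>lborel \<partial>lborel)))"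
    by (simp add: nn_integral_cmult)
  also have "(\<integral>\<^sup>+a. \<integral>\<^sup>+b.
      \<integral>\<^sup>+z. f (a0 + r *\<^sub>R a, b0 + r *\<^sub>R b, (z0 + r * (b0 \<bullet> a)) + r\<^sup>2 *\<^sub>R z) \<partial>lborel \<partial>lborel \<partial>lborel)
      = (\<integral>\<^sup>+y. f (ray x y r) \<partial>lborel)"
    unfolding prod[OF m] by (simp add: ray_def x algebra_simps)
  also have "ennreal (r ^ ?n) * (ennreal (r ^ ?n) * (ennreal (r\<^sup>2) * (\<integral>\<^sup>+y. f (ray x y r) \<partial>lborel)))
      = ennreal (r ^ (2 * ?n + 2)) * (\<integral>\<^sup>+y. f (ray x y r) \<partial>lborel)"
  proof -
    have "ennreal (r ^ (2 * ?n + 2)) = ennreal (r ^ ?n) * (ennreal (r ^ ?n) * ennreal (r\<^sup>2))"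
      using r by (simp add: ennreal_mult[symmetric] power_add[symmetric] mult_2)
    then show ?thesis by (simp only: mult.assoc)
  qed
  finally show ?thesis by simp
qed

lemma sum_UNIV_sum:
  fixes f :: "'a::finite + 'b::finite \<Rightarrow> 'c::comm_monoid_add"
  shows "(\<Sum>i\<in>UNIV. f i) = (\<Sum>j\<in>UNIV. f (Inl j)) + (\<Sum>j\<in>UNIV. f (Inr j))"
  using sum.Plus[of UNIV UNIV f] by (simp add: UNIV_Plus_UNIV)

section \<open>Weighted means along the rays and their derivatives\<close>

context
  fixes D :: "'n::finite R2n1 set" and x l u :: "'n R2n1" and R :: real
  assumes D: "open D" and R: "0 < R"
    and ray_in: "\<And>y r. y \<in> cbox l u \<Longrightarrow> 0 \<le> r \<Longrightarrow> r \<le> R \<Longrightarrow> ray x y r \<in> D"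
begin

lemma smooth_on_comp_ray:
  assumes "smooth_on D w"
  shows "open {y. ray x y r \<in> D}" "smooth_on {y. ray x y r \<in> D} (\<lambda>y. w (ray x y r))"
proof -
  have "open ((\<lambda>y. ray x y r) -` D)"
    using D continuous_ray2 by (intro open_vimage)
  then show o: "open {y. ray x y r \<in> D}" by (simp add: vimage_def)
  show "smooth_on {y. ray x y r \<in> D} (\<lambda>y. w (ray x y r))"
    by (intro smooth_on_compose[OF o D _ _ assms] smooth_on_ray o) auto
qed

lemma integrable_ray:
  fixes w \<Psi> :: "'n R2n1 \<Rightarrow> real"
  assumes "smooth_on D w" "smooth_on UNIV \<Psi>" "\<And>y. y \<notin> cbox l u \<Longrightarrow> \<Psi> y = 0" "0 \<le> r" "r \<le> R"
  shows "integrable lborel (\<lambda>y. w (ray x y r) * \<Psi> y)"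
  using smooth_on_comp_ray[OF assms(1)] assms ray_in
  by (intro integrable_mult_supported[of "{y. ray x y r \<in> D}" "cbox l u"]) auto

lemma ray_by_parts:
  fixes w \<Psi> :: "'n R2n1 \<Rightarrow> real"
  assumes w: "smooth_on D w" and p: "smooth_on UNIV \<Psi>" "\<And>y. y \<notin> cbox l u \<Longrightarrow> \<Psi> y = 0" and r: "0 \<le> r" "r \<le> R"
  shows "(LINT y|lborel. r * X_field i w (ray x y r) * \<Psi> y) = - (LINT y|lborel. w (ray x y r) * X_field i \<Psi> y)"
proof -
  note U = smooth_on_comp_ray[OF w, of r]
  have sub: "cbox l u \<subseteq> {y. ray x y r \<in> D}" using ray_in r by blast
  have "r * X_field i w (ray x y r) * \<Psi> y = X_field i (\<lambda>y. w (ray x y r)) y * \<Psi> y" for y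
  proof (cases "y \<in> cbox l u")
    case True
    then show ?thesis using X_field_ray[OF smooth_on_imp_differentiable[OF w]] ray_in r by simp
  qed (use p in auto)
  then have "(LINT y|lborel. r * X_field i w (ray x y r) * \<Psi> y)
     = (LINT y|lborel. X_field i (\<lambda>y. w (ray x y r)) y * \<Psi> y)" by presburger
  also have "\<dots> = - (LINT y|lborel. w (ray x y r) * X_field i \<Psi> y)"
    by (rule X_field_by_parts[OF U(1) compact_cbox sub U(2) p])
  finally show ?thesis .
qed

lemma integral_ray_eq_box:
  fixes w \<Psi> :: "'n R2n1 \<Rightarrow> real"
  assumes "continuous_on D w" "continuous_on UNIV \<Psi>" "\<And>y. y \<notin> cbox l u \<Longrightarrow> \<Psi> y = 0" "0 \<le> r" "r \<le> R"
  shows "(LINT y|lborel. w (ray x y r) * \<Psi> y) = integral (cbox l u) (\<lambda>y. w (ray x y r) * \<Psi> y)"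
proof (rule lborel_integral_eq_box)
  show "continuous_on (cbox l u) (\<lambda>y. w (ray x y r) * \<Psi> y)"
    using ray_in assms
    by (intro continuous_on_mult continuous_on_subset[OF assms(2)] continuous_on_compose2[OF assms(1)] continuous_ray2) auto
qed (use assms in auto)

text \<open>After differentiation under the integral, the term in the last coordinate direction is
  replaced by the commutator, of second order in \<open>w\<close>. Since it comes with the factor
  \<open>r\<close>, \<open>ray_by_parts\<close> takes one field off \<open>w\<close> without
  producing a negative power of \<open>r\<close>.\<close>

lemma ray_integral_derivative:
  fixes w \<Phi> :: "'n R2n1 \<Rightarrow> real"
  assumes w: "smooth_on D w" and p: "smooth_on UNIV \<Phi>" "\<And>y. y \<notin> cbox l u \<Longrightarrow> \<Phi> y = 0" and r: "0 \<le> r" "r \<le> R"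
  shows "((\<lambda>r. LINT y|lborel. w (ray x y r) * \<Phi> y) has_real_derivative
     (\<Sum>i\<in>UNIV. LINT y|lborel. X_field i w (ray x y r) * shift k i \<Phi> y)) (at r within {0..R})"
proof -
  let ?Z = "\<lambda>p. frechet_derivative w (at p) (coord_vec None)"
  let ?E = "\<lambda>y r. (\<Sum>j\<in>UNIV. fst y $ j * X_field (Inl j) w (ray x y r)) + (\<Sum>j\<in>UNIV. bcoord j y * X_field (Inr j) w (ray x y r))
      + r * qcoord y * ?Z (ray x y r)"
  have cw: "continuous_on D w" and cX: "\<And>i. continuous_on D (X_field i w)" and cZ: "continuous_on D ?Z"
    by (intro smooth_on_imp_continuous_on w smooth_on_X_field[OF D w] smooth_on_frechet_derivative[OF w])+
  have cp: "continuous_on UNIV \<Phi>" by (intro smooth_on_imp_continuous_on p)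
  have cq: "continuous_on UNIV (qcoord :: 'n R2n1 \<Rightarrow> real)" by (intro smooth_on_imp_continuous_on smooth_on_qcoord)
  have "((\<lambda>r. integral (cbox l u) (\<lambda>y. w (ray x y r) * \<Phi> y)) has_field_derivative
     integral (cbox l u) (\<lambda>y. ?E y r * \<Phi> y)) (at r within {0..R})"
  proof (rule leibniz_rule_field_derivative)
    show "((\<lambda>r. w (ray x y r) * \<Phi> y) has_real_derivative ?E y r * \<Phi> y) (at r within {0..R})"
      if "r \<in> {0..R}" "y \<in> cbox l u" for r y
      using that ray_in
      by (intro has_field_derivative_at_within[OF DERIV_cmult_right] ray_derivative smooth_on_imp_differentiable[OF w]) auto
    show "(\<lambda>y. w (ray x y r) * \<Phi> y) integrable_on cbox l u" if "r \<in> {0..R}" for r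
      using ray_in that
      by (intro integrable_continuous continuous_on_mult continuous_on_subset[OF cp] continuous_on_compose2[OF cw] continuous_ray2) auto
    have ray: "(\<lambda>p. ray x (snd p) (fst p)) ` ({0..R} \<times> cbox l u) \<subseteq> D" using ray_in by auto
    show "continuous_on ({0..R} \<times> cbox l u) (\<lambda>(r, y). ?E y r * \<Phi> y)"
      unfolding case_prod_beta
      by (intro continuous_on_mult continuous_on_add continuous_on_sum continuous_on_fst continuous_on_snd continuous_on_id
          continuous_on_component
          continuous_on_compose2[OF cX continuous_ray ray] continuous_on_compose2[OF cZ continuous_ray ray]
          continuous_on_compose2[OF cp] continuous_on_compose2[OF cq]
          continuous_on_compose2[OF linear_continuous_on[OF bounded_linear_bcoord, of UNIV]] subset_UNIV)
  qed (use r in auto)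
  then have 1: "((\<lambda>r. LINT y|lborel. w (ray x y r) * \<Phi> y) has_field_derivative
     integral (cbox l u) (\<lambda>y. ?E y r * \<Phi> y)) (at r within {0..R})"
    by (rule has_field_derivative_transform_within[of _ _ _ _ 1]) (use r integral_ray_eq_box[OF cw cp p(2)] in auto)
  have sq: "smooth_on UNIV (\<lambda>y. qcoord y * \<Phi> y)" "\<And>y. y \<notin> cbox l u \<Longrightarrow> qcoord y * \<Phi> y = 0"
    using p by (auto intro: smooth_on_mult smooth_on_qcoord)
  let ?L = "X_field (Inl k) w" and ?R = "X_field (Inr k) w" and ?q = "\<lambda>y. qcoord y * \<Phi> y"
  have sXw: "smooth_on D (X_field i w)" for i by (rule smooth_on_X_field[OF D w])
  note int = integrable_ray[OF _ _ _ r]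
  have ia: "integrable lborel (\<lambda>y. X_field (Inl j) w (ray x y r) * (fst y $ j * \<Phi> y))" for j
    using p by (intro int sXw smooth_on_mult smooth_on_bounded_linear[OF _ bounded_linear_acoord]) auto
  have ib: "integrable lborel (\<lambda>y. X_field (Inr j) w (ray x y r) * (bcoord j y * \<Phi> y))" for j
    using p by (intro int sXw smooth_on_mult smooth_on_bcoord) auto
  have sqX: "smooth_on UNIV (X_field i ?q)" "\<And>y. y \<notin> cbox l u \<Longrightarrow> X_field i ?q y = 0" for i
    by (rule smooth_on_X_field[OF open_UNIV sq(1)]) (rule X_field_supported[OF closed_cbox sq(2)])
  have ic: "integrable lborel (\<lambda>y. ?L (ray x y r) * X_field i ?q y)"
      "integrable lborel (\<lambda>y. ?R (ray x y r) * X_field i ?q y)" for i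
    by (intro int sXw sqX; assumption)+
  have id: "integrable lborel (\<lambda>y. r * X_field (Inr k) ?L (ray x y r) * ?q y)"
      "integrable lborel (\<lambda>y. r * X_field (Inl k) ?R (ray x y r) * ?q y)"
    using int[OF smooth_on_X_field[OF D sXw] sq] by (simp_all add: mult.assoc)
  \<comment> \<open>Inside the box the rays stay in \<open>D\<close>, where the commutator formula
    holds; outside it both sides vanish with \<open>\<Phi>\<close>.\<close>
  have E: "?E y r * \<Phi> y = (\<Sum>j\<in>UNIV. X_field (Inl j) w (ray x y r) * (fst y $ j * \<Phi> y))
     + (\<Sum>j\<in>UNIV. X_field (Inr j) w (ray x y r) * (bcoord j y * \<Phi> y))
     + (r * X_field (Inr k) ?L (ray x y r) * ?q y - r * X_field (Inl k) ?R (ray x y r) * ?q y)" for y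
  proof (cases "y \<in> cbox l u")
    case True
    then show ?thesis
      by (simp only: X_commutator[OF D w ray_in[OF True r], where j=k])
        (simp add: algebra_simps sum_distrib_left)
  qed (use p in auto)
  have "integral (cbox l u) (\<lambda>y. ?E y r * \<Phi> y) = (LINT y|lborel. ?E y r * \<Phi> y)"
  proof (rule lborel_integral_eq_box[symmetric])
    have ray: "(\<lambda>y. ray x y r) ` cbox l u \<subseteq> D" using ray_in r by auto
    show "continuous_on (cbox l u) (\<lambda>y. ?E y r * \<Phi> y)"
      by (intro continuous_on_mult continuous_on_add continuous_on_sum continuous_on_fst continuous_on_id
          continuous_on_component continuous_on_const
          continuous_on_compose2[OF cX continuous_ray2 ray] continuous_on_compose2[OF cZ continuous_ray2 ray]
          continuous_on_subset[OF cp] continuous_on_subset[OF cq]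
          linear_continuous_on[OF bounded_linear_bcoord] subset_UNIV)
  qed (use p in auto)
  also have "\<dots> = (\<Sum>j\<in>UNIV. LINT y|lborel. X_field (Inl j) w (ray x y r) * (fst y $ j * \<Phi> y))
     + (\<Sum>j\<in>UNIV. LINT y|lborel. X_field (Inr j) w (ray x y r) * (bcoord j y * \<Phi> y))
     + ((LINT y|lborel. r * X_field (Inr k) ?L (ray x y r) * ?q y) - (LINT y|lborel. r * X_field (Inl k) ?R (ray x y r) * ?q y))"
    unfolding E using ia ib id by simp
  also have "\<dots> = (\<Sum>j\<in>UNIV. LINT y|lborel. X_field (Inl j) w (ray x y r) * (fst y $ j * \<Phi> y))
     + (\<Sum>j\<in>UNIV. LINT y|lborel. X_field (Inr j) w (ray x y r) * (bcoord j y * \<Phi> y))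
     + (- (LINT y|lborel. ?L (ray x y r) * X_field (Inr k) ?q y) + (LINT y|lborel. ?R (ray x y r) * X_field (Inl k) ?q y))"
    by (simp add: ray_by_parts[OF sXw sq r])
  also have "\<dots> = (\<Sum>i\<in>UNIV. LINT y|lborel. X_field i w (ray x y r) * shift k i \<Phi> y)"
  proof -
    have "(LINT y|lborel. X_field (Inl j) w (ray x y r) * shift k (Inl j) \<Phi> y)
      = (LINT y|lborel. X_field (Inl j) w (ray x y r) * (fst y $ j * \<Phi> y))
        - of_bool (j = k) * (LINT y|lborel. ?L (ray x y r) * X_field (Inr k) ?q y)" for j
      using ia[of j] ic by (cases "j = k") (simp_all add: right_diff_distrib)
    moreover have "(LINT y|lborel. X_field (Inr j) w (ray x y r) * shift k (Inr j) \<Phi> y)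
      = (LINT y|lborel. X_field (Inr j) w (ray x y r) * (bcoord j y * \<Phi> y))
        + of_bool (j = k) * (LINT y|lborel. ?R (ray x y r) * X_field (Inl k) ?q y)" for j
      using ib[of j] ic by (cases "j = k") (simp_all add: distrib_left)
    moreover have "(\<Sum>j\<in>UNIV. of_bool (j = k) * c) = c" for c :: real
      by (simp add: of_bool_def if_distrib[of "\<lambda>x. x * c"] cong: if_cong)
    ultimately show ?thesis
      unfolding sum_UNIV_sum by (simp add: sum_subtractf sum.distrib)
  qed
  finally show ?thesis using 1 by simp
qed

lemma shifts_props:
  assumes "smooth_on UNIV \<Phi>" "\<And>y. y \<notin> cbox l u \<Longrightarrow> \<Phi> y = 0"
  shows "smooth_on UNIV (foldr (shift k) J \<Phi>)" "y \<notin> cbox l u \<Longrightarrow> foldr (shift k) J \<Phi> y = 0"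
proof -
  show "smooth_on UNIV (foldr (shift k) J \<Phi>)"
    by (induction J) (auto intro: smooth_on_shift assms)
  show "y \<notin> cbox l u \<Longrightarrow> foldr (shift k) J \<Phi> y = 0"
  proof (induction J arbitrary: y)
    case (Cons i J)
    show ?case using shift_supported[OF closed_cbox Cons.IH Cons.prems] by simp
  qed (simp add: assms)
qed

lemma sum_lists_Suc:
  fixes f :: "('n + 'n) list \<Rightarrow> real"
  shows "(\<Sum>J | length J = Suc m. f J) = (\<Sum>J | length J = m. \<Sum>i\<in>UNIV. f (i # J))"
proof -
  have fin: "finite {J :: ('n + 'n) list. length J = m}"
    using finite_lists_length_eq[of "UNIV :: ('n + 'n) set" m] by simp
  have "{J. length J = Suc m} = (\<lambda>(J, i). i # J) ` ({J :: ('n + 'n) list. length J = m} \<times> UNIV)"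
    by (auto simp: length_Suc_conv image_iff)
  then have "(\<Sum>J | length J = Suc m. f J) = (\<Sum>(J, i) \<in> {J. length J = m} \<times> UNIV. f (i # J))"
    by (simp add: sum.reindex inj_on_def case_prod_beta)
  then show ?thesis by (simp add: sum.cartesian_product)
qed

text \<open>The \<open>m\<close>-th derivative of the function \<open>g\<close> of the overview,
  with the weights that \<open>m\<close> applications of \<open>ray_integral_derivative\<close>
  produce.\<close>

definition mean :: "'n \<Rightarrow> ('n R2n1 \<Rightarrow> real) \<Rightarrow> ('n R2n1 \<Rightarrow> real) \<Rightarrow> nat \<Rightarrow> real \<Rightarrow> real" where
  "mean k w \<Phi> m r = (\<Sum>J | length J = m. LINT y|lborel. X_multi J w (ray x y r) * foldr (shift k) J \<Phi> y)"

lemma mean_derivative: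
  assumes w: "smooth_on D w" and p: "smooth_on UNIV \<Phi>" "\<And>y. y \<notin> cbox l u \<Longrightarrow> \<Phi> y = 0" and r: "0 \<le> r" "r \<le> R"
  shows "(mean k w \<Phi> m has_real_derivative mean k w \<Phi> (Suc m) r) (at r within {0..R})"
proof -
  have "((\<lambda>r. \<Sum>J | length J = m. LINT y|lborel. X_multi J w (ray x y r) * foldr (shift k) J \<Phi> y) has_real_derivative
      (\<Sum>J | length J = m. \<Sum>i\<in>UNIV. LINT y|lborel. X_field i (X_multi J w) (ray x y r) * shift k i (foldr (shift k) J \<Phi>) y))
      (at r within {0..R})"
    by (intro DERIV_sum ray_integral_derivative smooth_on_X_multi[OF D w] shifts_props[OF p] r)
  then show ?thesis by (simp add: mean_def[abs_def] sum_lists_Suc)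
qed

text \<open>The sum is the Taylor polynomial of \<open>mean k w \<Phi> 0\<close> with moving centre
  \<open>r\<close>, evaluated at 0. Differentiating in the centre telescopes to the last
  term.\<close>

lemma mean_taylor_derivative:
  assumes w: "smooth_on D w" and p: "smooth_on UNIV \<Phi>" "\<And>y. y \<notin> cbox l u \<Longrightarrow> \<Phi> y = 0" and r: "0 \<le> r" "r \<le> R"
  shows "((\<lambda>r. \<Sum>m<Suc N. mean k w \<Phi> m r * (- r) ^ m / fact m) has_real_derivative
      mean k w \<Phi> (Suc N) r * (- r) ^ N / fact N) (at r within {0..R})"
proof (induction N)
  case 0
  show ?case using mean_derivative[OF w p r, of k 0] by simp
next
  case (Suc N)
  have "((\<lambda>r. mean k w \<Phi> (Suc N) r * (- r) ^ Suc N / fact (Suc N)) has_real_derivative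
      mean k w \<Phi> (Suc (Suc N)) r * (- r) ^ Suc N / fact (Suc N)
      + mean k w \<Phi> (Suc N) r * (- (real (Suc N) * (- r) ^ N)) / fact (Suc N)) (at r within {0..R})"
  proof -
    have "((\<lambda>r. (- r) ^ Suc N) has_real_derivative - (real (Suc N) * (- r) ^ N)) (at r within {0..R})"
      by (rule derivative_eq_intros refl)+ simp
    moreover have "(mean k w \<Phi> (Suc N) has_real_derivative mean k w \<Phi> (Suc (Suc N)) r) (at r within {0..R})"
      by (intro mean_derivative assms)
    ultimately have "((\<lambda>r. mean k w \<Phi> (Suc N) r * (- r) ^ Suc N / fact (Suc N)) has_real_derivative
      (mean k w \<Phi> (Suc (Suc N)) r * (- r) ^ Suc N + - (real (Suc N) * (- r) ^ N) * mean k w \<Phi> (Suc N) r) / fact (Suc N))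
      (at r within {0..R})"
      by (intro DERIV_cdivide DERIV_mult)
    then
    show ?thesis by (simp only: add_divide_distrib mult.commute[of "mean k w \<Phi> (Suc N) r"])
  qed
  moreover have "mean k w \<Phi> (Suc N) r * (- (real (Suc N) * (- r) ^ N)) / fact (Suc N) = - (mean k w \<Phi> (Suc N) r * (- r) ^ N / fact N)"
    by (simp add: field_simps del: of_nat_Suc)
  ultimately have 1: "((\<lambda>r. mean k w \<Phi> (Suc N) r * (- r) ^ Suc N / fact (Suc N)) has_real_derivative
      mean k w \<Phi> (Suc (Suc N)) r * (- r) ^ Suc N / fact (Suc N) - mean k w \<Phi> (Suc N) r * (- r) ^ N / fact N) (at r within {0..R})"
    by (simp only: diff_conv_add_uminus)
  have "((\<lambda>r. (\<Sum>m<Suc N. mean k w \<Phi> m r * (- r) ^ m / fact m) + mean k w \<Phi> (Suc N) r * (- r) ^ Suc N / fact (Suc N))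
     has_real_derivative mean k w \<Phi> (Suc N) r * (- r) ^ N / fact N + (mean k w \<Phi> (Suc (Suc N)) r * (- r) ^ Suc N / fact (Suc N) - mean k w \<Phi> (Suc N) r * (- r) ^ N / fact N)) (at r within {0..R})"
    by (rule DERIV_add[OF Suc.IH 1])
  then show ?case by (simp only: sum.lessThan_Suc[of _ "Suc N"] add_diff_cancel_left' add_diff_eq[symmetric] diff_add_cancel) (simp add: algebra_simps)
qed

text \<open>Cauchy-Schwarz in \<open>y\<close>, with the square integral of \<open>v\<close> along
  the rays bounded by \<open>nn_integral_ray\<close>; the square root halves the homogeneous
  dimension \<open>2n + 2\<close>.\<close>

lemma ray_integral_bound:
  fixes v \<Psi> :: "'n R2n1 \<Rightarrow> real"
  assumes v: "continuous_on D v" "set_integrable lebesgue D (\<lambda>p. (v p)\<^sup>2)"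
    and p: "continuous_on UNIV \<Psi>" "\<And>y. y \<notin> cbox l u \<Longrightarrow> \<Psi> y = 0" and r: "0 < r" "r \<le> R"
  shows "\<bar>LINT y|lborel. v (ray x y r) * \<Psi> y\<bar> * r ^ (CARD('n) + 1)
      \<le> sqrt (LINT p:D|lebesgue. (v p)\<^sup>2) * sqrt (LINT y|lborel. (\<Psi> y)\<^sup>2)"
proof -
  let ?f = "\<lambda>y. indicator (cbox l u) y * v (ray x y r)"
  have ray: "(\<lambda>y. ray x y r) ` cbox l u \<subseteq> D" using ray_in r by auto
  have cv: "continuous_on (cbox l u) (\<lambda>y. v (ray x y r))"
    by (rule continuous_on_compose2[OF v(1) continuous_ray2 ray])
  have fm [measurable]: "?f \<in> borel_measurable borel"
    using borel_measurable_continuous_on_indicator[OF _ cv] by simp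
  have fi: "integrable lborel (\<lambda>y. (?f y)\<^sup>2)"
  proof -
    have "integrable lborel (\<lambda>y. indicator (cbox l u) y *\<^sub>R (v (ray x y r))\<^sup>2)"
      by (rule borel_integrable_compact) (auto intro: continuous_on_power cv)
    moreover have "(\<lambda>y. indicator (cbox l u) y *\<^sub>R (v (ray x y r))\<^sup>2) = (\<lambda>y. (?f y)\<^sup>2)"
      by (auto simp: indicator_def)
    ultimately show ?thesis by simp
  qed
  have pm [measurable]: "\<Psi> \<in> borel_measurable borel"
    using p(1) by (rule borel_measurable_continuous_onI)
  have pi: "integrable lborel (\<lambda>y. (\<Psi> y)\<^sup>2)"
    by (rule integrable_lborel_compact_support[OF compact_cbox[of l u]])
      (use p(2) in \<open>auto intro!: continuous_on_power continuous_on_subset[OF p(1)]\<close>)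
  have eq: "v (ray x y r) * \<Psi> y = ?f y * \<Psi> y" for y
    using p(2)[of y] by (auto simp: indicator_def)
  define N where "N = (LINT p:D|lebesgue. (v p)\<^sup>2)"
  \<comment> \<open>\<open>v\<^sup>2\<close> extended by zero outside \<open>D\<close>, since the
    scaling formula is about integrals over the whole space.\<close>
  define F where "F = (\<lambda>p. indicator D p * (v p)\<^sup>2)"
  have Fm [measurable]: "F \<in> borel_measurable borel"
    using borel_measurable_continuous_on_indicator[OF _ continuous_on_power[OF v(1), of 2]] D by (simp add: F_def)
  have Fi: "integrable lborel F"
    using v(2) unfolding set_integrable_def by (simp add: F_def integrable_completion Fm[unfolded F_def])
  have N: "N = (LINT p|lborel. F p)"
    unfolding N_def set_lebesgue_integral_def F_def by (simp add: integral_completion Fm[unfolded F_def])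
  have "ennreal (r ^ (2 * CARD('n) + 2)) * (\<integral>\<^sup>+y. ennreal ((?f y)\<^sup>2) \<partial>lborel)
      \<le> ennreal (r ^ (2 * CARD('n) + 2)) * (\<integral>\<^sup>+y. ennreal (F (ray x y r)) \<partial>lborel)"
    using ray by (intro mult_left_mono nn_integral_mono) (auto simp: F_def indicator_def)
  also have "\<dots> = (\<integral>\<^sup>+y. ennreal (F y) \<partial>lborel)"
    by (rule nn_integral_ray[OF _ r(1)]) measurable
  also have "\<dots> = ennreal N"
    unfolding N by (intro nn_integral_eq_integral Fi) (auto simp: F_def)
  also have "(\<integral>\<^sup>+y. ennreal ((?f y)\<^sup>2) \<partial>lborel) = ennreal (LINT y|lborel. (?f y)\<^sup>2)"
    by (intro nn_integral_eq_integral fi) auto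
  finally have "r ^ (2 * CARD('n) + 2) * (LINT y|lborel. (?f y)\<^sup>2) \<le> N"
    using r N by (subst (asm) ennreal_mult[symmetric]) (auto simp: F_def intro!: integral_nonneg)
  moreover have "r ^ (2 * CARD('n) + 2) = (r ^ (CARD('n) + 1))\<^sup>2"
  proof -
    have "2 * CARD('n) + 2 = (CARD('n) + 1) * 2" by simp
    then show ?thesis by (simp only: power_mult)
  qed
  ultimately have "(r ^ (CARD('n) + 1))\<^sup>2 * (LINT y|lborel. (?f y)\<^sup>2) \<le> N"
    by (simp only:)
  then have "sqrt ((r ^ (CARD('n) + 1))\<^sup>2 * (LINT y|lborel. (?f y)\<^sup>2)) \<le> sqrt N"
    by (rule real_sqrt_le_mono)
  then have b: "r ^ (CARD('n) + 1) * sqrt (LINT y|lborel. (?f y)\<^sup>2) \<le> sqrt N"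
    using r by (simp add: real_sqrt_mult abs_mult)
  have "\<bar>LINT y|lborel. ?f y * \<Psi> y\<bar> * r ^ (CARD('n) + 1)
      \<le> (sqrt (LINT y|lborel. (?f y)\<^sup>2) * sqrt (LINT y|lborel. (\<Psi> y)\<^sup>2)) * r ^ (CARD('n) + 1)"
    using r by (intro mult_right_mono cauchy_schwarz_integral(2) fi pi) auto
  also have "\<dots> \<le> sqrt N * sqrt (LINT y|lborel. (\<Psi> y)\<^sup>2)"
    using mult_right_mono[OF b, of "sqrt (LINT y|lborel. (\<Psi> y)\<^sup>2)"] by (simp add: mult_ac)
  finally show ?thesis unfolding N_def eq .
qed

text \<open>With \<open>n + 2\<close> terms, the derivative of the Taylor polynomial contains
  \<open>r ^ (n + 1)\<close>, which cancels exactly the singular factor in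
  \<open>ray_integral_bound\<close>. The terms at \<open>r = R\<close> are harmless and give the
  quotients by \<open>R ^ (n + 1)\<close>.\<close>

lemma pointwise_bound:
  fixes w \<Phi> :: "'n R2n1 \<Rightarrow> real" and k :: 'n
  assumes w: "smooth_on D w" "\<And>J. length J \<le> CARD('n) + 2 \<Longrightarrow> set_integrable lebesgue D (\<lambda>p. (X_multi J w p)\<^sup>2)"
    and p: "smooth_on UNIV \<Phi>" "\<And>y. y \<notin> cbox l u \<Longrightarrow> \<Phi> y = 0"
    and B: "\<And>J. length J \<le> CARD('n) + 2 \<Longrightarrow> sqrt (LINT p:D|lebesgue. (X_multi J w p)\<^sup>2) \<le> B"
  defines "A \<equiv> \<lambda>m. \<Sum>J | length J = m. sqrt (LINT y|lborel. (foldr (shift k) J \<Phi> y)\<^sup>2)"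
  shows "\<bar>w x * (LINT y|lborel. \<Phi> y)\<bar>
    \<le> ((\<Sum>m<CARD('n) + 2. A m * R ^ m / fact m / R ^ (CARD('n) + 1)) + R * A (CARD('n) + 2)) * B"
proof -
  let ?N = "CARD('n) + 1"
  have "0 \<le> (LINT p:D|lebesgue. (X_multi [] w p)\<^sup>2)"
    unfolding set_lebesgue_integral_def by (intro integral_nonneg_AE) auto
  then have B0: "0 \<le> B" using order_trans[OF real_sqrt_ge_zero B[of "[]"]] by simp
  have A0: "0 \<le> A m" for m unfolding A_def by (intro sum_nonneg) auto
  have bound: "\<bar>mean k w \<Phi> m r\<bar> * r ^ ?N \<le> A m * B" if "m \<le> CARD('n) + 2" "0 < r" "r \<le> R" for m r
  proof -
    have "\<bar>mean k w \<Phi> m r\<bar> * r ^ ?N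
      \<le> (\<Sum>J | length J = m. \<bar>LINT y|lborel. X_multi J w (ray x y r) * foldr (shift k) J \<Phi> y\<bar>) * r ^ ?N"
      unfolding mean_def using that by (intro mult_right_mono sum_abs) auto
    also have "\<dots> = (\<Sum>J | length J = m. \<bar>LINT y|lborel. X_multi J w (ray x y r) * foldr (shift k) J \<Phi> y\<bar> * r ^ ?N)"
      by (simp add: sum_distrib_right)
    also have "\<dots> \<le> (\<Sum>J | length J = m. B * sqrt (LINT y|lborel. (foldr (shift k) J \<Phi> y)\<^sup>2))"
    proof (rule sum_mono)
      fix J :: "('n + 'n) list" assume "J \<in> {J. length J = m}"
      then have J: "length J \<le> CARD('n) + 2" using that by simp
      have "\<bar>LINT y|lborel. X_multi J w (ray x y r) * foldr (shift k) J \<Phi> y\<bar> * r ^ ?N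
        \<le> sqrt (LINT p:D|lebesgue. (X_multi J w p)\<^sup>2) * sqrt (LINT y|lborel. (foldr (shift k) J \<Phi> y)\<^sup>2)"
        by (intro ray_integral_bound smooth_on_imp_continuous_on smooth_on_X_multi[OF D w(1)] w(2)[OF J] shifts_props[OF p] that)
      also have "\<dots> \<le> B * sqrt (LINT y|lborel. (foldr (shift k) J \<Phi> y)\<^sup>2)"
        by (intro mult_right_mono B[OF J]) auto
      finally show "\<bar>LINT y|lborel. X_multi J w (ray x y r) * foldr (shift k) J \<Phi> y\<bar> * r ^ ?N
        \<le> B * sqrt (LINT y|lborel. (foldr (shift k) J \<Phi> y)\<^sup>2)" .
    qed
    also have "\<dots> = A m * B" unfolding A_def by (simp add: sum_distrib_left mult.commute)
    finally show ?thesis .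
  qed
  define h where "h = (\<lambda>r. \<Sum>m<Suc ?N. mean k w \<Phi> m r * (- r) ^ m / fact m)"
  have dh: "(h has_real_derivative mean k w \<Phi> (Suc ?N) r * (- r) ^ ?N / fact ?N) (at r within {0..R})"
    if "0 \<le> r" "r \<le> R" for r
    unfolding h_def by (rule mean_taylor_derivative[OF w(1) p that])
  have dh': "(h has_real_derivative mean k w \<Phi> (Suc ?N) r * (- r) ^ ?N / fact ?N) (at r)"
    if "0 < r" "r < R" for r
    using dh[of r] that at_within_interior[of r "{0..R}"] by simp
  have ch: "continuous_on {0..R} h"
    unfolding continuous_on_eq_continuous_within using DERIV_continuous[OF dh] by simp
  \<comment> \<open>The mean value theorem evaluates the derivative at an interior point, where
    \<open>bound\<close> is available; at \<open>r = 0\<close> continuity of \<open>h\<close> is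
    enough.\<close>
  obtain d z where z: "0 < z" "z < R" "(h has_real_derivative d) (at z)" "h R - h 0 = (R - 0) * d"
    using MVT[OF R ch] dh' real_differentiable_def by blast
  have "\<bar>d\<bar> = \<bar>mean k w \<Phi> (Suc ?N) z\<bar> * z ^ ?N / fact ?N"
    using DERIV_unique[OF z(3) dh'[OF z(1,2)]] z(1) by (simp add: abs_mult power_abs)
  also have "\<dots> \<le> A (Suc ?N) * B / fact ?N"
    using bound[of "Suc ?N" z] z by (intro divide_right_mono) auto
  also have "\<dots> \<le> A (Suc ?N) * B"
    using divide_left_mono[OF fact_ge_1[of ?N, where 'a=real], of "A (Suc ?N) * B"] A0[of "Suc ?N"] B0
    by (simp del: fact_Suc)
  finally have d: "\<bar>d\<bar> \<le> A (Suc ?N) * B" .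
  have "\<bar>h R\<bar> \<le> (\<Sum>m<Suc ?N. \<bar>mean k w \<Phi> m R * (- R) ^ m / fact m\<bar>)"
    unfolding h_def by (rule sum_abs)
  also have "\<dots> \<le> (\<Sum>m<Suc ?N. A m * R ^ m / fact m / R ^ ?N * B)"
  proof (rule sum_mono)
    fix m assume "m \<in> {..<Suc ?N}"
    then have "\<bar>mean k w \<Phi> m R\<bar> * R ^ ?N \<le> A m * B" using bound[of m R] R by auto
    then have "\<bar>mean k w \<Phi> m R\<bar> \<le> A m * B / R ^ ?N" using R by (simp add: pos_le_divide_eq del: power_Suc)
    then have "\<bar>mean k w \<Phi> m R\<bar> * (R ^ m / fact m) \<le> A m * B / R ^ ?N * (R ^ m / fact m)"
      using R by (intro mult_right_mono) auto
    then show "\<bar>mean k w \<Phi> m R * (- R) ^ m / fact m\<bar> \<le> A m * R ^ m / fact m / R ^ ?N * B"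
      using R by (simp add: abs_mult power_abs mult_ac)
  qed
  also have "\<dots> = (\<Sum>m<Suc ?N. A m * R ^ m / fact m / R ^ ?N) * B"
    by (rule sum_distrib_right[symmetric])
  finally have hR: "\<bar>h R\<bar> \<le> (\<Sum>m<Suc ?N. A m * R ^ m / fact m / R ^ ?N) * B" .
  \<comment> \<open>At \<open>r = 0\<close> all terms with \<open>m > 0\<close> vanish, and the ray
    is constantly \<open>x\<close>.\<close>
  have "h 0 = mean k w \<Phi> 0 0"
    unfolding h_def by (subst sum.lessThan_Suc_shift) simp
  then have h0: "h 0 = w x * (LINT y|lborel. \<Phi> y)"
    by (simp add: mean_def)
  have "\<bar>h 0\<bar> \<le> \<bar>h R\<bar> + R * \<bar>d\<bar>"
    using z(4) R abs_triangle_ineq4[of "h R" "R * d"] by (simp add: abs_mult)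
  also have "\<dots> \<le> (\<Sum>m<Suc ?N. A m * R ^ m / fact m / R ^ ?N) * B + R * (A (Suc ?N) * B)"
    using hR d R by (intro add_mono mult_left_mono) auto
  finally show ?thesis unfolding h0 by (simp add: distrib_right mult.assoc)
qed

end

section \<open>Norms on a region\<close>

text \<open>Integrability of the square leaves the sign of \<open>v\<close> arbitrary, so
  measurability of \<open>v\<close> is demanded separately.\<close>

definition l2_on :: "'e::euclidean_space set \<Rightarrow> ('e \<Rightarrow> real) \<Rightarrow> bool" where
  "l2_on S v \<longleftrightarrow> set_borel_measurable lebesgue S v \<and> set_integrable lebesgue S (\<lambda>p. (v p)\<^sup>2)"

definition l2 :: "'e::euclidean_space set \<Rightarrow> ('e \<Rightarrow> real) \<Rightarrow> real" where
  "l2 S v = sqrt (LINT p:S|lebesgue. (v p)\<^sup>2)"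

lemma set_integral_square_nonneg: "0 \<le> (LINT p:S|M. (v p :: real)\<^sup>2)"
  unfolding set_lebesgue_integral_def by (intro integral_nonneg_AE) auto

lemma l2_nonneg [simp]: "0 \<le> l2 S v"
  by (simp add: l2_def set_integral_square_nonneg)

lemma l2_square: "(l2 S v)\<^sup>2 = (LINT p:S|lebesgue. (v p)\<^sup>2)"
  by (simp add: l2_def set_integral_square_nonneg)

lemma set_borel_measurable_continuous_lebesgue:
  fixes v :: "'e::euclidean_space \<Rightarrow> real"
  assumes "compact K" "S \<subseteq> K" "S \<in> sets lebesgue" "continuous_on K v"
  shows "set_borel_measurable lebesgue S v"
  using set_integrable_continuous[OF assms]
  unfolding set_integrable_def set_borel_measurable_def by (rule borel_measurable_integrable)

lemma l2_on_continuous: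
  assumes "compact K" "S \<subseteq> K" "S \<in> sets lebesgue" "continuous_on K v"
  shows "l2_on S v"
  unfolding l2_on_def
  using set_borel_measurable_continuous_lebesgue[OF assms]
    set_integrable_continuous[OF assms(1-3) continuous_on_power[OF assms(4), of 2]] by simp

lemma indicator_square: "(indicator S x *\<^sub>R v x)\<^sup>2 = indicator S x *\<^sub>R (v x :: real)\<^sup>2"
  by (simp add: indicator_def)

lemma l2_cauchy_schwarz:
  assumes "l2_on S v" "l2_on S w"
  shows "set_integrable lebesgue S (\<lambda>p. v p * w p)"
    and "\<bar>LINT p:S|lebesgue. v p * w p\<bar> \<le> l2 S v * l2 S w"
proof -
  let ?v = "\<lambda>x. indicator S x *\<^sub>R v x" and ?w = "\<lambda>x. indicator S x *\<^sub>R w x"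
  have m: "?v \<in> borel_measurable lebesgue" "?w \<in> borel_measurable lebesgue"
    and i: "integrable lebesgue (\<lambda>x. (?v x)\<^sup>2)" "integrable lebesgue (\<lambda>x. (?w x)\<^sup>2)"
    using assms unfolding l2_on_def set_borel_measurable_def set_integrable_def indicator_square by auto
  have e: "?v x * ?w x = indicator S x *\<^sub>R (v x * w x)" for x by (simp add: indicator_def)
  show "set_integrable lebesgue S (\<lambda>p. v p * w p)"
    using cauchy_schwarz_integral(1)[OF m i] unfolding set_integrable_def e .
  show "\<bar>LINT p:S|lebesgue. v p * w p\<bar> \<le> l2 S v * l2 S w"
    using cauchy_schwarz_integral(2)[OF m i] unfolding e indicator_square l2_def set_lebesgue_integral_def .
qed

lemma l2_mono:
  assumes "l2_on S w" "l2_on S v" "\<And>x. x \<in> S \<Longrightarrow> \<bar>v x\<bar> \<le> \<bar>w x\<bar>"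
  shows "l2 S v \<le> l2 S w"
  unfolding l2_def
  using assms by (intro real_sqrt_le_mono set_integral_mono) (auto simp: l2_on_def abs_le_square_iff)

lemma l2_cmult: "l2 S (\<lambda>x. c * v x) = \<bar>c\<bar> * l2 S v"
  unfolding l2_def by (simp add: power_mult_distrib real_sqrt_mult)

lemma l2_zero [simp]: "l2 S (\<lambda>x. 0) = 0"
  by (simp add: l2_def)

lemma l2_mult_le:
  assumes "l2_on S w" "l2_on S (\<lambda>x. v x * w x)" "\<And>x. x \<in> S \<Longrightarrow> \<bar>v x\<bar> \<le> B"
  shows "l2 S (\<lambda>x. v x * w x) \<le> \<bar>B\<bar> * l2 S w"
proof -
  have "l2_on S (\<lambda>x. B * w x)"
    using assms(1) set_integrable_mult_right[of "B\<^sup>2" lebesgue S "\<lambda>p. (w p)\<^sup>2"]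
    unfolding l2_on_def set_borel_measurable_def by (auto simp: power_mult_distrib mult.left_commute)
  then have "l2 S (\<lambda>x. v x * w x) \<le> l2 S (\<lambda>x. B * w x)"
    using assms(2,3) by (intro l2_mono) (auto simp: abs_mult intro!: mult_right_mono order_trans[OF assms(3) abs_ge_self])
  then show ?thesis by (simp add: l2_cmult)
qed

lemma l2_subset:
  assumes "l2_on T v" "S \<in> sets lebesgue" "S \<subseteq> T"
  shows "l2 S v \<le> l2 T v"
proof -
  have "set_integrable lebesgue S (\<lambda>p. (v p)\<^sup>2)"
    using assms set_integrable_subset[of lebesgue T "\<lambda>p. (v p)\<^sup>2" S] by (simp add: l2_on_def)
  then show ?thesis
    using assms unfolding l2_def set_lebesgue_integral_def set_integrable_def l2_on_def
    by (intro real_sqrt_le_mono integral_mono) (auto simp: indicator_def)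
qed

lemma l2_add:
  assumes v: "l2_on S v" and w: "l2_on S w"
  shows "l2_on S (\<lambda>x. v x + w x)" "l2 S (\<lambda>x. v x + w x) \<le> l2 S v + l2 S w"
proof -
  have e: "(\<lambda>x. (v x + w x)\<^sup>2) = (\<lambda>x. (v x)\<^sup>2 + (2 * (v x * w x) + (w x)\<^sup>2))"
    by (auto simp: power2_sum)
  have i: "set_integrable lebesgue S (\<lambda>x. 2 * (v x * w x) + (w x)\<^sup>2)"
    using l2_cauchy_schwarz(1)[OF v w] w by (intro set_integral_add set_integrable_mult_right) (auto simp: l2_on_def)
  show "l2_on S (\<lambda>x. v x + w x)"
    using v w i unfolding l2_on_def set_borel_measurable_def e
    by (auto simp: distrib_left intro!: set_integral_add)
  have "(l2 S (\<lambda>x. v x + w x))\<^sup>2 = (l2 S v)\<^sup>2 + (2 * (LINT x:S|lebesgue. v x * w x) + (l2 S w)\<^sup>2)"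
    unfolding l2_square e
    using v w i l2_cauchy_schwarz(1)[OF v w] by (subst set_integral_add; (subst set_integral_add)?) (auto simp: l2_on_def)
  also have "\<dots> \<le> (l2 S v)\<^sup>2 + (2 * (l2 S v * l2 S w) + (l2 S w)\<^sup>2)"
    using l2_cauchy_schwarz(2)[OF v w] by linarith
  also have "\<dots> = (l2 S v + l2 S w)\<^sup>2" by (simp add: power2_sum)
  finally show "l2 S (\<lambda>x. v x + w x) \<le> l2 S v + l2 S w"
    by (rule power2_le_imp_le) simp
qed

lemma l2_sum:
  assumes "\<And>i. i \<in> A \<Longrightarrow> l2_on S (v i)"
  shows "l2_on S (\<lambda>x. \<Sum>i\<in>A. v i x) \<and> l2 S (\<lambda>x. \<Sum>i\<in>A. v i x) \<le> (\<Sum>i\<in>A. l2 S (v i))"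
proof -
  have z: "l2_on S (\<lambda>x. 0)" by (simp add: l2_on_def set_borel_measurable_def set_integrable_def)
  show ?thesis using assms
  proof (induction A rule: infinite_finite_induct)
    case (insert a F)
    then have IH: "l2_on S (\<lambda>x. \<Sum>i\<in>F. v i x)" "l2 S (\<lambda>x. \<Sum>i\<in>F. v i x) \<le> (\<Sum>i\<in>F. l2 S (v i))" "l2_on S (v a)" by auto
    then show ?case using insert(1,2) l2_add[OF IH(3,1)] by simp
  qed (auto simp: z)
qed


section \<open>Functions smooth up to the boundary and their norms\<close>

lemma smooth_closureE:
  assumes "smooth_closure D u"
  obtains W where "open W" "closure D \<subseteq> W" "D \<subseteq> W" "smooth_on W u"
  using assms closure_subset unfolding smooth_closure_def by blast

lemma smooth_closure_combine:
  assumes "smooth_closure D u" "smooth_closure D v"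
  obtains W where "open W" "closure D \<subseteq> W" "D \<subseteq> W" "smooth_on W u" "smooth_on W v"
proof -
  obtain W1 where 1: "open W1" "closure D \<subseteq> W1" "D \<subseteq> W1" "smooth_on W1 u"
    using assms(1) by (rule smooth_closureE)
  obtain W2 where 2: "open W2" "closure D \<subseteq> W2" "D \<subseteq> W2" "smooth_on W2 v"
    using assms(2) by (rule smooth_closureE)
  show ?thesis
    by (rule that[of "W1 \<inter> W2"]) (use 1 2 in \<open>auto intro: smooth_on_subset\<close>)
qed

lemma smooth_closure_mult:
  fixes u v :: "'e::euclidean_space \<Rightarrow> real"
  assumes "smooth_closure D u" "smooth_closure D v"
  shows "smooth_closure D (\<lambda>x. u x * v x)"
  by (rule smooth_closure_combine[OF assms]) (auto simp: smooth_closure_def intro!: smooth_on_mult)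

lemma smooth_closure_add:
  fixes u v :: "'e::euclidean_space \<Rightarrow> real"
  assumes "smooth_closure D u" "smooth_closure D v"
  shows "smooth_closure D (\<lambda>x. u x + v x)"
  by (rule smooth_closure_combine[OF assms]) (auto simp: smooth_closure_def intro!: smooth_on_add)

lemma smooth_closure_diff:
  fixes u v :: "'e::euclidean_space \<Rightarrow> real"
  assumes "smooth_closure D u" "smooth_closure D v"
  shows "smooth_closure D (\<lambda>x. u x - v x)"
  by (rule smooth_closure_combine[OF assms]) (auto simp: smooth_closure_def intro!: smooth_on_diff)

lemma smooth_closure_const [simp]: "smooth_closure D (\<lambda>x. c)"
  by (auto simp: smooth_closure_def)

lemma smooth_closure_sum:
  fixes u :: "'i \<Rightarrow> 'e::euclidean_space \<Rightarrow> real"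
  shows "(\<And>i. i \<in> A \<Longrightarrow> smooth_closure D (u i)) \<Longrightarrow> smooth_closure D (\<lambda>x. \<Sum>i\<in>A. u i x)"
  by (induction A rule: infinite_finite_induct) (auto intro: smooth_closure_add)

lemma smooth_closure_X_multi: "smooth_closure D u \<Longrightarrow> smooth_closure D (X_multi I u)"
  unfolding smooth_closure_def using smooth_on_X_multi by blast

lemma smooth_closure_continuous_on: "smooth_closure D u \<Longrightarrow> continuous_on (closure D) u"
  unfolding smooth_closure_def using smooth_on_imp_continuous_on continuous_on_subset by blast

lemma smooth_closure_smooth_on: "smooth_closure D u \<Longrightarrow> smooth_on D u"
  unfolding smooth_closure_def using smooth_on_subset closure_subset by blast

lemma finite_multi_indices [simp]: "finite {I :: ('n::finite + 'n) list. length I \<le> s}"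
  using finite_lists_length_le[of "UNIV :: ('n + 'n) set" s] by simp

text \<open>The density of \<open>dV\<^sub>0\<close> is the constant 1, but only its positivity is used.\<close>

abbreviation kappa :: "'n::finite itself \<Rightarrow> real" where
  "kappa t \<equiv> sqrt (dV0_coeff (0 :: 'n R2n1))"

lemma kappa_pos: "0 < kappa TYPE('n::finite)"
  using dV0_eq(1) by simp

lemma set_integral_dV0:
  fixes f :: "'n::finite R2n1 \<Rightarrow> real"
  assumes "set_borel_measurable lebesgue S f"
  shows "(LINT p:S|dV0. f p) = dV0_coeff (0 :: 'n R2n1) * (LINT p:S|lebesgue. f p)"
  using assms dV0_eq(1)[where 'n='n] unfolding set_lebesgue_integral_def set_borel_measurable_def dV0_eq(2)
  by (subst integral_density) auto

context
  fixes D :: "'n::finite R2n1 set"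
  assumes D: "open D" and cD: "compact (closure D)"
begin

lemma smooth_closure_l2_on:
  fixes u :: "'n R2n1 \<Rightarrow> real"
  assumes "smooth_closure D u" shows "l2_on D u"
  using D cD smooth_closure_continuous_on[OF assms]
  by (intro l2_on_continuous[of "closure D"]) (auto simp: closure_subset)

text \<open>Written as a Euclidean norm of a vector of L^2 norms, \<open>pre_norm\<close> inherits
  its triangle inequality from the two known ones, and it is comparable with each entry and with
  their sum.\<close>

lemma pre_norm_eq:
  fixes u :: "'n R2n1 \<Rightarrow> real"
  assumes "smooth_closure D u"
  shows "pre_norm s D u = kappa TYPE('n) * L2_set (\<lambda>I. l2 D (X_multi I u)) {I. length I \<le> s}"
proof -
  have "(LINT x:D|dV0. X_multi I u x \<bullet> X_multi I u x) = dV0_coeff (0 :: 'n R2n1) * (l2 D (X_multi I u))\<^sup>2" for I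
  proof -
    have "set_borel_measurable lebesgue D (\<lambda>x. X_multi I u x \<bullet> X_multi I u x)"
      using D cD smooth_closure_continuous_on[OF smooth_closure_X_multi[OF assms]]
      by (intro set_borel_measurable_continuous_lebesgue[of "closure D"] continuous_on_inner) (auto simp: closure_subset)
    then show ?thesis unfolding l2_square by (simp add: set_integral_dV0 power2_eq_square)
  qed
  then have "pre_inner s D u u = dV0_coeff (0 :: 'n R2n1) * (\<Sum>I | length I \<le> s. (l2 D (X_multi I u))\<^sup>2)"
    by (simp add: pre_inner_def sum_distrib_left)
  then show ?thesis by (simp add: pre_norm_def L2_set_def real_sqrt_mult)
qed

lemma pre_norm_nonneg:
  fixes u :: "'n R2n1 \<Rightarrow> real"
  shows "smooth_closure D u \<Longrightarrow> 0 \<le> pre_norm s D u"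
  using kappa_pos[where 'n='n] by (simp add: pre_norm_eq L2_set_nonneg less_imp_le)

lemma pre_norm_ge:
  fixes u :: "'n R2n1 \<Rightarrow> real"
  assumes "smooth_closure D u" "length I \<le> s"
  shows "kappa TYPE('n) * l2 D (X_multi I u) \<le> pre_norm s D u"
  unfolding pre_norm_eq[OF assms(1)] using assms(2) kappa_pos[where 'n='n]
  by (intro mult_left_mono member_le_L2_set) auto

lemma pre_norm_le_sum:
  fixes u :: "'n R2n1 \<Rightarrow> real"
  assumes "smooth_closure D u"
  shows "pre_norm s D u \<le> kappa TYPE('n) * (\<Sum>I | length I \<le> s. l2 D (X_multi I u))"
  unfolding pre_norm_eq[OF assms] using kappa_pos[where 'n='n]
  by (intro mult_left_mono L2_set_le_sum) auto

lemma pre_norm_mono: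
  fixes u :: "'n R2n1 \<Rightarrow> real"
  assumes "smooth_closure D u" "k \<le> s"
  shows "pre_norm k D u \<le> pre_norm s D u"
proof -
  have "(\<Sum>I | length I \<le> k. (l2 D (X_multi I u))\<^sup>2) \<le> (\<Sum>I | length I \<le> s. (l2 D (X_multi I u))\<^sup>2)"
    using assms(2) by (intro sum_mono2) auto
  then show ?thesis unfolding pre_norm_eq[OF assms(1)] L2_set_def using kappa_pos[where 'n='n]
    by (intro mult_left_mono real_sqrt_le_mono) auto
qed

text \<open>Appending \<open>A\<close> is injective on words, so the squares on the left are among
  those on the right.\<close>

lemma pre_norm_X_multi:
  fixes u :: "'n R2n1 \<Rightarrow> real"
  assumes "smooth_closure D u"
  shows "pre_norm k D (X_multi A u) \<le> pre_norm (k + length A) D u"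
proof -
  have "(\<Sum>I | length I \<le> k. (l2 D (X_multi I (X_multi A u)))\<^sup>2)
    = (\<Sum>J\<in>(\<lambda>I. I @ A) ` {I. length I \<le> k}. (l2 D (X_multi J u))\<^sup>2)"
    by (subst sum.reindex) (auto simp: inj_on_def X_multi_append)
  also have "\<dots> \<le> (\<Sum>J | length J \<le> k + length A. (l2 D (X_multi J u))\<^sup>2)"
    by (intro sum_mono2) auto
  finally show ?thesis
    unfolding pre_norm_eq[OF assms(1)] pre_norm_eq[OF smooth_closure_X_multi[OF assms(1)]] L2_set_def
    using kappa_pos[where 'n='n] by (intro mult_left_mono real_sqrt_le_mono) auto
qed

lemma pre_norm_add:
  fixes u v :: "'n R2n1 \<Rightarrow> real"
  assumes u: "smooth_closure D u" and v: "smooth_closure D v"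
  shows "pre_norm s D (\<lambda>x. u x + v x) \<le> pre_norm s D u + pre_norm s D v"
proof -
  obtain W where W: "open W" "closure D \<subseteq> W" "D \<subseteq> W" "smooth_on W u" "smooth_on W v"
    using smooth_closure_combine[OF u v] .
  have "l2 D (X_multi I (\<lambda>x. u x + v x)) \<le> l2 D (X_multi I u) + l2 D (X_multi I v)" for I
  proof -
    have "l2 D (X_multi I (\<lambda>x. u x + v x)) = l2 D (\<lambda>x. X_multi I u x + X_multi I v x)"
      unfolding l2_def using D W
      by (intro arg_cong[where f=sqrt] set_lebesgue_integral_cong) (auto simp: X_multi_add[OF W(1)])
    then show ?thesis
      using l2_add(2)[OF smooth_closure_l2_on[OF smooth_closure_X_multi[OF u]]
          smooth_closure_l2_on[OF smooth_closure_X_multi[OF v]]] by simp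
  qed
  then have "L2_set (\<lambda>I. l2 D (X_multi I (\<lambda>x. u x + v x))) {I. length I \<le> s}
     \<le> L2_set (\<lambda>I. l2 D (X_multi I u) + l2 D (X_multi I v)) {I. length I \<le> s}"
    by (intro L2_set_mono) auto
  also have "\<dots> \<le> L2_set (\<lambda>I. l2 D (X_multi I u)) {I. length I \<le> s} + L2_set (\<lambda>I. l2 D (X_multi I v)) {I. length I \<le> s}"
    by (rule L2_set_triangle_ineq)
  finally show ?thesis
    unfolding pre_norm_eq[OF u] pre_norm_eq[OF v] pre_norm_eq[OF smooth_closure_add[OF u v]] distrib_left[symmetric]
    using kappa_pos[where 'n='n] by (intro mult_left_mono) auto
qed

lemma pre_norm_cmult:
  fixes u :: "'n R2n1 \<Rightarrow> real"
  assumes u: "smooth_closure D u"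
  shows "pre_norm s D (\<lambda>x. c * u x) = \<bar>c\<bar> * pre_norm s D u"
proof -
  obtain W where W: "open W" "closure D \<subseteq> W" "D \<subseteq> W" "smooth_on W u"
    using smooth_closureE[OF u] .
  have "l2 D (X_multi I (\<lambda>x. c * u x)) = \<bar>c\<bar> * l2 D (X_multi I u)" for I
    unfolding l2_cmult[symmetric] unfolding l2_def using D W
    by (intro arg_cong[where f=sqrt] set_lebesgue_integral_cong) (auto simp: X_multi_cmult[OF W(1)])
  then show ?thesis
    using u by (simp add: pre_norm_eq smooth_closure_mult L2_set_right_distrib[symmetric])
qed

lemma pre_norm_diff_triangle:
  fixes u v :: "'n R2n1 \<Rightarrow> real"
  assumes u: "smooth_closure D u" and v: "smooth_closure D v"
  shows "pre_norm s D u \<le> pre_norm s D v + pre_norm s D (\<lambda>x. u x - v x)"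
  using pre_norm_add[OF v smooth_closure_diff[OF u v]] by simp

lemma pre_norm_minus_commute:
  fixes u v :: "'n R2n1 \<Rightarrow> real"
  assumes u: "smooth_closure D u" and v: "smooth_closure D v"
  shows "pre_norm s D (\<lambda>x. u x - v x) = pre_norm s D (\<lambda>x. v x - u x)"
  using pre_norm_cmult[OF smooth_closure_diff[OF u v], of s "-1"] by simp

lemma pre_norm_sum:
  fixes u :: "'i \<Rightarrow> 'n R2n1 \<Rightarrow> real"
  assumes "\<And>i. i \<in> A \<Longrightarrow> smooth_closure D (u i)"
  shows "pre_norm s D (\<lambda>x. \<Sum>i\<in>A. u i x) \<le> (\<Sum>i\<in>A. pre_norm s D (u i))"
  using assms
proof (induction A rule: infinite_finite_induct)
  case (insert a F)
  have "pre_norm s D (\<lambda>x. u a x + (\<Sum>i\<in>F. u i x)) \<le> pre_norm s D (u a) + pre_norm s D (\<lambda>x. \<Sum>i\<in>F. u i x)"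
    using insert by (intro pre_norm_add smooth_closure_sum) auto
  then show ?case using insert by force
qed (use pre_norm_cmult[of "\<lambda>_. 0" s 0] in auto)

end

section \<open>Product estimates in the interior\<close>

lemma norm_R2n1_le:
  fixes y :: "'n::finite R2n1"
  shows "norm (fst y) \<le> norm y" "norm (fst (snd y)) \<le> norm y" "\<bar>snd (snd y)\<bar> \<le> norm y"
proof -
  show 1: "norm (fst y) \<le> norm y" using norm_fst_le[of "fst y" "snd y"] by simp
  have 2: "norm (snd y) \<le> norm y" using norm_snd_le[of "snd y" "fst y"] by simp
  show "norm (fst (snd y)) \<le> norm y"
    using norm_fst_le[of "fst (snd y)" "snd (snd y)"] 2 by simp
  show "\<bar>snd (snd y)\<bar> \<le> norm y"
    using norm_snd_le[of "snd (snd y)" "fst (snd y)"] 2 by simp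
qed

text \<open>The bound is uniform in \<open>x\<close> and \<open>y\<close> in a ball, so that one
  final parameter \<open>R\<close> keeps the rays from all points of a compact set inside
  \<open>D\<close>.\<close>

lemma dist_ray_le:
  fixes x y :: "'n::finite R2n1"
  assumes "norm x \<le> B" "norm y \<le> B" "0 \<le> r" "r \<le> 1"
  shows "dist x (ray x y r) \<le> r * (3 * B + B\<^sup>2)"
proof -
  note nx = norm_R2n1_le[of x] and ny = norm_R2n1_le[of y]
  have B: "0 \<le> B" using assms(1) norm_ge_zero order_trans by blast
  have "ray x y r - x = (r *\<^sub>R fst y, r *\<^sub>R fst (snd y), r\<^sup>2 * snd (snd y) + r * (fst (snd x) \<bullet> fst y))"
    by (simp add: ray_def prod_eq_iff)
  then have "dist x (ray x y r) = norm (r *\<^sub>R fst y, r *\<^sub>R fst (snd y), r\<^sup>2 * snd (snd y) + r * (fst (snd x) \<bullet> fst y))"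
    by (metis dist_commute dist_norm)
  also have "\<dots> \<le> norm (r *\<^sub>R fst y) + (norm (r *\<^sub>R fst (snd y)) + norm (r\<^sup>2 * snd (snd y) + r * (fst (snd x) \<bullet> fst y)))"
    by (intro order_trans[OF norm_Pair_le] add_left_mono order_refl norm_Pair_le)
  also have "\<dots> \<le> r * B + (r * B + (r * B + r * B\<^sup>2))"
  proof (intro add_mono order_trans[OF norm_triangle_ineq])
    show "norm (r *\<^sub>R fst y) \<le> r * B" "norm (r *\<^sub>R fst (snd y)) \<le> r * B"
      using assms nx ny by (auto intro!: mult_left_mono)
    have "r * r * \<bar>snd (snd y)\<bar> \<le> r * 1 * B"
      using assms ny B by (intro mult_mono) auto
    then show "norm (r\<^sup>2 * snd (snd y)) \<le> r * B"
      using assms by (simp add: abs_mult power2_eq_square)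
    have "\<bar>fst (snd x) \<bullet> fst y\<bar> \<le> norm (fst (snd x)) * norm (fst y)" by (rule Cauchy_Schwarz_ineq2)
    also have "\<dots> \<le> B * B" using assms nx ny B by (intro mult_mono) auto
    finally show "norm (r * (fst (snd x) \<bullet> fst y)) \<le> r * B\<^sup>2"
      using assms by (simp add: abs_mult power2_eq_square mult_left_mono)
  qed
  finally show ?thesis by (simp add: algebra_simps)
qed

text \<open>By continuity \<open>\<Phi>\<close> exceeds half of \<open>\<Phi> a\<close> on a ball
  around \<open>a\<close>. The integral is the factor that multiplies \<open>w x\<close> in
  \<open>pointwise_bound\<close>, so it has to be nonzero.\<close>

lemma integral_pos_bump:
  fixes \<Phi> :: "'e::euclidean_space \<Rightarrow> real"
  assumes "continuous_on UNIV \<Phi>" "\<And>y. 0 \<le> \<Phi> y" "0 < \<Phi> a" "compact L" "\<And>y. y \<notin> L \<Longrightarrow> \<Phi> y = 0"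
  shows "0 < (LINT y|lborel. \<Phi> y)"
proof -
  have i: "integrable lborel \<Phi>"
    using assms(5) by (intro integrable_lborel_compact_support[OF assms(4) continuous_on_subset[OF assms(1)]]) auto
  obtain e where e: "0 < e" "\<And>y. dist y a < e \<Longrightarrow> dist (\<Phi> y) (\<Phi> a) < \<Phi> a / 2"
    using assms(1,3) unfolding continuous_on_iff by (metis UNIV_I half_gt_zero)
  have "0 < \<Phi> a / 2 * measure lborel (ball a e)"
    using assms(3) content_ball_pos[OF e(1), of a] by (simp add: measure_def)
  also have "\<dots> = (LINT y|lborel. \<Phi> a / 2 * indicator (ball a e) y)" by simp
  also have "\<dots> \<le> (LINT y|lborel. \<Phi> y)"
  proof (intro integral_mono i)
    show "integrable lborel (\<lambda>y. \<Phi> a / 2 * indicator (ball a e) y)"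
      using emeasure_bounded_finite[of "ball a e"] by (intro integrable_mult_right integrable_real_indicator) auto
    fix y show "\<Phi> a / 2 * indicator (ball a e) y \<le> \<Phi> y"
    proof (cases "y \<in> ball a e")
      case True
      then have "dist y a < e" by (simp add: dist_commute)
      from e(2)[OF this] have "\<bar>\<Phi> y - \<Phi> a\<bar> < \<Phi> a / 2" by (simp only: dist_real_def)
      then have "\<Phi> a / 2 \<le> \<Phi> y" by linarith
      then show ?thesis using True by simp
    qed (use assms(2) in simp)
  qed
  finally show ?thesis .
qed

text \<open>Sobolev embedding with \<open>n + 2\<close> derivatives, more than half the homogeneous
  dimension \<open>2n + 2\<close>. Away from the boundary no regularity of \<open>D\<close> is needed.\<close>

lemma interior_sobolev:
  fixes D L :: "'n::finite R2n1 set"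
  assumes D: "open D" and cD: "compact (closure D)" and L: "compact L" "L \<subseteq> D"
  obtains C where "0 \<le> C"
    "\<And>(w :: 'n R2n1 \<Rightarrow> real) x. smooth_closure D w \<Longrightarrow> x \<in> L \<Longrightarrow> \<bar>w x\<bar> \<le> C * pre_norm (CARD('n) + 2) D w"
proof -
  obtain \<Phi> :: "'n R2n1 \<Rightarrow> real" where P: "smooth_on UNIV \<Phi>" "\<And>y. 0 \<le> \<Phi> y" "\<And>y. y \<in> ball 0 1 \<Longrightarrow> 0 < \<Phi> y"
      "\<And>y. y \<notin> cball 0 1 \<Longrightarrow> \<Phi> y = 0"
    using ex_bump[of 1 "0 :: 'n R2n1"] by auto
  obtain u :: "'n R2n1" where u: "cball 0 1 \<subseteq> cbox (- u) u"
    using bounded_subset_cbox_symmetric[OF bounded_cball] by blast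
  have P0: "\<Phi> y = 0" if "y \<notin> cbox (- u) u" for y using P(4) u that by blast
  have I: "0 < (LINT y|lborel. \<Phi> y)"
    using P by (intro integral_pos_bump[of \<Phi> 0 "cball 0 1"] smooth_on_imp_continuous_on) auto
  have "bounded (L \<union> cbox (- u) u)" using L compact_imp_bounded by auto
  then obtain B where "0 < B" "\<forall>y\<in>L \<union> cbox (- u) u. norm y \<le> B"
    unfolding bounded_pos by metis
  then have B: "0 < B" "\<And>y. y \<in> L \<union> cbox (- u) u \<Longrightarrow> norm y \<le> B"
    by simp_all
  obtain e where e: "0 < e" "(\<Union>x\<in>L. ball x e) \<subseteq> D"
    using compact_subset_open_imp_ball_epsilon_subset[OF L(1) D L(2)] .
  define M where "M = 3 * B + B\<^sup>2"
  \<comment> \<open>\<open>M\<close> bounds the displacement of a ray per unit of \<open>r\<close>,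
    and \<open>e\<close> is the distance that points of \<open>L\<close> can move within
    \<open>D\<close>; the factor 2 makes \<open>R * M\<close> strictly smaller than
    \<open>e\<close>.\<close>
  define R where "R = min 1 (e / (2 * M))"
  have pos: "0 < M" using B by (simp add: M_def add_pos_pos)
  have R: "0 < R" "R \<le> 1" using e pos by (auto simp: R_def)
  have "R * M \<le> e / (2 * M) * M"
    using pos by (intro mult_right_mono) (auto simp: R_def)
  also have "\<dots> = e / 2" using pos by simp
  finally have Re: "R * M < e" using e by simp
  have ray_in: "ray x y r \<in> D" if "x \<in> L" "y \<in> cbox (- u) u" "0 \<le> r" "r \<le> R" for x y r
  proof -
    have "dist x (ray x y r) \<le> r * M"
      unfolding M_def using that B R by (intro dist_ray_le) auto
    also have "\<dots> \<le> R * M" using that pos by (intro mult_right_mono) auto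
    finally have "ray x y r \<in> ball x e" using Re by simp
    then show ?thesis using e(2) that(1) by blast
  qed
  \<comment> \<open>Any index will do: a single pair of frame fields already generates the missing
    direction.\<close>
  define k :: 'n where "k = undefined"
  define A where "A = (\<lambda>m. \<Sum>J | length J = m. sqrt (LINT y|lborel. (foldr (shift k) J \<Phi> y)\<^sup>2))"
  \<comment> \<open>The constant of \<open>pointwise_bound\<close>. It involves only
    \<open>\<Phi>\<close> and \<open>R\<close>, hence is the same for all \<open>w\<close> and all
    \<open>x\<close> in \<open>L\<close>.\<close>
  define C0 where "C0 = (\<Sum>m<CARD('n) + 2. A m * R ^ m / fact m / R ^ (CARD('n) + 1)) + R * A (CARD('n) + 2)"
  have "0 \<le> A m" for m unfolding A_def by (intro sum_nonneg) auto
  then have C0: "0 \<le> C0" unfolding C0_def using R by (intro add_nonneg_nonneg sum_nonneg) auto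
  show ?thesis
  proof (rule that[of "C0 / kappa TYPE('n) / (LINT y|lborel. \<Phi> y)"])
    show "0 \<le> C0 / kappa TYPE('n) / (LINT y|lborel. \<Phi> y)"
      using C0 I kappa_pos[where 'n='n] by simp
    fix w :: "'n R2n1 \<Rightarrow> real" and x assume w: "smooth_closure D w" and x: "x \<in> L"
    have "\<bar>w x * (LINT y|lborel. \<Phi> y)\<bar> \<le> C0 * (pre_norm (CARD('n) + 2) D w / kappa TYPE('n))"
      unfolding C0_def A_def
    proof (rule pointwise_bound[OF D R(1) ray_in[OF x] smooth_closure_smooth_on[OF w] _ P(1) P0])
      fix J :: "('n + 'n) list" assume J: "length J \<le> CARD('n) + 2"
      show "set_integrable lebesgue D (\<lambda>p. (X_multi J w p)\<^sup>2)"
        using smooth_closure_l2_on[OF D cD smooth_closure_X_multi[OF w]] by (simp add: l2_on_def)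
      show "sqrt (LINT p:D|lebesgue. (X_multi J w p)\<^sup>2) \<le> pre_norm (CARD('n) + 2) D w / kappa TYPE('n)"
        using pre_norm_ge[OF D cD w J] kappa_pos[where 'n='n]
        by (simp add: l2_def[symmetric] pos_le_divide_eq mult.commute)
    qed
    then have "\<bar>w x\<bar> \<le> C0 * (pre_norm (CARD('n) + 2) D w / kappa TYPE('n)) / (LINT y|lborel. \<Phi> y)"
      using I by (simp only: abs_mult abs_of_pos pos_le_divide_eq)
    then show "\<bar>w x\<bar> \<le> C0 / kappa TYPE('n) / (LINT y|lborel. \<Phi> y) * pre_norm (CARD('n) + 2) D w"
      by (simp add: mult_ac)
  qed
qed

section \<open>Leibniz rule and products\<close>

text \<open>The index set of the Leibniz rule for noncommuting fields: every letter goes to one of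
  the two factors, in the given order. A list instead of a set, because equal pairs count with
  multiplicity.\<close>

fun splits :: "'i list \<Rightarrow> ('i list \<times> 'i list) list" where
  "splits [] = [([], [])]"
| "splits (i # I) = map (\<lambda>(A, B). (i # A, B)) (splits I) @ map (\<lambda>(A, B). (A, i # B)) (splits I)"

lemma length_splits: "(A, B) \<in> set (splits I) \<Longrightarrow> length A + length B = length I"
  by (induction I arbitrary: A B) fastforce+

lemma X_field_sum_list:
  assumes "\<And>a. a \<in> set As \<Longrightarrow> f a differentiable (at x)"
  shows "X_field i (\<lambda>x. \<Sum>a\<leftarrow>As. f a x) x = (\<Sum>a\<leftarrow>As. X_field i (f a) x)
    \<and> (\<lambda>x. \<Sum>a\<leftarrow>As. f a x) differentiable (at x)"
  using assms by (induction As) (auto simp: X_field_add)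

lemma X_multi_mult:
  fixes u v :: "'n::finite R2n1 \<Rightarrow> real" and I :: "('n + 'n) list"
  assumes W: "open W" and u: "smooth_on W u" and v: "smooth_on W v" and x: "x \<in> W"
  shows "X_multi I (\<lambda>x. u x * v x) x = (\<Sum>(A, B)\<leftarrow>splits I. X_multi A u x * X_multi B v x)"
  using x
proof (induction I arbitrary: x)
  case (Cons i I)
  have d: "X_multi A u differentiable (at x)" "X_multi A v differentiable (at x)" for A :: "('n + 'n) list"
    using smooth_on_imp_differentiable smooth_on_X_multi[OF W] u v Cons.prems by blast+
  have "X_multi (i # I) (\<lambda>x. u x * v x) x
    = X_field i (\<lambda>x. \<Sum>p\<leftarrow>splits I. X_multi (fst p) u x * X_multi (snd p) v x) x"
    using Cons.IH Cons.prems by (auto simp: case_prod_beta intro!: X_field_cong[OF W])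
  also have "\<dots> = (\<Sum>p\<leftarrow>splits I. X_field i (\<lambda>x. X_multi (fst p) u x * X_multi (snd p) v x) x)"
    using d X_field_sum_list[of "splits I" "\<lambda>p x. X_multi (fst p) u x * X_multi (snd p) v x" x i]
    by (auto intro: differentiable_mult)
  also have "\<dots> = (\<Sum>p\<leftarrow>splits I. X_multi (i # fst p) u x * X_multi (snd p) v x + X_multi (fst p) u x * X_multi (i # snd p) v x)"
    by (simp add: X_field_mult d)
  also have "\<dots> = (\<Sum>(A, B)\<leftarrow>splits (i # I). X_multi A u x * X_multi B v x)"
    by (simp add: sum_list_addf comp_def case_prod_beta)
  finally show ?case .
qed simp

text \<open>One of \<open>A\<close> and \<open>B\<close> has length at most \<open>s div 2\<close>;
  the supremum of that factor takes \<open>n + 2\<close> further derivatives, which is the condition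
  on \<open>t\<close>, and the other factor is estimated in L^2. Either factor can be the short one,
  hence the two symmetric products. The norm on the left is over \<open>L\<close> because the
  supremum is controlled there only.\<close>

lemma X_multi_mult_bound:
  fixes D L :: "'n::finite R2n1 set"
  assumes D: "open D" and cD: "compact (closure D)" and L: "compact L" "L \<subseteq> D"
    and t: "s div 2 + CARD('n) + 2 \<le> t"
  obtains C where "0 \<le> C"
    "\<And>(u :: 'n R2n1 \<Rightarrow> real) v A B. smooth_closure D u \<Longrightarrow> smooth_closure D v \<Longrightarrow> length A + length B \<le> s \<Longrightarrow>
      l2 L (\<lambda>x. X_multi A u x * X_multi B v x) \<le> C * (pre_norm t D u * pre_norm s D v + pre_norm s D u * pre_norm t D v)"
proof -
  obtain C where C: "0 \<le> C"
    "\<And>(w :: 'n R2n1 \<Rightarrow> real) x. smooth_closure D w \<Longrightarrow> x \<in> L \<Longrightarrow> \<bar>w x\<bar> \<le> C * pre_norm (CARD('n) + 2) D w"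
    by (rule interior_sobolev[OF D cD L]) blast
  have Ls: "L \<in> sets lebesgue" using L by (simp add: borel_compact lborelD)
  have l2L: "l2_on L w" if "smooth_closure D w" for w :: "'n R2n1 \<Rightarrow> real"
    using continuous_on_subset[OF smooth_closure_continuous_on[OF that]] L closure_subset Ls
    by (intro l2_on_continuous[of L]) blast+
  have one: "l2 L (\<lambda>x. X_multi A u x * X_multi B v x) \<le> C / kappa TYPE('n) * (pre_norm t D u * pre_norm s D v)"
    if u: "smooth_closure D u" and v: "smooth_closure D v" and A: "length A \<le> s div 2" and B: "length B \<le> s"
    for u v :: "'n R2n1 \<Rightarrow> real" and A B :: "('n + 'n) list"
  proof -
    note uA = smooth_closure_X_multi[OF u, of A] and vB = smooth_closure_X_multi[OF v, of B]
    have "C * pre_norm (CARD('n) + 2) D (X_multi A u) \<le> C * pre_norm t D u"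
      using A t by (intro mult_left_mono C(1) order_trans[OF pre_norm_X_multi[OF D cD u] pre_norm_mono[OF D cD u]]) auto
    then have "\<bar>X_multi A u x\<bar> \<le> C * pre_norm t D u" if "x \<in> L" for x
      using C(2)[OF uA that] by linarith
    then have "l2 L (\<lambda>x. X_multi A u x * X_multi B v x) \<le> \<bar>C * pre_norm t D u\<bar> * l2 L (X_multi B v)"
      by (intro l2_mult_le l2L vB smooth_closure_mult uA)
    also have "\<dots> = C * pre_norm t D u * l2 L (X_multi B v)"
      using C(1) pre_norm_nonneg[OF D cD u] by simp
    also have "\<dots> \<le> C * pre_norm t D u * (pre_norm s D v / kappa TYPE('n))"
    proof (rule mult_left_mono)
      have "l2 L (X_multi B v) \<le> l2 D (X_multi B v)"
        by (rule l2_subset[OF smooth_closure_l2_on[OF D cD vB] Ls L(2)])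
      also have "\<dots> \<le> pre_norm s D v / kappa TYPE('n)"
        using pre_norm_ge[OF D cD v B] kappa_pos[where 'n='n] by (simp add: pos_le_divide_eq mult.commute)
      finally show "l2 L (X_multi B v) \<le> pre_norm s D v / kappa TYPE('n)" .
    qed (use C(1) pre_norm_nonneg[OF D cD u] in simp)
    finally show ?thesis by simp
  qed
  have nn: "0 \<le> C / kappa TYPE('n)" using C(1) kappa_pos[where 'n='n] by simp
  show ?thesis
  proof (rule that[OF nn])
    fix u v :: "'n R2n1 \<Rightarrow> real" and A B :: "('n + 'n) list"
    assume u: "smooth_closure D u" and v: "smooth_closure D v" and AB: "length A + length B \<le> s"
    have p: "0 \<le> pre_norm t D u * pre_norm s D v" "0 \<le> pre_norm s D u * pre_norm t D v"
      by (intro mult_nonneg_nonneg pre_norm_nonneg[OF D cD] u v)+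
    consider "length A \<le> s div 2" | "length B \<le> s div 2" using AB by linarith
    then show "l2 L (\<lambda>x. X_multi A u x * X_multi B v x)
      \<le> C / kappa TYPE('n) * (pre_norm t D u * pre_norm s D v + pre_norm s D u * pre_norm t D v)"
    proof cases
      case 1
      have "length B \<le> s" using AB by simp
      note one[OF u v 1 this]
      also have "C / kappa TYPE('n) * (pre_norm t D u * pre_norm s D v)
        \<le> C / kappa TYPE('n) * (pre_norm t D u * pre_norm s D v + pre_norm s D u * pre_norm t D v)"
        using p by (intro mult_left_mono nn) simp
      finally show ?thesis .
    next
      case 2
      have "length A \<le> s" using AB by simp
      from one[OF v u 2 this]
      have "l2 L (\<lambda>x. X_multi A u x * X_multi B v x) \<le> C / kappa TYPE('n) * (pre_norm s D u * pre_norm t D v)"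
        by (simp add: mult.commute)
      also have "C / kappa TYPE('n) * (pre_norm s D u * pre_norm t D v)
        \<le> C / kappa TYPE('n) * (pre_norm t D u * pre_norm s D v + pre_norm s D u * pre_norm t D v)"
        using p by (intro mult_left_mono nn) simp
      finally show ?thesis .
    qed
  qed
qed

lemma interior_product_estimate:
  fixes D L :: "'n::finite R2n1 set"
  assumes D: "open D" and cD: "compact (closure D)" and L: "compact L" "L \<subseteq> D"
    and t: "s div 2 + CARD('n) + 2 \<le> t"
  obtains C where "0 \<le> C"
    "\<And>(u :: 'n R2n1 \<Rightarrow> real) v I. smooth_closure D u \<Longrightarrow> smooth_closure D v \<Longrightarrow> length I \<le> s \<Longrightarrow>
      l2 L (X_multi I (\<lambda>x. u x * v x)) \<le> C * (pre_norm t D u * pre_norm s D v + pre_norm s D u * pre_norm t D v)"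
proof -
  obtain C where C: "0 \<le> C"
    "\<And>(u :: 'n R2n1 \<Rightarrow> real) v A B. smooth_closure D u \<Longrightarrow> smooth_closure D v \<Longrightarrow> length A + length B \<le> s \<Longrightarrow>
      l2 L (\<lambda>x. X_multi A u x * X_multi B v x) \<le> C * (pre_norm t D u * pre_norm s D v + pre_norm s D u * pre_norm t D v)"
    by (rule X_multi_mult_bound[OF D cD L t]) blast
  have Ls: "L \<in> sets lebesgue" using L by (simp add: borel_compact lborelD)
  have l2L: "l2_on L w" if "smooth_closure D w" for w :: "'n R2n1 \<Rightarrow> real"
    using continuous_on_subset[OF smooth_closure_continuous_on[OF that]] L closure_subset Ls
    by (intro l2_on_continuous[of L]) blast+
  have len: "length (splits I) = 2 ^ length I" for I :: "('n + 'n) list"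
    by (induction I) auto
  show ?thesis
  \<comment> \<open>The Leibniz rule for a word of length at most \<open>s\<close> has at most
    \<open>2 ^ s\<close> terms.\<close>
  proof (rule that[of "2 ^ s * C"])
    fix u v :: "'n R2n1 \<Rightarrow> real" and I :: "('n + 'n) list"
    assume u: "smooth_closure D u" and v: "smooth_closure D v" and I: "length I \<le> s"
    let ?E = "C * (pre_norm t D u * pre_norm s D v + pre_norm s D u * pre_norm t D v)"
    have E: "0 \<le> ?E"
      by (intro mult_nonneg_nonneg add_nonneg_nonneg C(1) pre_norm_nonneg[OF D cD] u v)
    let ?f = "\<lambda>i x. X_multi (fst (splits I ! i)) u x * X_multi (snd (splits I ! i)) v x"
    have "l2 L (X_multi I (\<lambda>x. u x * v x)) = l2 L (\<lambda>x. \<Sum>i<length (splits I). ?f i x)"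
      unfolding l2_def using L
      by (intro arg_cong[where f=sqrt] set_lebesgue_integral_cong Ls)
        (auto simp: X_multi_mult[OF D smooth_closure_smooth_on[OF u] smooth_closure_smooth_on[OF v]]
          sum_list_sum_nth atLeast0LessThan case_prod_beta)
    also have "\<dots> \<le> (\<Sum>i<length (splits I). l2 L (?f i))"
      by (rule conjunct2[OF l2_sum]) (intro l2L smooth_closure_mult smooth_closure_X_multi u v)
    also have "\<dots> \<le> (\<Sum>i<length (splits I). ?E)"
    proof (rule sum_mono)
      fix i assume "i \<in> {..<length (splits I)}"
      then have "splits I ! i \<in> set (splits I)" by simp
      then have "length (fst (splits I ! i)) + length (snd (splits I ! i)) = length I"
        using length_splits[of "fst (splits I ! i)" "snd (splits I ! i)" I] by simp
      then show "l2 L (?f i) \<le> ?E" using I by (intro C(2) u v) simp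
    qed
    also have "\<dots> = 2 ^ length I * ?E" by (simp add: len)
    also have "\<dots> \<le> 2 ^ s * ?E" using I E by (intro mult_right_mono power_increasing) auto
    finally show "l2 L (X_multi I (\<lambda>x. u x * v x))
      \<le> 2 ^ s * C * (pre_norm t D u * pre_norm s D v + pre_norm s D u * pre_norm t D v)"
      by (simp add: mult.assoc)
  qed (use C(1) in simp)
qed

section \<open>Closability of the frame derivatives\<close>

lemma set_integral_eq_lborel:
  fixes g :: "'e::euclidean_space \<Rightarrow> real"
  assumes "integrable lborel g" "\<And>x. x \<notin> D \<Longrightarrow> g x = 0"
  shows "(LINT x:D|lebesgue. g x) = (LINT x|lborel. g x)"
proof -
  have "(\<lambda>x. indicator D x *\<^sub>R g x) = g" using assms(2) by (intro ext) (auto simp: indicator_def)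
  then show ?thesis
    using assms(1) unfolding set_lebesgue_integral_def by (simp add: integral_completion)
qed

context
  fixes D :: "'n::finite R2n1 set"
  assumes D: "open D" and cD: "compact (closure D)"
begin

lemma bounded_on_closure:
  fixes v :: "'n R2n1 \<Rightarrow> real"
  assumes "smooth_closure D v"
  obtains M where "0 \<le> M" "\<And>x. x \<in> D \<Longrightarrow> \<bar>v x\<bar> \<le> M"
proof -
  have "bounded (v ` closure D)"
    using compact_continuous_image[OF smooth_closure_continuous_on[OF assms] cD] compact_imp_bounded by blast
  then obtain M where "\<forall>y\<in>v ` closure D. norm y \<le> M" unfolding bounded_iff by blast
  then have "\<bar>v x\<bar> \<le> max 0 M" if "x \<in> D" for x using that closure_subset[of D] by force
  then show ?thesis using that[of "max 0 M"] by simp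
qed

text \<open>For a compactly supported test function all derivatives move to it by parts, and
  \<open>w k\<close> tends to 0. A general \<open>a\<close> is split by a cutoff
  \<open>\<xi>\<close>: the part \<open>a (1 - \<xi>)\<close> is small in L^2, and \<open>B\<close>
  controls the other factor.\<close>

lemma weak_null:
  fixes a :: "'n R2n1 \<Rightarrow> real" and w :: "nat \<Rightarrow> 'n R2n1 \<Rightarrow> real"
  assumes a: "smooth_closure D a" and w: "\<And>k. smooth_closure D (w k)"
    and w0: "(\<lambda>k. l2 D (w k)) \<longlonglongrightarrow> 0" and B: "\<And>k. l2 D (X_multi I (w k)) \<le> B"
  shows "(\<lambda>k. LINT x:D|lebesgue. a x * X_multi I (w k) x) \<longlonglongrightarrow> 0"
proof (rule LIMSEQ_I)
  fix e :: real assume e: "0 < e"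
  note l2D = smooth_closure_l2_on[OF D cD]
  have wI: "l2_on D (X_multi I (w k))" for k by (intro l2D smooth_closure_X_multi w)
  have B0: "0 \<le> B" using B[of 0] l2_nonneg order_trans by blast
  obtain M where M: "0 \<le> M" "\<And>x. x \<in> D \<Longrightarrow> \<bar>a x\<bar> \<le> M"
    by (rule bounded_on_closure[OF a]) blast
  \<comment> \<open>Chosen so that \<open>M * d * B\<close> is below \<open>e / 2\<close>; the
    summand 1 guards against \<open>M * B = 0\<close>. The cutoff is requested with tolerance
    \<open>d\<^sup>2\<close>, since that one bounds a squared norm.\<close>
  define d where "d = e / (2 * (M * B + 1))"
  have MB: "0 \<le> M * B" using M B0 by simp
  have d: "0 < d" using e MB by (simp add: d_def add_nonneg_pos)
  have bD: "bounded D" using cD compact_imp_bounded bounded_subset closure_subset by blast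
  obtain \<xi> :: "'n R2n1 \<Rightarrow> real" and L where x: "smooth_on UNIV \<xi>" "\<And>x. 0 \<le> \<xi> x" "\<And>x. \<xi> x \<le> 1"
    "compact L" "L \<subseteq> D" "\<And>x. x \<notin> L \<Longrightarrow> \<xi> x = 0" "(LINT x:D|lebesgue. (1 - \<xi> x)\<^sup>2) \<le> d\<^sup>2"
    using smooth_cutoff[OF D bD, of "d\<^sup>2"] d by (metis zero_less_power)
  have sx: "smooth_closure D \<xi>" unfolding smooth_closure_def using x(1) by blast
  have s1x: "smooth_closure D (\<lambda>x. 1 - \<xi> x)" by (intro smooth_closure_diff sx smooth_closure_const)
  have l1: "l2 D (\<lambda>x. 1 - \<xi> x) \<le> d"
    using real_sqrt_le_mono[OF x(7)] d by (simp add: l2_def)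
  have la: "l2 D (\<lambda>x. a x * (1 - \<xi> x)) \<le> M * d"
  proof -
    have "l2 D (\<lambda>x. a x * (1 - \<xi> x)) \<le> \<bar>M\<bar> * l2 D (\<lambda>x. 1 - \<xi> x)"
      by (intro l2_mult_le l2D smooth_closure_mult a s1x M)
    also have "\<dots> \<le> M * d" using M l1 by (simp add: mult_left_mono)
    finally show ?thesis .
  qed
  let ?ax = "\<lambda>x. a x * \<xi> x"
  have aL: "?ax x = 0" if "x \<notin> L" for x using x(6)[OF that] by simp
  have sax: "smooth_on UNIV ?ax"
    by (rule smooth_on_mult_supported[OF D x(4,5) smooth_closure_smooth_on[OF a] x(1,6)])
  let ?c = "l2 D (X_multi (rev I) ?ax)"
  have second: "\<bar>LINT x:D|lebesgue. ?ax x * X_multi I (w k) x\<bar> \<le> ?c * l2 D (w k)" for k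
  proof -
    have sw: "smooth_on D (w k)" by (rule smooth_closure_smooth_on[OF w])
    have sr: "smooth_on UNIV (X_multi (rev I) ?ax)" by (rule smooth_on_X_multi[OF open_UNIV sax])
    have rL: "X_multi (rev I) ?ax x = 0" if "x \<notin> L" for x
      by (rule X_multi_supported[OF compact_imp_closed[OF x(4)] aL that])
    have i1: "integrable lborel (\<lambda>x. X_multi I (w k) x * ?ax x)"
      by (rule integrable_mult_supported[OF D x(4,5) smooth_on_X_multi[OF D sw] sax aL])
    have i2: "integrable lborel (\<lambda>x. w k x * X_multi (rev I) ?ax x)"
      by (rule integrable_mult_supported[OF D x(4,5) sw sr rL])
    have "(LINT x:D|lebesgue. ?ax x * X_multi I (w k) x) = (LINT x:D|lebesgue. X_multi I (w k) x * ?ax x)"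
      by (simp add: mult.commute)
    also have "\<dots> = (LINT x|lborel. X_multi I (w k) x * ?ax x)"
      by (rule set_integral_eq_lborel[OF i1]) (use aL x(5) in auto)
    also have "\<dots> = (-1) ^ length I * (LINT x|lborel. w k x * X_multi (rev I) ?ax x)"
      by (rule X_multi_by_parts[OF D x(4,5) sw sax aL])
    also have "(LINT x|lborel. w k x * X_multi (rev I) ?ax x) = (LINT x:D|lebesgue. w k x * X_multi (rev I) ?ax x)"
      by (rule set_integral_eq_lborel[OF i2, symmetric]) (use rL x(5) in auto)
    finally have "\<bar>LINT x:D|lebesgue. ?ax x * X_multi I (w k) x\<bar> = \<bar>LINT x:D|lebesgue. w k x * X_multi (rev I) ?ax x\<bar>"
      by (simp add: abs_mult power_abs)
    also have "\<dots> \<le> l2 D (w k) * ?c"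
      using sr by (intro l2_cauchy_schwarz(2) l2D w) (auto simp: smooth_closure_def)
    finally show ?thesis by (simp add: mult.commute)
  qed
  have first: "\<bar>LINT x:D|lebesgue. a x * (1 - \<xi> x) * X_multi I (w k) x\<bar> \<le> M * d * B" for k
  proof -
    have "\<bar>LINT x:D|lebesgue. a x * (1 - \<xi> x) * X_multi I (w k) x\<bar> \<le> l2 D (\<lambda>x. a x * (1 - \<xi> x)) * l2 D (X_multi I (w k))"
      by (intro l2_cauchy_schwarz(2) l2D smooth_closure_mult a s1x wI)
    also have "\<dots> \<le> M * d * B" using la B M d by (intro mult_mono) auto
    finally show ?thesis .
  qed
  have split: "(LINT x:D|lebesgue. a x * X_multi I (w k) x)
     = (LINT x:D|lebesgue. a x * (1 - \<xi> x) * X_multi I (w k) x) + (LINT x:D|lebesgue. ?ax x * X_multi I (w k) x)" for k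
  proof -
    have "(LINT x:D|lebesgue. a x * (1 - \<xi> x) * X_multi I (w k) x + ?ax x * X_multi I (w k) x)
     = (LINT x:D|lebesgue. a x * (1 - \<xi> x) * X_multi I (w k) x) + (LINT x:D|lebesgue. ?ax x * X_multi I (w k) x)"
      by (intro set_integral_add l2_cauchy_schwarz(1) l2D smooth_closure_mult a s1x sx wI)
    then show ?thesis by (simp add: algebra_simps)
  qed
  have Md: "M * d * B < e / 2"
  proof -
    have "M * d * B = e / 2 * (M * B / (M * B + 1))" using MB by (simp add: d_def field_simps)
    also have "\<dots> < e / 2 * 1" using e MB by (intro mult_strict_left_mono) (auto simp: divide_less_eq)
    finally show ?thesis by simp
  qed
  have "(\<lambda>k. ?c * l2 D (w k)) \<longlonglongrightarrow> ?c * 0" by (intro tendsto_mult_left w0)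
  then have "\<forall>\<^sub>F k in sequentially. ?c * l2 D (w k) < e / 2"
    using e by (intro order_tendstoD) auto
  then obtain N where N: "\<And>k. k \<ge> N \<Longrightarrow> ?c * l2 D (w k) < e / 2" unfolding eventually_sequentially by blast
  have "\<bar>LINT x:D|lebesgue. a x * X_multi I (w k) x\<bar> < e" if "N \<le> k" for k
    using first[of k] second[of k] N[OF that] Md unfolding split[of k] by linarith
  then show "\<exists>N. \<forall>k\<ge>N. norm ((LINT x:D|lebesgue. a x * X_multi I (w k) x) - 0) < e" by auto
qed

text \<open>The square of \<open>\<parallel>a\<^sub>k\<parallel>\<close> is \<open>\<langle>a\<^sub>k, a\<^sub>k - a\<^sub>l\<rangle> + \<langle>a\<^sub>k, a\<^sub>l\<rangle>\<close>, where \<open>a\<^sub>k = X\<^sub>I w\<^sub>k\<close>; no completeness of \<open>L\<^sup>2\<close> is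
  needed.\<close>

lemma closable:
  fixes w :: "nat \<Rightarrow> 'n R2n1 \<Rightarrow> real"
  assumes w: "\<And>k. smooth_closure D (w k)"
    and cauchy: "\<And>e. 0 < e \<Longrightarrow> \<exists>N. \<forall>k\<ge>N. \<forall>l\<ge>N. l2 D (\<lambda>x. X_multi I (w k) x - X_multi I (w l) x) < e"
    and w0: "(\<lambda>k. l2 D (w k)) \<longlonglongrightarrow> 0"
  shows "(\<lambda>k. l2 D (X_multi I (w k))) \<longlonglongrightarrow> 0"
proof -
  note l2D = smooth_closure_l2_on[OF D cD]
  let ?a = "\<lambda>k. X_multi I (w k)"
  have sa: "smooth_closure D (?a k)" for k by (intro smooth_closure_X_multi w)
  obtain N0 where N0: "\<And>k l. k \<ge> N0 \<Longrightarrow> l \<ge> N0 \<Longrightarrow> l2 D (\<lambda>x. ?a k x - ?a l x) < 1"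
    using cauchy[of 1] by auto
  define B where "B = l2 D (?a N0) + 1"
  have B1: "1 \<le> B" by (simp add: B_def)
  have B: "l2 D (?a k) \<le> B" if "k \<ge> N0" for k
    using l2_add(2)[OF l2D[OF sa[of N0]] l2D[OF smooth_closure_diff[OF sa[of k] sa[of N0]]]] N0[OF that order_refl]
    by (simp add: B_def)
  have "(\<lambda>k. (l2 D (?a k))\<^sup>2) \<longlonglongrightarrow> 0"
  proof (rule LIMSEQ_I)
    fix e :: real assume e: "0 < e"
    obtain N where N: "\<And>k l. k \<ge> N \<Longrightarrow> l \<ge> N \<Longrightarrow> l2 D (\<lambda>x. ?a k x - ?a l x) < e / (2 * B)"
      using cauchy[of "e / (2 * B)"] e B1 by auto
    have "(l2 D (?a k))\<^sup>2 < e" if k: "k \<ge> max N0 N" for k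
    proof -
      \<comment> \<open>The sequence is shifted by \<open>N0\<close> because the bound
        \<open>B\<close> holds from that index on, while \<open>weak_null\<close> asks for it at
        every index.\<close>
      have "(\<lambda>l. LINT x:D|lebesgue. ?a k x * X_multi I (w (l + N0)) x) \<longlonglongrightarrow> 0"
        using B by (intro weak_null[where B=B] sa w LIMSEQ_ignore_initial_segment[OF w0]) simp
      then have "\<forall>\<^sub>F l in sequentially. \<bar>LINT x:D|lebesgue. ?a k x * X_multi I (w (l + N0)) x\<bar> < e / 2"
        using e by (intro order_tendstoD(2)[OF tendsto_rabs_zero]) auto
      then obtain l0 where l0: "\<And>l. l \<ge> l0 \<Longrightarrow> \<bar>LINT x:D|lebesgue. ?a k x * X_multi I (w (l + N0)) x\<bar> < e / 2"
        unfolding eventually_sequentially by blast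
      define l where "l = l0 + N + N0"
      have l: "N \<le> l" "N0 \<le> l" by (auto simp: l_def)
      have cl: "\<bar>LINT x:D|lebesgue. ?a k x * ?a l x\<bar> < e / 2"
        using l0[of "l0 + N"] by (simp add: l_def)
      have "(l2 D (?a k))\<^sup>2 = (LINT x:D|lebesgue. ?a k x * (?a k x - ?a l x) + ?a k x * ?a l x)"
        unfolding l2_square by (simp add: power2_eq_square algebra_simps)
      also have "\<dots> = (LINT x:D|lebesgue. ?a k x * (?a k x - ?a l x)) + (LINT x:D|lebesgue. ?a k x * ?a l x)"
        by (intro set_integral_add l2_cauchy_schwarz(1) l2D smooth_closure_diff sa)
      also have "\<dots> < e / 2 + e / 2"
      proof (rule add_le_less_mono)
        have "(LINT x:D|lebesgue. ?a k x * (?a k x - ?a l x)) \<le> l2 D (?a k) * l2 D (\<lambda>x. ?a k x - ?a l x)"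
          by (rule order_trans[OF abs_ge_self]) (intro l2_cauchy_schwarz(2) l2D smooth_closure_diff sa)
        also have "\<dots> \<le> B * (e / (2 * B))"
          using B[of k] N[of k l] k l B1 by (intro mult_mono) auto
        finally show "(LINT x:D|lebesgue. ?a k x * (?a k x - ?a l x)) \<le> e / 2" using B1 by simp
      qed (use cl in linarith)
      finally show ?thesis by simp
    qed
    then show "\<exists>no. \<forall>k\<ge>no. norm ((l2 D (?a k))\<^sup>2 - 0) < e" by (intro exI[of _ "max N0 N"]) simp
  qed
  then have "(\<lambda>k. sqrt ((l2 D (?a k))\<^sup>2)) \<longlonglongrightarrow> sqrt 0" by (rule tendsto_real_sqrt)
  then show ?thesis by simp
qed

end

section \<open>Representing sequences and the norm of the completion\<close>

lemma borel_measurable_square_diff: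
  fixes f g :: "'a \<Rightarrow> real"
  assumes "set_borel_measurable M S f" "set_borel_measurable M S g"
  shows "(\<lambda>x. ennreal ((f x - g x)\<^sup>2) * indicator S x) \<in> borel_measurable M"
proof -
  have [measurable]: "(\<lambda>x. indicator S x *\<^sub>R f x) \<in> borel_measurable M" "(\<lambda>x. indicator S x *\<^sub>R g x) \<in> borel_measurable M"
    using assms by (simp_all add: set_borel_measurable_def)
  have "(\<lambda>x. ennreal ((indicator S x *\<^sub>R f x - indicator S x *\<^sub>R g x)\<^sup>2)) \<in> borel_measurable M"
    by measurable
  moreover have "(\<lambda>x. ennreal ((indicator S x *\<^sub>R f x - indicator S x *\<^sub>R g x)\<^sup>2)) = (\<lambda>x. ennreal ((f x - g x)\<^sup>2) * indicator S x)"
    by (intro ext) (simp add: indicator_def)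
  ultimately show ?thesis by (simp only:)
qed

lemma nn_integral_square_triangle:
  fixes f g h :: "'a \<Rightarrow> real"
  assumes "set_borel_measurable M S f" "set_borel_measurable M S g" "set_borel_measurable M S h"
  shows "(\<integral>\<^sup>+x\<in>S. ennreal ((f x - h x)\<^sup>2) \<partial>M)
    \<le> 2 * (\<integral>\<^sup>+x\<in>S. ennreal ((f x - g x)\<^sup>2) \<partial>M) + 2 * (\<integral>\<^sup>+x\<in>S. ennreal ((h x - g x)\<^sup>2) \<partial>M)"
proof -
  have *: "ennreal ((a - c)\<^sup>2) \<le> 2 * ennreal ((a - b)\<^sup>2) + 2 * ennreal ((c - b)\<^sup>2)" for a b c :: real
  proof -
    have "(a - c)\<^sup>2 \<le> 2 * (a - b)\<^sup>2 + 2 * (c - b)\<^sup>2"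
      using zero_le_power2[of "a + c - 2 * b"] by (simp add: power2_eq_square algebra_simps)
    then have "ennreal ((a - c)\<^sup>2) \<le> ennreal (2 * (a - b)\<^sup>2 + 2 * (c - b)\<^sup>2)" by (rule ennreal_leI)
    then show ?thesis by (simp add: ennreal_plus ennreal_mult)
  qed
  have "(\<integral>\<^sup>+x\<in>S. ennreal ((f x - h x)\<^sup>2) \<partial>M)
    \<le> (\<integral>\<^sup>+x. 2 * (ennreal ((f x - g x)\<^sup>2) * indicator S x) + 2 * (ennreal ((h x - g x)\<^sup>2) * indicator S x) \<partial>M)"
    using * by (intro nn_integral_mono) (auto simp: indicator_def)
  also have "\<dots> = 2 * (\<integral>\<^sup>+x\<in>S. ennreal ((f x - g x)\<^sup>2) \<partial>M) + 2 * (\<integral>\<^sup>+x\<in>S. ennreal ((h x - g x)\<^sup>2) \<partial>M)"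
    using borel_measurable_square_diff[OF assms(1,2)] borel_measurable_square_diff[OF assms(3,2)]
    by (simp add: nn_integral_add nn_integral_cmult)
  finally show ?thesis .
qed

lemma ennreal_null_comparison:
  fixes f g :: "nat \<Rightarrow> ennreal"
  assumes "\<And>k. f k \<le> g k" "g \<longlonglongrightarrow> 0"
  shows "f \<longlonglongrightarrow> 0"
  by (rule tendsto_sandwich[OF _ _ tendsto_const assms(2)]) (use assms(1) in auto)

lemma sets_dV0 [simp]: "sets (dV0 :: 'n::finite R2n1 measure) = sets lebesgue"
  by (simp add: dV0_def)

lemma set_borel_measurable_dV0:
  fixes f :: "'n::finite R2n1 \<Rightarrow> real"
  shows "set_borel_measurable dV0 S f \<longleftrightarrow> set_borel_measurable lebesgue S f"
  unfolding set_borel_measurable_def by (simp add: dV0_def)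

context
  fixes D :: "'n::finite R2n1 set"
  assumes D: "open D" and cD: "compact (closure D)"
begin

lemma set_borel_measurable_smooth_closure:
  fixes u :: "'n R2n1 \<Rightarrow> real"
  assumes "smooth_closure D u" shows "set_borel_measurable dV0 D u"
  using smooth_closure_l2_on[OF D cD assms] by (simp add: l2_on_def set_borel_measurable_dV0)

lemma pre_norm_0:
  fixes u :: "'n R2n1 \<Rightarrow> real"
  assumes "smooth_closure D u"
  shows "pre_norm 0 D u = kappa TYPE('n) * l2 D u"
  by (simp add: pre_norm_eq[OF D cD assms])

lemma nn_integral_square_eq:
  fixes u :: "'n R2n1 \<Rightarrow> real"
  assumes u: "smooth_closure D u"
  shows "(\<integral>\<^sup>+x\<in>D. ennreal ((u x)\<^sup>2) \<partial>dV0) = ennreal ((pre_norm 0 D u)\<^sup>2)"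
proof -
  note l2 = smooth_closure_l2_on[OF D cD u]
  have m: "set_borel_measurable lebesgue D u" and i: "set_integrable lebesgue D (\<lambda>x. (u x)\<^sup>2)"
    using l2 by (auto simp: l2_on_def)
  have z: "set_borel_measurable lebesgue D (\<lambda>x. 0 :: real)" by (simp add: set_borel_measurable_def)
  have "(\<integral>\<^sup>+x\<in>D. ennreal ((u x)\<^sup>2) \<partial>dV0) = ennreal (dV0_coeff (0 :: 'n R2n1)) * (\<integral>\<^sup>+x\<in>D. ennreal ((u x)\<^sup>2) \<partial>lebesgue)"
    using borel_measurable_square_diff[OF m z] unfolding dV0_eq(2)
    by (subst nn_integral_density) (auto simp: nn_integral_cmult)
  also have "(\<integral>\<^sup>+x\<in>D. ennreal ((u x)\<^sup>2) \<partial>lebesgue) = (\<integral>\<^sup>+x. ennreal (indicator D x *\<^sub>R (u x)\<^sup>2) \<partial>lebesgue)"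
    by (intro nn_integral_cong) (simp add: indicator_def)
  also have "\<dots> = ennreal ((l2 D u)\<^sup>2)"
    using i unfolding l2_square set_lebesgue_integral_def set_integrable_def
    by (intro nn_integral_eq_integral) auto
  also have "ennreal (dV0_coeff (0 :: 'n R2n1)) * ennreal ((l2 D u)\<^sup>2) = ennreal ((pre_norm 0 D u)\<^sup>2)"
    using dV0_eq(1)[where 'n='n] by (simp add: pre_norm_0[OF u] power_mult_distrib ennreal_mult)
  finally show ?thesis .
qed

lemma fs_representsD:
  fixes f :: "'n R2n1 \<Rightarrow> real"
  assumes "fs_represents s D f u"
  shows "smooth_closure D (u k)" "set_borel_measurable dV0 D f"
    and "0 < e \<Longrightarrow> \<exists>N. \<forall>k\<ge>N. \<forall>l\<ge>N. pre_norm s D (\<lambda>x. u k x - u l x) < e"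
    and "(\<lambda>k. \<integral>\<^sup>+x\<in>D. ennreal ((u k x - f x)\<^sup>2) \<partial>dV0) \<longlonglongrightarrow> 0"
  using assms by (auto simp: fs_represents_def)

lemma fs_represents_mono:
  fixes f :: "'n R2n1 \<Rightarrow> real"
  assumes "fs_represents s D f u" "t \<le> s"
  shows "fs_represents t D f u"
proof -
  note u = fs_representsD[OF assms(1)]
  have "\<exists>N. \<forall>k\<ge>N. \<forall>l\<ge>N. pre_norm t D (\<lambda>x. u k x - u l x) < e" if "0 < e" for e
    using u(3)[OF that] pre_norm_mono[OF D cD smooth_closure_diff[OF u(1) u(1)] assms(2)] order_le_less_trans by meson
  then show ?thesis using assms(1) unfolding fs_represents_def by blast
qed

lemma l2_X_multi_diff:
  fixes u v :: "'n R2n1 \<Rightarrow> real"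
  assumes "smooth_closure D u" "smooth_closure D v"
  shows "l2 D (\<lambda>x. X_multi I u x - X_multi I v x) = l2 D (X_multi I (\<lambda>x. u x - v x))"
proof -
  obtain W where W: "open W" "D \<subseteq> W" "smooth_on W u" "smooth_on W v"
    by (rule smooth_closure_combine[OF assms]) blast
  then show ?thesis
    unfolding l2_def using D
    by (intro arg_cong[where f=sqrt] set_lebesgue_integral_cong) (auto simp: X_multi_diff[OF W(1)])
qed

text \<open>The differences tend to 0 in L^2, both sequences having the limit \<open>f\<close>, and
  their frame derivatives are Cauchy; closability makes these tend to 0 too. This is what makes the
  norm depend on \<open>f\<close> alone.\<close>

lemma fs_represents_same:
  fixes f :: "'n R2n1 \<Rightarrow> real"
  assumes u: "fs_represents s D f u" and v: "fs_represents s D f v"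
  shows "(\<lambda>k. pre_norm s D (\<lambda>x. u k x - v k x)) \<longlonglongrightarrow> 0"
proof -
  note u = fs_representsD[OF u] and v = fs_representsD[OF v]
  let ?w = "\<lambda>k x. u k x - v k x"
  have w: "smooth_closure D (?w k)" for k by (intro smooth_closure_diff u v)
  have k0: "0 < kappa TYPE('n)" by (rule kappa_pos)
  have le: "ennreal ((pre_norm 0 D (?w k))\<^sup>2) \<le> 2 * (\<integral>\<^sup>+x\<in>D. ennreal ((u k x - f x)\<^sup>2) \<partial>dV0)
      + 2 * (\<integral>\<^sup>+x\<in>D. ennreal ((v k x - f x)\<^sup>2) \<partial>dV0)" for k
    unfolding nn_integral_square_eq[OF w, symmetric]
    by (intro nn_integral_square_triangle set_borel_measurable_smooth_closure u v)
  have "(\<lambda>k. 2 * (\<integral>\<^sup>+x\<in>D. ennreal ((u k x - f x)\<^sup>2) \<partial>dV0)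
      + 2 * (\<integral>\<^sup>+x\<in>D. ennreal ((v k x - f x)\<^sup>2) \<partial>dV0)) \<longlonglongrightarrow> 2 * 0 + 2 * 0"
    by (intro tendsto_add ennreal_tendsto_cmult u(4) v(4)) auto
  then have "(\<lambda>k. ennreal ((pre_norm 0 D (?w k))\<^sup>2)) \<longlonglongrightarrow> 0"
    using ennreal_null_comparison[OF le] by simp
  then have "(\<lambda>k. (pre_norm 0 D (?w k))\<^sup>2) \<longlonglongrightarrow> 0"
    by (subst (asm) ennreal_0[symmetric], subst (asm) tendsto_ennreal_iff) auto
  then have "(\<lambda>k. sqrt ((pre_norm 0 D (?w k))\<^sup>2)) \<longlonglongrightarrow> sqrt 0" by (rule tendsto_real_sqrt)
  then have "(\<lambda>k. kappa TYPE('n) * l2 D (?w k)) \<longlonglongrightarrow> 0"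
    using k0 by (simp add: pre_norm_0[OF w])
  then have w0: "(\<lambda>k. l2 D (?w k)) \<longlonglongrightarrow> 0"
    using k0 tendsto_mult_left[of "\<lambda>k. kappa TYPE('n) * l2 D (?w k)" 0 sequentially "1 / kappa TYPE('n)"] by simp
  have cauchy: "\<exists>N. \<forall>k\<ge>N. \<forall>l\<ge>N. l2 D (\<lambda>x. X_multi I (?w k) x - X_multi I (?w l) x) < e"
    if I: "length I \<le> s" and e: "0 < e" for I e
  proof -
    let ?e = "e * kappa TYPE('n) / 2"
    have e': "0 < ?e" using e k0 by simp
    obtain N1 where N1: "\<And>k l. k \<ge> N1 \<Longrightarrow> l \<ge> N1 \<Longrightarrow> pre_norm s D (\<lambda>x. u k x - u l x) < ?e" using u(3)[OF e'] by blast
    obtain N2 where N2: "\<And>k l. k \<ge> N2 \<Longrightarrow> l \<ge> N2 \<Longrightarrow> pre_norm s D (\<lambda>x. v k x - v l x) < ?e" using v(3)[OF e'] by blast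
    have "l2 D (\<lambda>x. X_multi I (?w k) x - X_multi I (?w l) x) < e" if "k \<ge> max N1 N2" "l \<ge> max N1 N2" for k l
    proof -
      have "kappa TYPE('n) * l2 D (\<lambda>x. X_multi I (?w k) x - X_multi I (?w l) x)
          \<le> pre_norm s D (\<lambda>x. ?w k x - ?w l x)"
        unfolding l2_X_multi_diff[OF w w] by (rule pre_norm_ge[OF D cD smooth_closure_diff[OF w w] I])
      also have "(\<lambda>x. ?w k x - ?w l x) = (\<lambda>x. (u k x - u l x) + (v l x - v k x))" by auto
      also have "pre_norm s D (\<lambda>x. (u k x - u l x) + (v l x - v k x)) \<le> pre_norm s D (\<lambda>x. u k x - u l x) + pre_norm s D (\<lambda>x. v l x - v k x)"
        by (intro pre_norm_add[OF D cD] smooth_closure_diff u v)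
      also have "\<dots> < ?e + ?e" using that by (intro add_strict_mono N1 N2) auto
      also have "\<dots> = kappa TYPE('n) * e" by simp
      finally show ?thesis using k0 by (simp only: mult_less_cancel_left_pos)
    qed
    then show ?thesis by blast
  qed
  have "(\<lambda>k. kappa TYPE('n) * (\<Sum>I | length I \<le> s. l2 D (X_multi I (?w k)))) \<longlonglongrightarrow> kappa TYPE('n) * (\<Sum>I\<in>{I :: ('n + 'n) list. length I \<le> s}. 0)"
    using closable[OF D cD w cauchy w0] by (intro tendsto_mult_left tendsto_sum) auto
  then have lim: "(\<lambda>k. kappa TYPE('n) * (\<Sum>I | length I \<le> s. l2 D (X_multi I (?w k)))) \<longlonglongrightarrow> 0" by simp
  show ?thesis
    by (rule Lim_null_comparison[OF always_eventually[OF allI] lim])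
      (simp add: pre_norm_nonneg[OF D cD w] pre_norm_le_sum[OF D cD w])
qed

lemma pre_norm_square:
  fixes u :: "'n R2n1 \<Rightarrow> real"
  assumes "smooth_closure D u"
  shows "(pre_norm s D u)\<^sup>2 = dV0_coeff (0 :: 'n R2n1) * (\<Sum>I | length I \<le> s. (l2 D (X_multi I u))\<^sup>2)"
  using dV0_eq(1)[where 'n='n]
  by (simp add: pre_norm_eq[OF D cD assms] L2_set_def power_mult_distrib sum_nonneg)

text \<open>Polarisation: convergence of inner products reduces to that of norms.\<close>

lemma pre_inner_eq:
  fixes u v :: "'n R2n1 \<Rightarrow> real"
  assumes u: "smooth_closure D u" and v: "smooth_closure D v"
  shows "pre_inner s D u v = ((pre_norm s D u)\<^sup>2 + (pre_norm s D v)\<^sup>2 - (pre_norm s D (\<lambda>x. u x - v x))\<^sup>2) / 2"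
proof -
  note l2D = smooth_closure_l2_on[OF D cD]
  have 1: "(LINT x:D|lebesgue. X_multi I u x * X_multi I v x)
     = ((l2 D (X_multi I u))\<^sup>2 + (l2 D (X_multi I v))\<^sup>2 - (l2 D (X_multi I (\<lambda>x. u x - v x)))\<^sup>2) / 2" for I
  proof -
    have X: "l2_on D (X_multi I u)" "l2_on D (X_multi I v)" by (intro l2D smooth_closure_X_multi u v)+
    have "(l2 D (X_multi I (\<lambda>x. u x - v x)))\<^sup>2
        = (LINT x:D|lebesgue. (X_multi I u x)\<^sup>2 + ((X_multi I v x)\<^sup>2 - 2 * (X_multi I u x * X_multi I v x)))"
      unfolding l2_X_multi_diff[OF u v, symmetric] l2_square by (simp add: power2_diff algebra_simps)
    also have "\<dots> = (l2 D (X_multi I u))\<^sup>2 + ((l2 D (X_multi I v))\<^sup>2 - 2 * (LINT x:D|lebesgue. X_multi I u x * X_multi I v x))"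
      using X l2_cauchy_schwarz(1)[OF X] unfolding l2_square l2_on_def
      by (subst set_integral_add set_integral_diff; (subst set_integral_diff)?) auto
    finally show ?thesis by simp
  qed
  have "set_borel_measurable lebesgue D (\<lambda>x. X_multi I u x \<bullet> X_multi I v x)" for I
    using l2D[OF smooth_closure_mult[OF smooth_closure_X_multi[OF u] smooth_closure_X_multi[OF v]]]
    by (simp add: l2_on_def)
  then have "pre_inner s D u v = dV0_coeff (0 :: 'n R2n1) * (\<Sum>I | length I \<le> s. LINT x:D|lebesgue. X_multi I u x * X_multi I v x)"
    unfolding pre_inner_def by (simp add: set_integral_dV0 sum_distrib_left)
  then show ?thesis
    unfolding pre_norm_square[OF u] pre_norm_square[OF v] pre_norm_square[OF smooth_closure_diff[OF u v]] 1
    by (simp add: sum_divide_distrib[symmetric] sum.distrib sum_subtractf algebra_simps diff_divide_distrib add_divide_distrib)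
qed

text \<open>The bridge between the definite description in \<open>inner_dom\<close> and estimates on
  smooth functions. The norms converge by the reverse triangle inequality, and every other
  representing sequence has the same limit by \<open>fs_represents_same\<close>.\<close>

lemma pre_norm_limit:
  fixes f :: "'n R2n1 \<Rightarrow> real"
  assumes u: "fs_represents s D f u"
  shows "(\<lambda>k. pre_norm s D (u k)) \<longlonglongrightarrow> sqrt (inner_dom s D f f)"
proof -
  note us = fs_representsD[OF u]
  have "Cauchy (\<lambda>k. pre_norm s D (u k))"
  proof (rule metric_CauchyI)
    fix e :: real assume "0 < e"
    then obtain N where N: "\<And>k l. k \<ge> N \<Longrightarrow> l \<ge> N \<Longrightarrow> pre_norm s D (\<lambda>x. u k x - u l x) < e" using us(3) by blast
    have "dist (pre_norm s D (u k)) (pre_norm s D (u l)) < e" if "k \<ge> N" "l \<ge> N" for k l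
      using pre_norm_diff_triangle[OF D cD us(1)[of k] us(1)[of l], of s]
        pre_norm_diff_triangle[OF D cD us(1)[of l] us(1)[of k], of s] N[OF that] N[OF that(2,1)]
      by (simp add: dist_real_def abs_less_iff)
    then show "\<exists>M. \<forall>m\<ge>M. \<forall>n\<ge>M. dist (pre_norm s D (u m)) (pre_norm s D (u n)) < e" by blast
  qed
  then obtain r where r: "(\<lambda>k. pre_norm s D (u k)) \<longlonglongrightarrow> r"
    using Cauchy_convergent_iff convergent_def by blast
  have r0: "0 \<le> r" using pre_norm_nonneg[OF D cD us(1)] by (intro LIMSEQ_le_const[OF r]) auto
  have lim: "(\<lambda>k. pre_norm s D (v k)) \<longlonglongrightarrow> r" if v: "fs_represents s D f v" for v
  proof -
    note vs = fs_representsD[OF v]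
    have "(\<lambda>k. pre_norm s D (v k) - pre_norm s D (u k)) \<longlonglongrightarrow> 0"
    proof (rule Lim_null_comparison[OF _ fs_represents_same[OF u v]])
      have "norm (pre_norm s D (v k) - pre_norm s D (u k)) \<le> pre_norm s D (\<lambda>x. u k x - v k x)" for k
        using pre_norm_diff_triangle[OF D cD us(1)[of k] vs(1)[of k], of s]
          pre_norm_diff_triangle[OF D cD vs(1)[of k] us(1)[of k], of s]
          pre_norm_minus_commute[OF D cD us(1)[of k] vs(1)[of k], of s]
        unfolding real_norm_def by linarith
      then show "\<forall>\<^sub>F k in sequentially. norm (pre_norm s D (v k) - pre_norm s D (u k)) \<le> pre_norm s D (\<lambda>x. u k x - v k x)"
        by simp
    qed
    from tendsto_add[OF this r] show ?thesis by simp
  qed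
  \<comment> \<open>The description quantifies over two sequences independently. Both represent
    \<open>f\<close>, so the difference term of the polarisation formula tends to 0 and
    \<open>(r\<^sup>2 + r\<^sup>2) / 2\<close> remains.\<close>
  have inner: "(\<lambda>k. pre_inner s D (v k) (w k)) \<longlonglongrightarrow> r\<^sup>2" if v: "fs_represents s D f v" and w: "fs_represents s D f w" for v w
  proof -
    have "(\<lambda>k. ((pre_norm s D (v k))\<^sup>2 + (pre_norm s D (w k))\<^sup>2 - (pre_norm s D (\<lambda>x. v k x - w k x))\<^sup>2) / 2)
      \<longlonglongrightarrow> (r\<^sup>2 + r\<^sup>2 - 0\<^sup>2) / 2"
      by (intro tendsto_intros lim v w fs_represents_same[OF v w]) auto
    then show ?thesis by (simp add: pre_inner_eq fs_representsD[OF v] fs_representsD[OF w])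
  qed
  have "inner_dom s D f f = r\<^sup>2"
    unfolding inner_dom_def
  proof (rule the_equality)
    fix r' assume "\<forall>u v. fs_represents s D f u \<longrightarrow> fs_represents s D f v \<longrightarrow> (\<lambda>k. pre_inner s D (u k) (v k)) \<longlonglongrightarrow> r'"
    then show "r' = r\<^sup>2" using LIMSEQ_unique[OF _ inner[OF u u]] u by blast
  qed (use inner in blast)
  then show ?thesis using r r0 by simp
qed

lemma inner_dom_nonneg:
  fixes f :: "'n R2n1 \<Rightarrow> real"
  assumes u: "fs_represents s D f u"
  shows "0 \<le> sqrt (inner_dom s D f f)"
  using pre_norm_nonneg[OF D cD fs_representsD(1)[OF u]] by (intro LIMSEQ_le_const[OF pre_norm_limit[OF u]]) auto

end

section \<open>Locally uniform limits\<close>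

lemma nn_integral_uniform_limit:
  fixes u :: "nat \<Rightarrow> 'a \<Rightarrow> real"
  assumes S: "S \<in> sets M" "emeasure M S < \<infinity>" and u: "uniform_limit S u g sequentially"
  shows "(\<lambda>k. \<integral>\<^sup>+x\<in>S. ennreal ((u k x - g x)\<^sup>2) \<partial>M) \<longlonglongrightarrow> 0"
proof (rule order_tendstoI)
  fix a :: ennreal assume a: "0 < a"
  then obtain b where b: "0 < b" "b < a" using dense by blast
  then obtain r where r: "b = ennreal r" "0 < r"
    by (cases b) (auto simp: ennreal_less_zero_iff)
  define m where "m = measure M S"
  have m: "emeasure M S = ennreal m" "0 \<le> m"
    using S by (auto simp: m_def emeasure_eq_ennreal_measure)
  \<comment> \<open>Then \<open>e\<^sup>2 * m \<le> r\<close>; the summand 1 allows a null set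
    \<open>S\<close>.\<close>
  define e where "e = sqrt (r / (m + 1))"
  have e: "0 < e" using r m by (simp add: e_def)
  have "\<forall>\<^sub>F k in sequentially. \<forall>x\<in>S. dist (u k x) (g x) < e"
    using u e unfolding uniform_limit_iff by blast
  then show "\<forall>\<^sub>F k in sequentially. (\<integral>\<^sup>+x\<in>S. ennreal ((u k x - g x)\<^sup>2) \<partial>M) < a"
  proof eventually_elim
    case (elim k)
    have "(\<integral>\<^sup>+x\<in>S. ennreal ((u k x - g x)\<^sup>2) \<partial>M) \<le> (\<integral>\<^sup>+x. ennreal (e\<^sup>2) * indicator S x \<partial>M)"
    proof (rule nn_integral_mono)
      fix x
      have "ennreal ((u k x - g x)\<^sup>2) \<le> ennreal (e\<^sup>2)" if "x \<in> S"
      proof -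
        have "\<bar>u k x - g x\<bar> \<le> \<bar>e\<bar>" using elim that e by (fastforce simp: dist_real_def)
        then show ?thesis by (intro ennreal_leI) (simp add: abs_le_square_iff)
      qed
      then show "ennreal ((u k x - g x)\<^sup>2) * indicator S x \<le> ennreal (e\<^sup>2) * indicator S x"
        by (auto simp: indicator_def)
    qed
    also have "\<dots> = ennreal (e\<^sup>2 * m)" using S m by (simp add: nn_integral_cmult_indicator ennreal_mult)
    also have "\<dots> \<le> ennreal r"
    proof (rule ennreal_leI)
      have "e\<^sup>2 * m = r * (m / (m + 1))" using r m by (simp add: e_def)
      also have "\<dots> \<le> r * 1" using r m by (intro mult_left_mono) auto
      finally show "e\<^sup>2 * m \<le> r" by simp
    qed
    also have "\<dots> < a" using b r by simp
    finally show ?case .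
  qed
qed simp

lemma emeasure_dV0_finite:
  fixes S :: "'n::finite R2n1 set"
  assumes "S \<in> lmeasurable"
  shows "emeasure dV0 S < \<infinity>"
  using assms unfolding dV0_eq(2)
  by (subst emeasure_density_const) (auto simp: fmeasurable_def ennreal_mult_less_top)

lemma AE_dV0:
  "(AE x in (dV0 :: 'n::finite R2n1 measure). P x) \<longleftrightarrow> (AE x in lebesgue. P x)"
  unfolding dV0_eq(2) using dV0_eq(1)[where 'n='n] by (subst AE_density) auto

text \<open>The Sobolev bound turns a Cauchy sequence into a uniformly Cauchy one on
  \<open>L\<close>. Its uniform limit is also an L^2 limit on \<open>L\<close> and so equals
  \<open>f\<close> almost everywhere. Unlike L^2 limits, uniform limits of bounded functions can be
  multiplied.\<close>

lemma fs_represents_uniform: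
  fixes D L :: "'n::finite R2n1 set" and f :: "'n R2n1 \<Rightarrow> real"
  assumes D: "open D" and cD: "compact (closure D)" and L: "compact L" "L \<subseteq> D"
    and u: "fs_represents s D f u" and s: "CARD('n) + 2 \<le> s"
  obtains g where "uniform_limit L u g sequentially" "continuous_on L g"
    "AE x in lebesgue. x \<in> L \<longrightarrow> f x = g x"
proof -
  note us = fs_representsD[OF D cD u]
  obtain C where C: "0 \<le> C"
    "\<And>(w :: 'n R2n1 \<Rightarrow> real) x. smooth_closure D w \<Longrightarrow> x \<in> L \<Longrightarrow> \<bar>w x\<bar> \<le> C * pre_norm (CARD('n) + 2) D w"
    by (rule interior_sobolev[OF D cD L]) blast
  have Ls: "L \<in> sets lebesgue" using L by (simp add: borel_compact lborelD)
  have "uniformly_Cauchy_on L u"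
    unfolding uniformly_Cauchy_on_def
  proof (intro allI impI)
    fix e :: real assume e: "0 < e"
    then have "0 < e / (C + 1)" using C by simp
    then obtain N where N: "\<And>k l. k \<ge> N \<Longrightarrow> l \<ge> N \<Longrightarrow> pre_norm s D (\<lambda>x. u k x - u l x) < e / (C + 1)"
      using us(3) by blast
    have "dist (u k x) (u l x) < e" if "x \<in> L" "k \<ge> N" "l \<ge> N" for x k l
    proof -
      note sd = smooth_closure_diff[OF us(1)[of k] us(1)[of l]]
      have "\<bar>u k x - u l x\<bar> \<le> C * pre_norm (CARD('n) + 2) D (\<lambda>x. u k x - u l x)"
        using C(2)[OF sd that(1)] .
      also have "\<dots> \<le> C * pre_norm s D (\<lambda>x. u k x - u l x)"
        by (intro mult_left_mono C(1) pre_norm_mono[OF D cD sd s])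
      also have "\<dots> \<le> C * (e / (C + 1))"
        using N[OF that(2,3)] by (intro mult_left_mono C(1)) simp
      also have "\<dots> = e * (C / (C + 1))" by simp
      also have "\<dots> < e * 1" using e C(1) by (intro mult_strict_left_mono) auto
      finally show ?thesis by (simp add: dist_real_def)
    qed
    then show "\<exists>M. \<forall>x\<in>L. \<forall>m\<ge>M. \<forall>n\<ge>M. dist (u m x) (u n x) < e" by blast
  qed
  then obtain g where g: "uniform_limit L u g sequentially"
    using Cauchy_uniformly_convergent uniformly_convergent_on_def by metis
  have cu: "continuous_on L (u k)" for k
    using continuous_on_subset[OF smooth_closure_continuous_on[OF us(1)]] L closure_subset by blast
  have cg: "continuous_on L g"
    by (rule uniform_limit_theorem[OF _ g]) (use cu in auto)
  have mu: "set_borel_measurable dV0 L (u k)" for k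
    unfolding set_borel_measurable_dV0 by (rule set_borel_measurable_continuous_lebesgue[OF L(1) order_refl Ls cu])
  have mg: "set_borel_measurable dV0 L g"
    unfolding set_borel_measurable_dV0 by (rule set_borel_measurable_continuous_lebesgue[OF L(1) order_refl Ls cg])
  have mf: "set_borel_measurable dV0 L f"
    using us(2) Ls L by (intro set_borel_measurable_subset[of dV0 D f L]) auto
  have fin: "emeasure dV0 L < \<infinity>"
    using L by (intro emeasure_dV0_finite) (simp add: lmeasurable_compact)
  have 1: "(\<lambda>k. \<integral>\<^sup>+x\<in>L. ennreal ((g x - u k x)\<^sup>2) \<partial>dV0) \<longlonglongrightarrow> 0"
    using nn_integral_uniform_limit[of L dV0, OF _ fin g] Ls by (simp add: power2_commute)
  have 2: "(\<lambda>k. \<integral>\<^sup>+x\<in>L. ennreal ((f x - u k x)\<^sup>2) \<partial>dV0) \<longlonglongrightarrow> 0"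
  proof (rule ennreal_null_comparison[OF _ us(4)])
    show "(\<integral>\<^sup>+x\<in>L. ennreal ((f x - u k x)\<^sup>2) \<partial>dV0) \<le> (\<integral>\<^sup>+x\<in>D. ennreal ((u k x - f x)\<^sup>2) \<partial>dV0)" for k
      using L(2) by (intro nn_integral_mono) (auto simp: indicator_def power2_commute)
  qed
  have le: "(\<integral>\<^sup>+x\<in>L. ennreal ((g x - f x)\<^sup>2) \<partial>dV0)
    \<le> 2 * (\<integral>\<^sup>+x\<in>L. ennreal ((g x - u k x)\<^sup>2) \<partial>dV0) + 2 * (\<integral>\<^sup>+x\<in>L. ennreal ((f x - u k x)\<^sup>2) \<partial>dV0)" for k
    by (intro nn_integral_square_triangle mf mg mu)
  have "(\<lambda>k. 2 * (\<integral>\<^sup>+x\<in>L. ennreal ((g x - u k x)\<^sup>2) \<partial>dV0) + 2 * (\<integral>\<^sup>+x\<in>L. ennreal ((f x - u k x)\<^sup>2) \<partial>dV0))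
      \<longlonglongrightarrow> 2 * 0 + 2 * 0"
    by (intro tendsto_add ennreal_tendsto_cmult 1 2) auto
  then have lim: "(\<lambda>k. 2 * (\<integral>\<^sup>+x\<in>L. ennreal ((g x - u k x)\<^sup>2) \<partial>dV0) + 2 * (\<integral>\<^sup>+x\<in>L. ennreal ((f x - u k x)\<^sup>2) \<partial>dV0))
      \<longlonglongrightarrow> 0"
    by simp
  have "(\<lambda>k::nat. \<integral>\<^sup>+x\<in>L. ennreal ((g x - f x)\<^sup>2) \<partial>dV0) \<longlonglongrightarrow> 0"
    by (rule ennreal_null_comparison[OF le lim])
  then have "(\<integral>\<^sup>+x\<in>L. ennreal ((g x - f x)\<^sup>2) \<partial>dV0) = 0"
    using LIMSEQ_unique[OF tendsto_const] by blast
  then have "AE x in dV0. ennreal ((g x - f x)\<^sup>2) * indicator L x = 0"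
    using borel_measurable_square_diff[OF mg mf] by (simp add: nn_integral_0_iff_AE)
  then have "AE x in dV0. x \<in> L \<longrightarrow> f x = g x"
    by (rule AE_mp) (auto intro!: AE_I2 simp: indicator_def split: if_splits)
  then show ?thesis using that[OF g cg] AE_dV0 by blast
qed


section \<open>Contact transformations and the frame\<close>

lemma eta0_contact_frame [simp]: "eta0 x (contact_frame i x) = 0"
  by (cases i) (auto simp: eta0_def axis_def if_distrib cong: if_cong split: prod.splits)

definition frame_coeff :: "'n::finite + 'n \<Rightarrow> 'n R2n1 \<Rightarrow> real" where
  "frame_coeff i v = (case i of Inl j \<Rightarrow> fst v $ j | Inr j \<Rightarrow> bcoord j v)"

text \<open>On the kernel of \<open>eta0 y\<close> the last coordinate is determined by the others,
  which are the coefficients in the frame.\<close>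

lemma horizontal_expansion:
  fixes v :: "'n::finite R2n1"
  assumes "eta0 y v = 0"
  shows "v = (\<Sum>i\<in>UNIV. frame_coeff i v *\<^sub>R contact_frame i y)"
proof -
  have s: "(\<Sum>j\<in>UNIV. a $ j *\<^sub>R axis j 1) = a" for a :: "real ^ 'n"
    using basis_expansion[of a] by (simp add: scalar_mult_eq_scaleR)
  have 1: "(\<Sum>j\<in>UNIV. frame_coeff (Inl j) v *\<^sub>R contact_frame (Inl j) y) = (fst v, 0, fst (snd y) \<bullet> fst v)"
    by (simp add: frame_coeff_def sum_prod s inner_vec_def mult.commute)
  have 2: "(\<Sum>j\<in>UNIV. frame_coeff (Inr j) v *\<^sub>R contact_frame (Inr j) y) = (0, fst (snd v), 0)"
    by (simp add: frame_coeff_def sum_prod s bcoord_def)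
  have 3: "snd (snd v) = fst (snd y) \<bullet> fst v"
    using assms by (simp add: eta0_def inner_vec_def split: prod.splits)
  show ?thesis unfolding sum_UNIV_sum 1 2 by (simp add: prod_eq_iff 3)
qed

context
  fixes S U :: "'n::finite R2n1 set" and T :: "'n R2n1 \<Rightarrow> 'n R2n1"
  assumes S: "open S" and U: "open U" and T: "smooth_on S T" "T ` S \<subseteq> U"
    and eta: "\<And>x v. x \<in> S \<Longrightarrow> eta0 (T x) (frechet_derivative T (at x) v) = eta0 x v"
begin

text \<open>\<open>T\<close> preserves \<open>eta0\<close>, so it maps frame vectors into the kernel
  of \<open>eta0\<close>, and no derivative in the last coordinate direction appears. Such a term
  would count as two frame derivatives and raise the order.\<close>

lemma X_field_compose:
  fixes w :: "'n R2n1 \<Rightarrow> real"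
  assumes w: "smooth_on U w" and x: "x \<in> S"
  shows "X_field i (\<lambda>y. w (T y)) x = (\<Sum>j\<in>UNIV. frame_coeff j (X_field i T x) * X_field j w (T x))"
proof -
  have Tx: "T x \<in> U" using T x by blast
  let ?d = "frechet_derivative w (at (T x))"
  have hd: "(w has_derivative ?d) (at (T x))" by (rule smooth_on_imp_has_derivative[OF w Tx])
  have lin: "linear ?d" using has_derivative_linear[OF hd] .
  have "X_field i (\<lambda>y. w (T y)) x = ?d (X_field i T x)"
    unfolding X_field_def[of i T]
    by (rule X_field_eqI[OF has_derivative_compose[OF smooth_on_imp_has_derivative[OF T(1) x] hd]])
  also have "X_field i T x = (\<Sum>j\<in>UNIV. frame_coeff j (X_field i T x) *\<^sub>R contact_frame j (T x))"
    by (rule horizontal_expansion) (simp add: X_field_def eta[OF x])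
  finally show ?thesis
    by (simp add: linear_sum[OF lin] linear_scale[OF lin] X_field_def[of _ w] del: contact_frame.simps)
qed

lemma smooth_on_frame_coeff: "smooth_on S (\<lambda>x. frame_coeff j (X_field i T x))"
proof -
  have "bounded_linear (frame_coeff j :: 'n R2n1 \<Rightarrow> real)"
    unfolding frame_coeff_def[abs_def] by (cases j) (simp_all add: bounded_linear_acoord bounded_linear_bcoord[unfolded])
  then show ?thesis by (rule smooth_on_compose_bounded_linear[OF S _ smooth_on_X_field[OF S T(1)]])
qed

text \<open>The coefficients come from \<open>T\<close>, \<open>\<psi>\<close> and \<open>I\<close>
  alone and are fixed before \<open>w\<close>. This uniformity is what later yields a constant valid
  for all functions.\<close>

lemma X_multi_compose:
  fixes \<psi> :: "'n R2n1 \<Rightarrow> real" and I :: "('n + 'n) list"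
  assumes p: "smooth_on S \<psi>"
  obtains c where "\<And>J :: ('n + 'n) list. smooth_on S (c J)"
    "\<And>(w :: 'n R2n1 \<Rightarrow> real) x. smooth_on U w \<Longrightarrow> x \<in> S \<Longrightarrow>
      X_multi I (\<lambda>y. \<psi> y * w (T y)) x = (\<Sum>J | length J \<le> length I. c J x * X_multi J w (T x))"
proof -
  have "\<exists>c. (\<forall>J :: ('n + 'n) list. smooth_on S (c J)) \<and> (\<forall>(w :: 'n R2n1 \<Rightarrow> real) x. smooth_on U w \<longrightarrow> x \<in> S \<longrightarrow>
      X_multi I (\<lambda>y. \<psi> y * w (T y)) x = (\<Sum>J | length J \<le> length I. c J x * X_multi J w (T x)))"
  proof (induction I)
    case Nil
    show ?case by (rule exI[of _ "\<lambda>J. \<psi>"]) (auto simp: p)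
  next
    case (Cons i I)
    then obtain c where c: "\<And>J :: ('n + 'n) list. smooth_on S (c J)"
      "\<And>(w :: 'n R2n1 \<Rightarrow> real) x. smooth_on U w \<Longrightarrow> x \<in> S \<Longrightarrow>
      X_multi I (\<lambda>y. \<psi> y * w (T y)) x = (\<Sum>J | length J \<le> length I. c J x * X_multi J w (T x))" by blast
    let ?a = "\<lambda>j x. frame_coeff j (X_field i T x)"
    \<comment> \<open>The two terms of the product rule, sorted by the resulting word
      \<open>K\<close>. In \<open>c1\<close> the field hits a coefficient and the word stays, so the
      longest words get 0; in \<open>c2\<close> it hits \<open>X_multi J w\<close> and puts a letter
      in front, so the empty word gets 0.\<close>
    define c1 where "c1 = (\<lambda>(K :: ('n + 'n) list) x. if length K \<le> length I then X_field i (c K) x else 0)"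
    define c2 where "c2 = (\<lambda>(K :: ('n + 'n) list) x. case K of [] \<Rightarrow> 0 | j # J \<Rightarrow> ?a j x * c J x)"
    have s1: "smooth_on S (c1 K)" for K
      using smooth_on_X_field[OF S c(1)[of K]] unfolding c1_def by (cases "length K \<le> length I") auto
    have s2: "smooth_on S (c2 K)" for K
      unfolding c2_def by (cases K) (auto intro!: smooth_on_mult S smooth_on_frame_coeff c(1))
    have "X_multi (i # I) (\<lambda>y. \<psi> y * w (T y)) x
        = (\<Sum>K | length K \<le> length (i # I). (c1 K x + c2 K x) * X_multi K w (T x))"
      if w: "smooth_on U w" and x: "x \<in> S" for w :: "'n R2n1 \<Rightarrow> real" and x
    proof -
      have dw: "(\<lambda>y. X_multi J w (T y)) differentiable (at x)" for J
        by (rule smooth_on_imp_differentiable[OF smooth_on_compose[OF S U T(2,1) smooth_on_X_multi[OF U w]] x])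
      have dc: "c J differentiable (at x)" for J
        by (rule smooth_on_imp_differentiable[OF c(1) x])
      have "X_multi (i # I) (\<lambda>y. \<psi> y * w (T y)) x
        = X_field i (\<lambda>x. \<Sum>J | length J \<le> length I. c J x * X_multi J w (T x)) x"
        using c(2)[OF w] by (auto intro!: X_field_cong[OF S x])
      also have "\<dots> = (\<Sum>J | length J \<le> length I. X_field i (\<lambda>x. c J x * X_multi J w (T x)) x)"
        by (intro X_field_sum differentiable_mult dc dw)
      also have "\<dots> = (\<Sum>J | length J \<le> length I. X_field i (c J) x * X_multi J w (T x))
          + (\<Sum>J | length J \<le> length I. \<Sum>j\<in>UNIV. ?a j x * c J x * X_multi (j # J) w (T x))"
        by (simp add: X_field_mult[OF dc dw] X_field_compose[OF smooth_on_X_multi[OF U w] x] sum.distrib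
            sum_distrib_left mult_ac)
      also have "(\<Sum>J | length J \<le> length I. X_field i (c J) x * X_multi J w (T x))
          = (\<Sum>K | length K \<le> length (i # I). c1 K x * X_multi K w (T x))"
        by (rule sum.mono_neutral_cong_left) (auto simp: c1_def)
      also have "(\<Sum>J | length J \<le> length I. \<Sum>j\<in>UNIV. ?a j x * c J x * X_multi (j # J) w (T x))
          = (\<Sum>K\<in>(\<lambda>(J, j). j # J) ` ({J. length J \<le> length I} \<times> UNIV). c2 K x * X_multi K w (T x))"
        by (subst sum.reindex) (auto simp: inj_on_def sum.cartesian_product c2_def case_prod_beta)
      also have "\<dots> = (\<Sum>K | length K \<le> length (i # I). c2 K x * X_multi K w (T x))"
      proof (rule sum.mono_neutral_left)
        show "\<forall>K\<in>{K. length K \<le> length (i # I)} - (\<lambda>(J, j). j # J) ` ({J. length J \<le> length I} \<times> UNIV).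
          c2 K x * X_multi K w (T x) = 0"
        proof
          fix K :: "('n + 'n) list"
          assume K: "K \<in> {K. length K \<le> length (i # I)} - (\<lambda>(J, j). j # J) ` ({J. length J \<le> length I} \<times> UNIV)"
          then have "K = []" by (cases K) (auto simp: image_iff)
          then show "c2 K x * X_multi K w (T x) = 0" by (simp add: c2_def)
        qed
      qed auto
      finally show ?thesis by (simp only: distrib_right sum.distrib)
    qed
    then show ?case using smooth_on_add[OF S s1 s2] by (intro exI[of _ "\<lambda>K x. c1 K x + c2 K x"]) blast
  qed
  then show ?thesis using that by blast
qed

end

section \<open>Change of variables\<close>

lemma nn_integral_le_of_emeasure_le:
  assumes sets: "sets M = sets N" and le: "\<And>A. A \<in> sets M \<Longrightarrow> emeasure M A \<le> C * emeasure N A"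
    and f: "f \<in> borel_measurable M"
  shows "(\<integral>\<^sup>+x. f x \<partial>M) \<le> C * (\<integral>\<^sup>+x. f x \<partial>N)"
  using f
proof (induction rule: borel_measurable_induct)
  case (cong f g)
  then show ?case
    using nn_integral_cong[of M f g] nn_integral_cong[of N f g] sets_eq_imp_space_eq[OF sets] by simp
next
  case (set A)
  then show ?case using le sets by simp
next
  case (mult u c)
  then have "u \<in> borel_measurable N" using measurable_cong_sets[OF sets refl] by blast
  then show ?case
    using mult mult_left_mono[of "integral\<^sup>N M u" "C * integral\<^sup>N N u" c]
    by (simp add: nn_integral_cmult mult.left_commute)
next
  case (add u v)
  then have "u \<in> borel_measurable N" "v \<in> borel_measurable N" using measurable_cong_sets[OF sets refl] by blast+
  then show ?case using add by (simp add: nn_integral_add distrib_left add_mono)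
next
  case (seq U)
  then have N: "U i \<in> borel_measurable N" for i using measurable_cong_sets[OF sets refl] by blast
  have "(\<integral>\<^sup>+x. (SUP i. U i) x \<partial>M) = (SUP i. \<integral>\<^sup>+x. U i x \<partial>M)"
    using seq by (simp add: nn_integral_monotone_convergence_SUP SUP_apply image_comp)
  also have "\<dots> \<le> (SUP i. C * \<integral>\<^sup>+x. U i x \<partial>N)" using seq by (intro SUP_mono) blast
  also have "\<dots> = C * (SUP i. \<integral>\<^sup>+x. U i x \<partial>N)" by (simp add: SUP_mult_left_ennreal)
  also have "(SUP i. \<integral>\<^sup>+x. U i x \<partial>N) = (\<integral>\<^sup>+x. (SUP i. U i) x \<partial>N)"
    using seq N by (simp add: nn_integral_monotone_convergence_SUP SUP_apply image_comp)
  finally show ?case .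
qed

context
  fixes L :: "'e::euclidean_space set" and T :: "'e \<Rightarrow> 'e" and B :: real
  assumes L: "compact L" and T: "continuous_on L T" and B: "0 < B"
    and lip: "\<And>x y. x \<in> L \<Longrightarrow> y \<in> L \<Longrightarrow> dist x y \<le> B * dist (T x) (T y)"
begin

lemma preimage_borel:
  assumes "A \<in> sets borel"
  shows "L \<inter> T -` A \<in> sets borel"
proof -
  have "T \<in> borel_measurable (restrict_space borel L)" by (rule borel_measurable_continuous_on_restrict[OF T])
  then have "T -` A \<inter> space (restrict_space borel L) \<in> sets (restrict_space borel L)"
    using assms by (rule measurable_sets)
  then show ?thesis
    using borel_compact[OF L] by (auto simp: space_restrict_space sets_restrict_space_iff Int_commute)
qed

text \<open>Two points of a cube of side \<open>l\<close> are at distance at most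
  \<open>DIM('e) * l\<close>; their preimages are then within \<open>B * DIM('e) * l\<close> of each
  other. So the preimage lies in a cube of side \<open>2 * B * DIM('e) * l\<close>, whence the
  constant. No derivative of \<open>T\<close> enters.\<close>

lemma preimage_cube:
  assumes cube: "\<And>i. i \<in> Basis \<Longrightarrow> v \<bullet> i - u \<bullet> i = l" and l: "0 \<le> l"
  shows "emeasure lborel (L \<inter> T -` cbox u v) \<le> ennreal ((2 * B * DIM('e)) ^ DIM('e)) * emeasure lborel (cbox u v)"
proof (cases "L \<inter> T -` cbox u v = {}")
  case False
  then obtain x0 where x0: "x0 \<in> L" "T x0 \<in> cbox u v" by auto
  define r where "r = B * (DIM('e) * l)"
  have r: "0 \<le> r" using B l by (simp add: r_def)
  have "L \<inter> T -` cbox u v \<subseteq> cbox (x0 - r *\<^sub>R One) (x0 + r *\<^sub>R One)"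
  proof
    fix x assume x: "x \<in> L \<inter> T -` cbox u v"
    have "dist (T x0) (T x) \<le> (\<Sum>i\<in>Basis. \<bar>(T x0 - T x) \<bullet> i\<bar>)"
      unfolding dist_norm by (rule norm_le_l1)
    also have "\<dots> \<le> (\<Sum>i\<in>(Basis :: 'e set). l)"
    proof (rule sum_mono)
      fix i :: 'e assume i: "i \<in> Basis"
      then have "u \<bullet> i \<le> T x0 \<bullet> i" "T x0 \<bullet> i \<le> v \<bullet> i" "u \<bullet> i \<le> T x \<bullet> i" "T x \<bullet> i \<le> v \<bullet> i"
        using x0 x by (auto simp: mem_box)
      then show "\<bar>(T x0 - T x) \<bullet> i\<bar> \<le> l" using cube[OF i] by (simp add: inner_diff_left abs_le_iff)
    qed
    finally have "B * dist (T x0) (T x) \<le> r" using B by (simp add: r_def mult_left_mono)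
    then have "dist x0 x \<le> r" using lip[of x0 x] x0 x by simp
    then have "\<bar>(x0 - x) \<bullet> i\<bar> \<le> r" if "i \<in> Basis" for i
      using Basis_le_norm[OF that, of "x0 - x"] by (simp add: dist_norm)
    then show "x \<in> cbox (x0 - r *\<^sub>R One) (x0 + r *\<^sub>R One)"
      by (fastforce simp: mem_box inner_diff_left inner_add_left abs_le_iff)
  qed
  then have "emeasure lborel (L \<inter> T -` cbox u v) \<le> emeasure lborel (cbox (x0 - r *\<^sub>R One) (x0 + r *\<^sub>R One))"
    by (intro emeasure_mono) auto
  also have "\<dots> = ennreal ((2 * r) ^ DIM('e))"
    using r by (subst emeasure_lborel_cbox) (auto simp: inner_add_left inner_diff_left)
  also have "\<dots> = ennreal ((2 * B * DIM('e)) ^ DIM('e)) * ennreal (l ^ DIM('e))"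
    using B l by (simp add: r_def ennreal_mult[symmetric] power_mult_distrib mult_ac)
  also have "ennreal (l ^ DIM('e)) = emeasure lborel (cbox u v)"
  proof -
    have "(\<Prod>i\<in>(Basis :: 'e set). (v - u) \<bullet> i) = (\<Prod>i\<in>(Basis :: 'e set). l)"
      by (rule prod.cong) (auto simp: inner_diff_left cube)
    then have "(\<Prod>i\<in>(Basis :: 'e set). (v - u) \<bullet> i) = l ^ DIM('e)" by simp
    moreover have "u \<bullet> i \<le> v \<bullet> i" if "i \<in> Basis" for i using cube[OF that] l by linarith
    ultimately show ?thesis by (simp add: emeasure_lborel_cbox)
  qed
  finally show ?thesis .
qed simp

text \<open>A covering of \<open>A\<close> by cubes with disjoint interiors inside an open set
  \<open>U\<close> of nearly the same measure reduces the claim to single cubes. Passing to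
  interiors is harmless, as the boundary of a cube is a null set.\<close>

lemma preimage_emeasure_bounded:
  assumes A: "A \<in> sets borel" "bounded A"
  shows "emeasure lborel (L \<inter> T -` A) \<le> ennreal ((2 * B * DIM('e)) ^ DIM('e)) * emeasure lborel A"
proof (rule ennreal_le_epsilon)
  let ?C = "(2 * B * DIM('e)) ^ DIM('e)"
  fix e :: real assume e: "0 < e"
  have C: "0 < ?C" using B by simp
  obtain U where U: "open U" "A \<subseteq> U" "U - A \<in> lmeasurable" "emeasure lebesgue (U - A) < ennreal (e / ?C)"
    using sets_lebesgue_outer_open[of A "e / ?C"] A e C by auto
  obtain a where a: "0 < a" "\<And>y. y \<in> A \<Longrightarrow> norm y \<le> a" using A(2) unfolding bounded_pos by metis
  have "A \<subseteq> cbox (- a *\<^sub>R One) (a *\<^sub>R One)"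
  proof
    fix y assume y: "y \<in> A"
    have "\<bar>y \<bullet> i\<bar> \<le> a" if "i \<in> Basis" for i
      using Basis_le_norm[OF that, of y] a(2)[OF y] by linarith
    then show "y \<in> cbox (- a *\<^sub>R One) (a *\<^sub>R One)" by (fastforce simp: mem_box abs_le_iff)
  qed
  moreover have "box (- a *\<^sub>R One) (a *\<^sub>R One :: 'e) \<noteq> {}" using a by (simp add: box_ne_empty)
  \<comment> \<open>Each cube of the covering lies in the gauge set of one of its points that
    belongs to \<open>A\<close>, and \<open>A \<subseteq> U\<close>; this gauge therefore keeps all
    cubes inside \<open>U\<close>. They are true cubes because they arise by bisecting one.\<close>
  moreover have "gauge (\<lambda>x. if x \<in> U then U else UNIV)" using U by (auto simp: gauge_def)
  ultimately obtain \<D> where D: "countable \<D>" "\<And>K. K \<in> \<D> \<Longrightarrow> interior K \<noteq> {} \<and> (\<exists>c d. K = cbox c d)"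
      "pairwise (\<lambda>A B. interior A \<inter> interior B = {}) \<D>" "\<And>K. K \<in> \<D> \<Longrightarrow> \<exists>x\<in>A \<inter> K. K \<subseteq> (if x \<in> U then U else UNIV)"
      "\<And>u v. cbox u v \<in> \<D> \<Longrightarrow> \<exists>n. \<forall>i\<in>Basis. v \<bullet> i - u \<bullet> i = ((a *\<^sub>R One) \<bullet> i - (- a *\<^sub>R One :: 'e) \<bullet> i) / 2 ^ n" "A \<subseteq> \<Union>\<D>"
    by (rule covering_lemma) blast
  have DU: "K \<subseteq> U" if KD: "K \<in> \<D>" for K
  proof -
    obtain x where x: "x \<in> A" "K \<subseteq> (if x \<in> U then U else UNIV)" using D(4)[OF KD] by blast
    then have "x \<in> U" using U(2) by blast
    then show ?thesis using x(2) by simp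
  qed
  have cube: "emeasure lborel (L \<inter> T -` K) \<le> ennreal ?C * emeasure lborel (interior K)" if KD: "K \<in> \<D>" for K
  proof -
    obtain u v where K: "K = cbox u v" using D(2)[OF KD] by blast
    obtain n where n: "\<And>i. i \<in> Basis \<Longrightarrow> v \<bullet> i - u \<bullet> i = 2 * a / 2 ^ n"
      using D(5)[of u v] KD K by (fastforce simp: field_simps)
    have "emeasure lborel (interior K) = emeasure lborel K"
      unfolding K interior_cbox by (simp add: emeasure_lborel_box_eq emeasure_lborel_cbox_eq)
    then show ?thesis using preimage_cube[OF n] a(1) unfolding K by simp
  qed
  \<comment> \<open>An enumeration by all natural numbers even if the family is finite: surplus
    indices get the empty set.\<close>
  define X where "X n = (if n \<in> to_nat_on \<D> ` \<D> then from_nat_into \<D> n else {})" for n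
  have XD: "X n \<in> \<D>" if "n \<in> to_nat_on \<D> ` \<D>" for n
    using that D(1) by (auto simp: X_def)
  have UX: "\<Union>\<D> = (\<Union>n. X n)"
  proof
    show "\<Union>\<D> \<subseteq> (\<Union>n. X n)"
    proof
      fix y assume "y \<in> \<Union>\<D>"
      then obtain K where "K \<in> \<D>" "y \<in> K" by blast
      then have "y \<in> X (to_nat_on \<D> K)" using D(1) by (simp add: X_def)
      then show "y \<in> (\<Union>n. X n)" by blast
    qed
    show "(\<Union>n. X n) \<subseteq> \<Union>\<D>" using XD by (auto simp: X_def split: if_splits)
  qed
  have Xb: "X n \<in> sets borel" for n
    using XD[of n] D(2)[of "X n"] by (cases "n \<in> to_nat_on \<D> ` \<D>") (auto simp: X_def)
  have Xle: "emeasure lborel (L \<inter> T -` X n) \<le> ennreal ?C * emeasure lborel (interior (X n))" for n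
  proof (cases "n \<in> to_nat_on \<D> ` \<D>")
    case True
    show ?thesis by (rule cube[OF XD[OF True]])
  qed (simp add: X_def)
  have dis: "disjoint_family (\<lambda>n. interior (X n))"
    unfolding disjoint_family_on_def
  proof (intro ballI impI)
    fix m n :: nat assume "m \<noteq> n"
    show "interior (X m) \<inter> interior (X n) = {}"
    proof (cases "m \<in> to_nat_on \<D> ` \<D> \<and> n \<in> to_nat_on \<D> ` \<D>")
      case True
      then have "X m \<noteq> X n" using \<open>m \<noteq> n\<close> D(1) by (auto simp: X_def)
      then show ?thesis using D(3) XD True unfolding pairwise_def by blast
    qed (auto simp: X_def)
  qed
  have "emeasure lborel (L \<inter> T -` A) \<le> emeasure lborel (\<Union>n. L \<inter> T -` X n)"
  proof (rule emeasure_mono)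
    have "A \<subseteq> (\<Union>n. X n)" using D(6) unfolding UX .
    then have "T x \<in> (\<Union>n. X n)" if "T x \<in> A" for x using that by (rule subsetD)
    then show "L \<inter> T -` A \<subseteq> (\<Union>n. L \<inter> T -` X n)" by simp fast
    have "(\<Union>n. L \<inter> T -` X n) \<in> sets borel" by (rule sets.countable_UN) (use preimage_borel[OF Xb] in blast)
    then show "(\<Union>n. L \<inter> T -` X n) \<in> sets lborel" by simp
  qed
  also have "\<dots> \<le> (\<Sum>n. emeasure lborel (L \<inter> T -` X n))"
    using preimage_borel[OF Xb] by (intro emeasure_subadditive_countably) auto
  also have "\<dots> \<le> (\<Sum>n. ennreal ?C * emeasure lborel (interior (X n)))"
    by (intro suminf_le Xle) auto
  also have "\<dots> = ennreal ?C * (\<Sum>n. emeasure lborel (interior (X n)))" by simp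
  also have "(\<Sum>n. emeasure lborel (interior (X n))) = emeasure lborel (\<Union>n. interior (X n))"
    by (rule suminf_emeasure[OF _ dis]) auto
  also have "\<dots> \<le> emeasure lborel U"
    using UX DU interior_subset by (intro emeasure_mono) (auto simp: subset_iff U(1), blast)
  also have "\<dots> \<le> emeasure lborel A + emeasure lborel (U - A)"
    using A(1) U(1,2) emeasure_subadditive[of A lborel "U - A"] by (simp add: Un_absorb1)
  also have "emeasure lborel (U - A) \<le> ennreal (e / ?C)"
    using U(1,4) A(1) by (simp add: less_imp_le)
  finally have "emeasure lborel (L \<inter> T -` A) \<le> ennreal ?C * (emeasure lborel A + ennreal (e / ?C))"
    by (simp add: mult_left_mono add_left_mono)
  also have "\<dots> = ennreal ?C * emeasure lborel A + ennreal e"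
  proof -
    have "ennreal c * ennreal (e / c) = ennreal e" if "0 < c" for c
      using e that by (simp add: ennreal_mult[symmetric])
    then show ?thesis using C by (simp only: distrib_left)
  qed
  finally show "emeasure lborel (L \<inter> T -` A) \<le> ennreal ?C * emeasure lborel A + ennreal e" .
qed

lemma preimage_emeasure_le:
  assumes A: "A \<in> sets borel"
  shows "emeasure lborel (L \<inter> T -` A) \<le> ennreal ((2 * B * DIM('e)) ^ DIM('e)) * emeasure lborel (A \<inter> T ` L)"
proof -
  have "compact (T ` L)" by (rule compact_continuous_image[OF T L])
  then have "A \<inter> T ` L \<in> sets borel" "bounded (A \<inter> T ` L)"
    using A borel_compact compact_imp_bounded by (auto intro: bounded_subset)
  moreover have eq: "L \<inter> T -` A = L \<inter> T -` (A \<inter> T ` L)" by auto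
  ultimately show ?thesis
    unfolding eq by (intro preimage_emeasure_bounded)
qed

text \<open>The push-forward under \<open>T\<close> of Lebesgue measure on \<open>L\<close> is at
  most a constant times Lebesgue measure; this passes from sets to integrals of nonnegative
  functions.\<close>

lemma l2_compose_le:
  assumes L': "T ` L \<subseteq> L'" "compact L'" and v: "continuous_on L' v"
  shows "l2 L (\<lambda>x. v (T x)) \<le> sqrt ((2 * B * DIM('e)) ^ DIM('e)) * l2 L' v"
proof -
  let ?C = "(2 * B * DIM('e)) ^ DIM('e)"
  have C: "0 \<le> ?C" using B by simp
  let ?M = "distr (restrict_space lborel L) borel T"
  have Lb: "L \<in> sets borel" "L' \<in> sets borel" using L L'(2) borel_compact by auto
  have Tm: "T \<in> measurable (restrict_space lborel L) borel"
    using borel_measurable_continuous_on_restrict[OF T] measurable_cong_sets[of "restrict_space lborel L" "restrict_space borel L"]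
    by (simp add: sets_restrict_space)
  define F where "F = (\<lambda>y. ennreal (indicator L' y *\<^sub>R (v y)\<^sup>2))"
  have Fm [measurable]: "F \<in> borel_measurable borel"
    unfolding F_def using borel_measurable_continuous_on_indicator[OF Lb(2) continuous_on_power[OF v, of 2]] by simp
  have le: "emeasure ?M A \<le> ennreal ?C * emeasure lborel A" if "A \<in> sets ?M" for A
  proof -
    have "emeasure ?M A = emeasure lborel (L \<inter> T -` A)"
      using that Tm Lb by (subst emeasure_distr) (auto simp: emeasure_restrict_space space_restrict_space Int_commute)
    also have "\<dots> \<le> ennreal ?C * emeasure lborel (A \<inter> T ` L)" using that by (intro preimage_emeasure_le) simp
    also have "\<dots> \<le> ennreal ?C * emeasure lborel A"
      using that by (intro mult_left_mono emeasure_mono) auto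
    finally show ?thesis .
  qed
  have cvT: "continuous_on L (\<lambda>x. v (T x))" by (rule continuous_on_compose2[OF v T L'(1)])
  have i1: "integrable lborel (\<lambda>x. indicator L x *\<^sub>R (v (T x))\<^sup>2)"
    by (rule borel_integrable_compact[OF L continuous_on_power[OF cvT]])
  have i2: "integrable lborel (\<lambda>x. indicator L' x *\<^sub>R (v x)\<^sup>2)"
    by (rule borel_integrable_compact[OF L'(2) continuous_on_power[OF v]])
  have "ennreal (LINT x:L|lebesgue. (v (T x))\<^sup>2) = ennreal (LINT x|lborel. indicator L x *\<^sub>R (v (T x))\<^sup>2)"
    using i1 by (simp add: set_lebesgue_integral_def integral_completion)
  also have "\<dots> = (\<integral>\<^sup>+x. ennreal (indicator L x *\<^sub>R (v (T x))\<^sup>2) \<partial>lborel)"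
    by (rule nn_integral_eq_integral[OF i1, symmetric]) simp
  also have "\<dots> = (\<integral>\<^sup>+x. F (T x) * indicator L x \<partial>lborel)"
    using L'(1) by (intro nn_integral_cong) (auto simp: F_def indicator_def)
  also have "\<dots> = (\<integral>\<^sup>+x. F (T x) \<partial>restrict_space lborel L)"
    using Lb by (subst nn_integral_restrict_space) auto
  also have "\<dots> = (\<integral>\<^sup>+y. F y \<partial>?M)"
    by (rule nn_integral_distr[OF Tm, symmetric]) simp
  also have "\<dots> \<le> ennreal ?C * (\<integral>\<^sup>+y. F y \<partial>lborel)"
    by (rule nn_integral_le_of_emeasure_le[OF _ le]) auto
  also have "(\<integral>\<^sup>+y. F y \<partial>lborel) = ennreal (LINT x|lborel. indicator L' x *\<^sub>R (v x)\<^sup>2)"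
    unfolding F_def by (rule nn_integral_eq_integral[OF i2]) simp
  also have "\<dots> = ennreal (LINT x:L'|lebesgue. (v x)\<^sup>2)"
    using i2 by (simp add: set_lebesgue_integral_def integral_completion)
  finally have "(LINT x:L|lebesgue. (v (T x))\<^sup>2) \<le> ?C * (LINT x:L'|lebesgue. (v x)\<^sup>2)"
    using C set_integral_square_nonneg by (subst (asm) ennreal_mult[symmetric]) auto
  then have "l2 L (\<lambda>x. v (T x)) \<le> sqrt (?C * (LINT x:L'|lebesgue. (v x)\<^sup>2))"
    unfolding l2_def by (rule real_sqrt_le_mono)
  then show ?thesis by (simp add: l2_def real_sqrt_mult)
qed

text \<open>Preimages of null sets are null by \<open>preimage_emeasure_le\<close>, so identities
  almost everywhere can be carried from one region to another.\<close>

lemma AE_compose: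
  assumes "AE y in lebesgue. P y"
  shows "AE x in lebesgue. x \<in> L \<longrightarrow> P (T x)"
proof -
  obtain N where N: "N \<in> null_sets lborel" "{y. \<not> P y} \<subseteq> N"
    using assms by (auto simp: eventually_ae_filter null_sets_completion_iff2)
  have Nb: "N \<in> sets borel" using N by auto
  have "emeasure lborel (L \<inter> T -` N) \<le> ennreal ((2 * B * DIM('e)) ^ DIM('e)) * emeasure lborel (N \<inter> T ` L)"
    by (rule preimage_emeasure_le[OF Nb])
  also have "emeasure lborel (N \<inter> T ` L) \<le> emeasure lborel N" using Nb by (intro emeasure_mono) auto
  also have "emeasure lborel N = 0" using N by auto
  finally have "L \<inter> T -` N \<in> null_sets lborel"
    using preimage_borel[OF Nb] by (simp add: null_sets_def mult_left_mono)
  then have "L \<inter> T -` N \<in> null_sets lebesgue" by (rule null_sets_completionI)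
  then show ?thesis by (rule AE_I') (use N(2) in auto)
qed

end

lemma X_multi_zero [simp]: "X_multi I (\<lambda>x. 0 :: real) x = 0"
proof (induction I arbitrary: x)
  case (Cons i I)
  then have "X_multi I (\<lambda>x. 0 :: real) = (\<lambda>x. 0)" by blast
  then show ?case by simp
qed simp

text \<open>A piece of the region \<open>D\<close> that a contact transformation \<open>T\<close> carries into the interior of
  the region \<open>D'\<close>; the bound \<open>B\<close> is a Lipschitz constant of the inverse of \<open>T\<close>.\<close>

locale chart_piece =
  fixes D V W L :: "'n::finite R2n1 set" and D' L' :: "'n R2n1 set"
    and T :: "'n R2n1 \<Rightarrow> 'n R2n1" and B :: real and \<psi> :: "'n R2n1 \<Rightarrow> real"
  assumes D: "open D" "compact (closure D)" and V: "open V" "closure D \<subseteq> V"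
    and W: "open W" and D': "open D'" "compact (closure D')"
    and T: "smooth_on W T" "T ` W \<subseteq> D'"
    and eta: "\<And>x v. x \<in> W \<Longrightarrow> eta0 (T x) (frechet_derivative T (at x) v) = eta0 x v"
    and L: "compact L" "L \<subseteq> W" and L': "compact L'" "L' \<subseteq> D'" and TL: "T ` L \<subseteq> L'"
    and B: "0 < B" and lip: "\<And>x y. x \<in> L \<Longrightarrow> y \<in> L \<Longrightarrow> dist x y \<le> B * dist (T x) (T y)"
    and \<psi>: "smooth_on V \<psi>" "\<And>x. x \<in> V \<Longrightarrow> x \<notin> L \<Longrightarrow> \<psi> x = 0"
begin

text \<open>\<open>T\<close> is smooth on \<open>W\<close> only, but within the neighbourhood
  \<open>V\<close> of the closure of \<open>D\<close> the weight \<open>\<psi>\<close> is supported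
  in \<open>L \<subseteq> W\<close>; extension by zero makes the product smooth on
  \<open>V\<close>.\<close>

lemma smooth_closure_pullback:
  fixes w :: "'n R2n1 \<Rightarrow> real"
  assumes w: "smooth_on D' w"
  shows "smooth_closure D (\<lambda>x. \<psi> x * w (T x))"
proof -
  have o: "open (V \<inter> W)" by (rule open_Int[OF V(1) W])
  have "smooth_on (V \<inter> W) (\<lambda>x. \<psi> x * w (T x))"
    using T by (intro smooth_on_mult o smooth_on_subset[OF \<psi>(1)] smooth_on_compose[OF o D'(1) _ _ w]
        smooth_on_subset[OF T(1)]) auto
  then have "smooth_on V (\<lambda>x. \<psi> x * w (T x))"
    using V W L \<psi>(2) by (intro smooth_on_extend_zero[of V W _ L]) (auto simp: compact_imp_closed)
  then show ?thesis using V unfolding smooth_closure_def by blast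
qed

lemma continuous_T: "continuous_on L T"
  using smooth_on_imp_continuous_on[OF T(1)] L continuous_on_subset by blast

text \<open>The expression vanishes on \<open>D - L\<close>. On \<open>D \<inter> L\<close> it is a
  combination of the \<open>X_multi J w\<close> at \<open>T x\<close> with coefficients bounded on a
  compact set, and the change of variables moves the integrals to \<open>L'\<close>.\<close>

lemma l2_X_multi_pullback:
  obtains C where "0 \<le> C" "\<And>w :: 'n R2n1 \<Rightarrow> real. smooth_on D' w \<Longrightarrow>
    l2 D (X_multi I (\<lambda>x. \<psi> x * w (T x))) \<le> C * (\<Sum>J | length J \<le> length I. l2 L' (X_multi J w))"
proof -
  \<comment> \<open>\<open>L\<close> may leave \<open>V\<close>, where the coefficients are
    uncontrolled, so they are bounded on \<open>?K\<close>, a compact subset of \<open>?S\<close>.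
    Integration takes place over \<open>?E\<close>, contained in \<open>?K\<close>.\<close>
  let ?S = "V \<inter> W" and ?K = "closure D \<inter> L" and ?E = "D \<inter> L"
  let ?\<J> = "{J :: ('n + 'n) list. length J \<le> length I}"
  have o: "open ?S" by (rule open_Int[OF V(1) W])
  have TS: "T ` ?S \<subseteq> D'" using T by auto
  obtain c where c: "\<And>J :: ('n + 'n) list. smooth_on ?S (c J)"
    "\<And>(w :: 'n R2n1 \<Rightarrow> real) x. smooth_on D' w \<Longrightarrow> x \<in> ?S \<Longrightarrow>
      X_multi I (\<lambda>y. \<psi> y * w (T y)) x = (\<Sum>J | length J \<le> length I. c J x * X_multi J w (T x))"
    by (rule X_multi_compose[OF o D'(1) smooth_on_subset[OF T(1)] TS eta smooth_on_subset[OF \<psi>(1)], of I]) auto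
  have K: "compact ?K" "?K \<subseteq> ?S" using D L V by (auto intro: compact_Int)
  have Ks: "?E \<in> sets lebesgue" "?E \<subseteq> ?K"
    using D(1) L(1) closure_subset[of D] by (auto simp: borel_compact lborelD)
  have Ls: "L \<in> sets lebesgue" using L by (simp add: borel_compact lborelD)
  have cc: "continuous_on ?K (c J)" for J
    using smooth_on_imp_continuous_on[OF c(1)] K(2) continuous_on_subset by blast
  have "\<exists>M\<ge>0. \<forall>x\<in>?K. \<bar>c J x\<bar> \<le> M" for J
  proof -
    have "bounded (c J ` ?K)" by (intro compact_imp_bounded compact_continuous_image cc K)
    then obtain M where "\<forall>y\<in>c J ` ?K. norm y \<le> M" unfolding bounded_iff by blast
    then show ?thesis by (intro exI[of _ "max 0 M"]) force
  qed
  then obtain M where M: "\<And>J. 0 \<le> M J" "\<And>J x. x \<in> ?K \<Longrightarrow> \<bar>c J x\<bar> \<le> M J" by metis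
  define M0 where "M0 = (\<Sum>J\<in>?\<J>. M J)"
  have M0: "M J \<le> M0" if "J \<in> ?\<J>" for J
    unfolding M0_def using that M(1) by (intro member_le_sum) auto
  have M00: "0 \<le> M0" unfolding M0_def by (intro sum_nonneg M)
  define C where "C = sqrt ((2 * B * DIM('n R2n1)) ^ DIM('n R2n1))"
  have C: "0 \<le> C" using B by (simp add: C_def)
  show ?thesis
  proof (rule that[of "M0 * C"])
    show "0 \<le> M0 * C" using M00 C by simp
    fix w :: "'n R2n1 \<Rightarrow> real" assume w: "smooth_on D' w"
    have cX: "continuous_on L' (X_multi J w)" for J
      using smooth_on_imp_continuous_on[OF smooth_on_X_multi[OF D'(1) w]] L' continuous_on_subset by blast
    have cXT: "continuous_on L (\<lambda>x. X_multi J w (T x))" for J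
      by (rule continuous_on_compose2[OF cX continuous_T TL])
    have zero: "X_multi I (\<lambda>y. \<psi> y * w (T y)) x = 0" if "x \<in> D" "x \<notin> L" for x
    proof -
      have "x \<in> V - L" using that V closure_subset[of D] by blast
      then have "X_multi I (\<lambda>y. \<psi> y * w (T y)) x = X_multi I (\<lambda>y. 0) x"
        using V L \<psi>(2) by (intro X_multi_cong[of "V - L"]) (auto simp: open_Diff compact_imp_closed)
      then show ?thesis by simp
    qed
    have inS: "X_multi I (\<lambda>y. \<psi> y * w (T y)) x = (\<Sum>J\<in>?\<J>. c J x * X_multi J w (T x))" if "x \<in> ?E" for x
      using c(2)[OF w] that Ks(2) K(2) by blast
    have "indicator D x *\<^sub>R (X_multi I (\<lambda>x. \<psi> x * w (T x)) x)\<^sup>2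
       = indicator ?E x *\<^sub>R (\<Sum>J\<in>?\<J>. c J x * X_multi J w (T x))\<^sup>2" for x
      using zero[of x] inS[of x] by (cases "x \<in> D"; cases "x \<in> L") simp_all
    then have "l2 D (X_multi I (\<lambda>x. \<psi> x * w (T x))) = l2 ?E (\<lambda>x. \<Sum>J\<in>?\<J>. c J x * X_multi J w (T x))"
      unfolding l2_def set_lebesgue_integral_def by simp
    also have "\<dots> \<le> (\<Sum>J\<in>?\<J>. l2 ?E (\<lambda>x. c J x * X_multi J w (T x)))"
    proof (rule conjunct2[OF l2_sum])
      show "l2_on ?E (\<lambda>x. c J x * X_multi J w (T x))" for J
        by (intro l2_on_continuous[OF K(1) Ks(2,1)] continuous_on_mult cc continuous_on_subset[OF cXT]) auto
    qed
    also have "\<dots> \<le> (\<Sum>J\<in>?\<J>. M0 * C * l2 L' (X_multi J w))"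
    proof (rule sum_mono)
      fix J :: "('n + 'n) list" assume J: "J \<in> ?\<J>"
      have "l2 ?E (\<lambda>x. c J x * X_multi J w (T x)) \<le> \<bar>M J\<bar> * l2 ?E (\<lambda>x. X_multi J w (T x))"
      proof (rule l2_mult_le)
        show "l2_on ?E (\<lambda>x. X_multi J w (T x))"
          by (intro l2_on_continuous[OF K(1) Ks(2,1)] continuous_on_subset[OF cXT]) auto
        show "l2_on ?E (\<lambda>x. c J x * X_multi J w (T x))"
          by (intro l2_on_continuous[OF K(1) Ks(2,1)] continuous_on_mult cc continuous_on_subset[OF cXT]) auto
        show "\<And>x. x \<in> ?E \<Longrightarrow> \<bar>c J x\<bar> \<le> M J" using M(2) Ks(2) by blast
      qed
      also have "\<dots> \<le> M0 * l2 ?E (\<lambda>x. X_multi J w (T x))"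
        using M(1) M0[OF J] by (intro mult_right_mono) auto
      also have "\<dots> \<le> M0 * l2 L (\<lambda>x. X_multi J w (T x))"
        using Ks(1) by (intro mult_left_mono M00 l2_subset[OF l2_on_continuous[OF L(1) order_refl Ls cXT]]) auto
      also have "\<dots> \<le> M0 * (C * l2 L' (X_multi J w))"
        unfolding C_def using l2_compose_le[OF L(1) continuous_T B lip TL L'(1) cX]
        by (intro mult_left_mono M00)
      finally show "l2 ?E (\<lambda>x. c J x * X_multi J w (T x)) \<le> M0 * C * l2 L' (X_multi J w)" by simp
    qed
    also have "\<dots> = M0 * C * (\<Sum>J\<in>?\<J>. l2 L' (X_multi J w))" by (rule sum_distrib_left[symmetric])
    finally show "l2 D (X_multi I (\<lambda>x. \<psi> x * w (T x))) \<le> M0 * C * (\<Sum>J\<in>?\<J>. l2 L' (X_multi J w))" .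
  qed
qed

lemma pre_norm_pullback:
  obtains C where "0 \<le> C" "\<And>w :: 'n R2n1 \<Rightarrow> real. smooth_on D' w \<Longrightarrow>
    pre_norm s D (\<lambda>x. \<psi> x * w (T x)) \<le> C * (\<Sum>J | length J \<le> s. l2 L' (X_multi J w))"
proof -
  let ?A = "\<lambda>s. {J :: ('n + 'n) list. length J \<le> s}"
  have "\<forall>I. \<exists>C. 0 \<le> C \<and> (\<forall>w :: 'n R2n1 \<Rightarrow> real. smooth_on D' w \<longrightarrow>
    l2 D (X_multi I (\<lambda>x. \<psi> x * w (T x))) \<le> C * (\<Sum>J\<in>?A (length I). l2 L' (X_multi J w)))"
  proof
    fix I :: "('n + 'n) list"
    show "\<exists>C. 0 \<le> C \<and> (\<forall>w :: 'n R2n1 \<Rightarrow> real. smooth_on D' w \<longrightarrow>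
      l2 D (X_multi I (\<lambda>x. \<psi> x * w (T x))) \<le> C * (\<Sum>J\<in>?A (length I). l2 L' (X_multi J w)))"
      by (rule l2_X_multi_pullback[of I]) blast
  qed
  from choice[OF this] obtain C where C': "\<forall>I. 0 \<le> C I \<and> (\<forall>w :: 'n R2n1 \<Rightarrow> real. smooth_on D' w \<longrightarrow>
    l2 D (X_multi I (\<lambda>x. \<psi> x * w (T x))) \<le> C I * (\<Sum>J\<in>?A (length I). l2 L' (X_multi J w)))" ..
  then have C: "\<And>I. 0 \<le> C I" "\<And>I (w :: 'n R2n1 \<Rightarrow> real). smooth_on D' w \<Longrightarrow>
    l2 D (X_multi I (\<lambda>x. \<psi> x * w (T x))) \<le> C I * (\<Sum>J\<in>?A (length I). l2 L' (X_multi J w))"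
    by simp_all
  have k: "0 \<le> kappa TYPE('n)" using kappa_pos[where 'n='n] by simp
  show ?thesis
  proof (rule that[of "kappa TYPE('n) * (\<Sum>I\<in>?A s. C I)"])
    show "0 \<le> kappa TYPE('n) * (\<Sum>I\<in>?A s. C I)" by (intro mult_nonneg_nonneg k sum_nonneg C)
    fix w :: "'n R2n1 \<Rightarrow> real" assume w: "smooth_on D' w"
    have "pre_norm s D (\<lambda>x. \<psi> x * w (T x)) \<le> kappa TYPE('n) * (\<Sum>I\<in>?A s. l2 D (X_multi I (\<lambda>x. \<psi> x * w (T x))))"
      by (rule pre_norm_le_sum[OF D smooth_closure_pullback[OF w]])
    also have "\<dots> \<le> kappa TYPE('n) * (\<Sum>I\<in>?A s. C I * (\<Sum>J\<in>?A s. l2 L' (X_multi J w)))"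
    proof (intro mult_left_mono sum_mono k)
      fix I assume I: "I \<in> ?A s"
      have "(\<Sum>J\<in>?A (length I). l2 L' (X_multi J w)) \<le> (\<Sum>J\<in>?A s. l2 L' (X_multi J w))"
        using I by (intro sum_mono2) auto
      then show "l2 D (X_multi I (\<lambda>x. \<psi> x * w (T x))) \<le> C I * (\<Sum>J\<in>?A s. l2 L' (X_multi J w))"
        using C(2)[OF w, of I] mult_left_mono[OF _ C(1)[of I]] order_trans by blast
    qed
    also have "\<dots> = kappa TYPE('n) * (\<Sum>I\<in>?A s. C I) * (\<Sum>J\<in>?A s. l2 L' (X_multi J w))"
      by (simp add: sum_distrib_right)
    finally show "pre_norm s D (\<lambda>x. \<psi> x * w (T x)) \<le> kappa TYPE('n) * (\<Sum>I\<in>?A s. C I) * (\<Sum>J\<in>?A s. l2 L' (X_multi J w))" .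
  qed
qed

lemma pre_norm_pullback_product:
  assumes t: "s div 2 + CARD('n) + 2 \<le> t"
  obtains C where "0 \<le> C" "\<And>u v :: 'n R2n1 \<Rightarrow> real. smooth_closure D' u \<Longrightarrow> smooth_closure D' v \<Longrightarrow>
    pre_norm s D (\<lambda>x. \<psi> x * (u (T x) * v (T x)))
      \<le> C * (pre_norm t D' u * pre_norm s D' v + pre_norm s D' u * pre_norm t D' v)"
proof -
  obtain C1 where C1: "0 \<le> C1" "\<And>w :: 'n R2n1 \<Rightarrow> real. smooth_on D' w \<Longrightarrow>
    pre_norm s D (\<lambda>x. \<psi> x * w (T x)) \<le> C1 * (\<Sum>J | length J \<le> s. l2 L' (X_multi J w))"
    by (rule pre_norm_pullback) blast
  obtain C2 where C2: "0 \<le> C2"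
    "\<And>(u :: 'n R2n1 \<Rightarrow> real) v I. smooth_closure D' u \<Longrightarrow> smooth_closure D' v \<Longrightarrow> length I \<le> s \<Longrightarrow>
      l2 L' (X_multi I (\<lambda>x. u x * v x)) \<le> C2 * (pre_norm t D' u * pre_norm s D' v + pre_norm s D' u * pre_norm t D' v)"
    by (rule interior_product_estimate[OF D' L' t]) blast
  define N where "N = real (card {J :: ('n + 'n) list. length J \<le> s})"
  show ?thesis
  proof (rule that[of "C1 * N * C2"])
    show "0 \<le> C1 * N * C2" using C1(1) C2(1) by (simp add: N_def)
    fix u v :: "'n R2n1 \<Rightarrow> real" assume u: "smooth_closure D' u" and v: "smooth_closure D' v"
    let ?E = "pre_norm t D' u * pre_norm s D' v + pre_norm s D' u * pre_norm t D' v"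
    have "smooth_on D' (\<lambda>x. u x * v x)" by (intro smooth_closure_smooth_on smooth_closure_mult u v)
    from C1(2)[OF this]
    have "pre_norm s D (\<lambda>x. \<psi> x * (u (T x) * v (T x))) \<le> C1 * (\<Sum>J | length J \<le> s. l2 L' (X_multi J (\<lambda>x. u x * v x)))" .
    also have "\<dots> \<le> C1 * (\<Sum>J\<in>{J :: ('n + 'n) list. length J \<le> s}. C2 * ?E)"
      using C2(2)[OF u v] by (intro mult_left_mono C1(1) sum_mono) simp
    also have "\<dots> = C1 * N * C2 * ?E" by (simp add: N_def)
    finally show "pre_norm s D (\<lambda>x. \<psi> x * (u (T x) * v (T x))) \<le> C1 * N * C2 * ?E" .
  qed
qed

end

section \<open>Products of representing sequences\<close>

lemma fs_represents_norm_bounded: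
  fixes D :: "'n::finite R2n1 set" and f :: "'n R2n1 \<Rightarrow> real"
  assumes "open D" "compact (closure D)" "fs_represents s D f u"
  obtains M where "0 < M" "\<And>k. pre_norm s D (u k) \<le> M"
proof -
  have "bounded (range (\<lambda>k. pre_norm s D (u k)))"
    using pre_norm_limit[OF assms] convergentI convergent_imp_bounded by blast
  then obtain M where "0 < M" "\<forall>y\<in>range (\<lambda>k. pre_norm s D (u k)). norm y \<le> M" unfolding bounded_pos by blast
  then have "pre_norm s D (u k) \<le> M" for k
    by (metis abs_ge_self order_trans rangeI real_norm_def)
  then show ?thesis using that[OF \<open>0 < M\<close>] by blast
qed

lemma uniform_limit_sum:
  fixes f :: "'i \<Rightarrow> 'n \<Rightarrow> 'a \<Rightarrow> real"
  assumes "\<And>i. i \<in> A \<Longrightarrow> uniform_limit S (f i) (g i) F"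
  shows "uniform_limit S (\<lambda>n x. \<Sum>i\<in>A. f i n x) (\<lambda>x. \<Sum>i\<in>A. g i x) F"
  using assms
  by (induction A rule: infinite_finite_induct) (auto intro: uniform_limit_add uniform_limit_const)

context chart_piece
begin

text \<open>\<open>u_k v_k - u_l v_l\<close> is written as
  \<open>(u_k - u_l) v_k + u_l (v_k - v_l)\<close>; the product estimate applies to both terms, and
  norms along a representing sequence are bounded. The norms of order \<open>t\<close> are absorbed
  into those of order \<open>s\<close>.\<close>

lemma product_cauchy:
  fixes f g :: "'n R2n1 \<Rightarrow> real"
  assumes t: "s div 2 + CARD('n) + 2 \<le> t" "t \<le> s"
    and u: "fs_represents s D' f u" and v: "fs_represents s D' g v" and e: "0 < e"
  obtains N where "\<And>k l. k \<ge> N \<Longrightarrow> l \<ge> N \<Longrightarrow>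
    pre_norm s D (\<lambda>x. \<psi> x * (u k (T x) * v k (T x)) - \<psi> x * (u l (T x) * v l (T x))) < e"
proof -
  note us = fs_representsD[OF D' u] and vs = fs_representsD[OF D' v]
  obtain C where C: "0 \<le> C" "\<And>u v :: 'n R2n1 \<Rightarrow> real. smooth_closure D' u \<Longrightarrow> smooth_closure D' v \<Longrightarrow>
    pre_norm s D (\<lambda>x. \<psi> x * (u (T x) * v (T x)))
      \<le> C * (pre_norm t D' u * pre_norm s D' v + pre_norm s D' u * pre_norm t D' v)"
    by (rule pre_norm_pullback_product[OF t(1)]) blast
  have C': "pre_norm s D (\<lambda>x. \<psi> x * (u (T x) * v (T x))) \<le> C * (2 * (pre_norm s D' u * pre_norm s D' v))"
    if "smooth_closure D' u" "smooth_closure D' v" for u v :: "'n R2n1 \<Rightarrow> real"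
  proof -
    have "pre_norm t D' u * pre_norm s D' v + pre_norm s D' u * pre_norm t D' v
      \<le> pre_norm s D' u * pre_norm s D' v + pre_norm s D' u * pre_norm s D' v"
      using that t(2) by (intro add_mono mult_mono pre_norm_mono[OF D'] pre_norm_nonneg[OF D']) auto
    then show ?thesis using C(2)[OF that] mult_left_mono[OF _ C(1)] by (smt (verit))
  qed
  obtain Mu where Mu: "0 < Mu" "\<And>k. pre_norm s D' (u k) \<le> Mu" by (rule fs_represents_norm_bounded[OF D' u]) blast
  obtain Mv where Mv: "0 < Mv" "\<And>k. pre_norm s D' (v k) \<le> Mv" by (rule fs_represents_norm_bounded[OF D' v]) blast
  \<comment> \<open>The two terms add up to at most \<open>2 * C * d * (Mu + Mv)\<close>;
    \<open>C + 1\<close> in place of \<open>C\<close> makes the inequality strict and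
    \<open>q\<close> positive.\<close>
  define q where "q = (C + 1) * (2 * (Mu + Mv))"
  have q: "0 < q" using C(1) Mu(1) Mv(1) by (simp add: q_def)
  define d where "d = e / q"
  have d: "0 < d" using e q by (simp add: d_def)
  obtain N1 where N1: "\<And>k l. k \<ge> N1 \<Longrightarrow> l \<ge> N1 \<Longrightarrow> pre_norm s D' (\<lambda>x. u k x - u l x) < d" using us(3)[OF d] by blast
  obtain N2 where N2: "\<And>k l. k \<ge> N2 \<Longrightarrow> l \<ge> N2 \<Longrightarrow> pre_norm s D' (\<lambda>x. v k x - v l x) < d" using vs(3)[OF d] by blast
  show ?thesis
  proof (rule that[of "max N1 N2"])
    fix k l assume "k \<ge> max N1 N2" "l \<ge> max N1 N2"
    then have kl: "k \<ge> N1" "l \<ge> N1" "k \<ge> N2" "l \<ge> N2" by auto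
    let ?du = "\<lambda>x. u k x - u l x" and ?dv = "\<lambda>x. v k x - v l x"
    have sd: "smooth_closure D' ?du" "smooth_closure D' ?dv" by (intro smooth_closure_diff us vs)+
    have sp: "smooth_closure D (\<lambda>x. \<psi> x * (p (T x) * q (T x)))"
      if "smooth_closure D' p" "smooth_closure D' q" for p q :: "'n R2n1 \<Rightarrow> real"
      using smooth_closure_pullback[OF smooth_closure_smooth_on[OF smooth_closure_mult[OF that]]] .
    have "(\<lambda>x. \<psi> x * (u k (T x) * v k (T x)) - \<psi> x * (u l (T x) * v l (T x)))
      = (\<lambda>x. \<psi> x * (?du (T x) * v k (T x)) + \<psi> x * (u l (T x) * ?dv (T x)))"
      by (auto simp: algebra_simps)
    then have "pre_norm s D (\<lambda>x. \<psi> x * (u k (T x) * v k (T x)) - \<psi> x * (u l (T x) * v l (T x)))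
      \<le> pre_norm s D (\<lambda>x. \<psi> x * (?du (T x) * v k (T x))) + pre_norm s D (\<lambda>x. \<psi> x * (u l (T x) * ?dv (T x)))"
      using pre_norm_add[OF D sp[OF sd(1) vs(1)[of k]] sp[OF us(1)[of l] sd(2)], of s] by simp
    also have "\<dots> \<le> C * (2 * (d * Mv)) + C * (2 * (Mu * d))"
    proof (intro add_mono)
      have "pre_norm s D' ?du * pre_norm s D' (v k) \<le> d * Mv"
        using N1[OF kl(1,2)] Mv d by (intro mult_mono pre_norm_nonneg[OF D'] vs) auto
      then show "pre_norm s D (\<lambda>x. \<psi> x * (?du (T x) * v k (T x))) \<le> C * (2 * (d * Mv))"
        by (intro order_trans[OF C'[OF sd(1) vs(1)[of k]]] mult_left_mono C(1)) simp_all
      have "pre_norm s D' (u l) * pre_norm s D' ?dv \<le> Mu * d"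
        using N2[OF kl(3,4)] Mu d by (intro mult_mono pre_norm_nonneg[OF D'] sd) auto
      then show "pre_norm s D (\<lambda>x. \<psi> x * (u l (T x) * ?dv (T x))) \<le> C * (2 * (Mu * d))"
        by (intro order_trans[OF C'[OF us(1)[of l] sd(2)]] mult_left_mono C(1)) simp_all
    qed
    also have "\<dots> = C * (2 * d * (Mu + Mv))" by (simp add: algebra_simps)
    also have "\<dots> < (C + 1) * (2 * d * (Mu + Mv))" using d Mu Mv by (intro mult_strict_right_mono) auto
    also have "\<dots> = q * d" by (simp add: q_def)
    also have "\<dots> = e" using q by (simp add: d_def)
    finally show "pre_norm s D (\<lambda>x. \<psi> x * (u k (T x) * v k (T x)) - \<psi> x * (u l (T x) * v l (T x))) < e" .
  qed
qed

text \<open>\<open>T\<close> carries the support of \<open>\<psi>\<close> into \<open>L'\<close>, on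
  which both sequences converge uniformly to bounded continuous functions. Their product, pulled
  back and weighted by the bounded \<open>\<psi>\<close>, is the limit.\<close>

lemma product_uniform:
  fixes f g :: "'n R2n1 \<Rightarrow> real"
  assumes s: "CARD('n) + 2 \<le> s" and u: "fs_represents s D' f u" and v: "fs_represents s D' g v"
  obtains G where "uniform_limit D (\<lambda>k x. \<psi> x * (u k (T x) * v k (T x))) G sequentially"
    "AE x in lebesgue. x \<in> D \<longrightarrow> \<psi> x * (f (T x) * g (T x)) = G x"
proof -
  obtain p where p: "uniform_limit L' u p sequentially" "continuous_on L' p" "AE x in lebesgue. x \<in> L' \<longrightarrow> f x = p x"
    by (rule fs_represents_uniform[OF D' L' u s])
  obtain q where q: "uniform_limit L' v q sequentially" "continuous_on L' q" "AE x in lebesgue. x \<in> L' \<longrightarrow> g x = q x"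
    by (rule fs_represents_uniform[OF D' L' v s])
  have "bounded (p ` L')" "bounded (q ` L')"
    using compact_imp_bounded compact_continuous_image p(2) q(2) L'(1) by blast+
  then have pq: "uniform_limit L' (\<lambda>k x. u k x * v k x) (\<lambda>x. p x * q x) sequentially"
    by (intro uniform_lim_mult p q)
  have "continuous_on (closure D) \<psi>"
    using smooth_on_imp_continuous_on[OF \<psi>(1)] V(2) continuous_on_subset by blast
  then have "bounded (\<psi> ` closure D)" using D(2) compact_imp_bounded compact_continuous_image by blast
  then obtain M where M: "0 < M" "\<And>x. x \<in> closure D \<Longrightarrow> \<bar>\<psi> x\<bar> \<le> M" unfolding bounded_pos by auto
  have off: "\<psi> x = 0" if "x \<in> D" "x \<notin> L" for x using \<psi>(2) V(2) closure_subset[of D] that by blast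
  show ?thesis
  proof (rule that[of "\<lambda>x. \<psi> x * (p (T x) * q (T x))"])
    show "uniform_limit D (\<lambda>k x. \<psi> x * (u k (T x) * v k (T x))) (\<lambda>x. \<psi> x * (p (T x) * q (T x))) sequentially"
      unfolding uniform_limit_iff
    proof (intro allI impI)
      fix e :: real assume e: "0 < e"
      then have "0 < e / M" using M by simp
      then have "\<forall>\<^sub>F k in sequentially. \<forall>x\<in>L'. dist (u k x * v k x) (p x * q x) < e / M"
        using pq unfolding uniform_limit_iff by blast
      then show "\<forall>\<^sub>F k in sequentially. \<forall>x\<in>D. dist (\<psi> x * (u k (T x) * v k (T x))) (\<psi> x * (p (T x) * q (T x))) < e"
      proof eventually_elim
        case (elim k)
        show ?case
        proof
          fix x assume x: "x \<in> D"
          show "dist (\<psi> x * (u k (T x) * v k (T x))) (\<psi> x * (p (T x) * q (T x))) < e"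
          proof (cases "x \<in> L")
            case True
            then have "T x \<in> L'" using TL by blast
            then have "dist (u k (T x) * v k (T x)) (p (T x) * q (T x)) < e / M" using elim by blast
            moreover have "\<bar>\<psi> x\<bar> \<le> M" using M(2) x closure_subset by blast
            ultimately have "\<bar>\<psi> x\<bar> * \<bar>u k (T x) * v k (T x) - p (T x) * q (T x)\<bar> \<le> M * \<bar>u k (T x) * v k (T x) - p (T x) * q (T x)\<bar>"
                and "M * \<bar>u k (T x) * v k (T x) - p (T x) * q (T x)\<bar> < M * (e / M)"
              using M(1) by (auto simp only: dist_real_def intro!: mult_right_mono mult_strict_left_mono)
            then show ?thesis using M(1) by (simp add: dist_real_def right_diff_distrib[symmetric] abs_mult)
          qed (use off x e in simp)
        qed
      qed
    qed
    \<comment> \<open>The agreement of \<open>f\<close> with \<open>p\<close> holds almost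
      everywhere on \<open>L'\<close>, which is the other side of \<open>T\<close>.\<close>
    have "AE x in lebesgue. x \<in> L \<longrightarrow> (T x \<in> L' \<longrightarrow> f (T x) = p (T x))"
      by (rule AE_compose[OF L(1) continuous_T B lip p(3)])
    moreover have "AE x in lebesgue. x \<in> L \<longrightarrow> (T x \<in> L' \<longrightarrow> g (T x) = q (T x))"
      by (rule AE_compose[OF L(1) continuous_T B lip q(3)])
    ultimately show "AE x in lebesgue. x \<in> D \<longrightarrow> \<psi> x * (f (T x) * g (T x)) = \<psi> x * (p (T x) * q (T x))"
    proof eventually_elim
      case (elim x)
      show ?case
      proof
        assume x: "x \<in> D"
        show "\<psi> x * (f (T x) * g (T x)) = \<psi> x * (p (T x) * q (T x))"
        proof (cases "x \<in> L")
          case True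
          then have "T x \<in> L'" using TL by blast
          then show ?thesis using elim True by simp
        qed (use off x in simp)
      qed
    qed
  qed
qed

end

lemma ex_uniform_bound:
  fixes N :: "'i \<Rightarrow> nat"
  assumes "finite A"
  obtains n where "\<And>i. i \<in> A \<Longrightarrow> N i \<le> n"
  using that[of "\<Sum>i\<in>A. N i"] member_le_sum[of _ A N] assms by auto

text \<open>\<open>f'\<close> and \<open>g'\<close> are the expressions of \<open>f\<close> and
  \<open>g\<close> in neighbouring charts. The product is approximated on \<open>D\<close> through
  the sequences on the regions \<open>D' i\<close>, in which the relevant points are interior;
  sequences on \<open>D\<close> itself would give nothing at its boundary. The estimate holds for
  the approximants and passes to the limit.\<close>

lemma glue_product:
  fixes D V :: "'n::finite R2n1 set" and A :: "'i set"
  assumes A: "finite A"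
    and piece: "\<And>i. i \<in> A \<Longrightarrow> chart_piece D V (W i) (L i) (D' i) (L' i) (T i) (B i) (\<psi> i)"
    and D: "open D" "compact (closure D)"
    and one: "\<And>x. x \<in> D \<Longrightarrow> (\<Sum>i\<in>A. \<psi> i x) = 1"
    and t: "s div 2 + CARD('n) + 2 \<le> t" "t \<le> s"
  obtains C where "0 \<le> C"
    "\<And>(f :: 'n R2n1 \<Rightarrow> real) g f' g' u v.
      set_borel_measurable dV0 D f \<Longrightarrow> set_borel_measurable dV0 D g \<Longrightarrow>
      (\<And>i x. i \<in> A \<Longrightarrow> x \<in> W i \<Longrightarrow> f x = f' i (T i x)) \<Longrightarrow>
      (\<And>i x. i \<in> A \<Longrightarrow> x \<in> W i \<Longrightarrow> g x = g' i (T i x)) \<Longrightarrow>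
      (\<And>i. i \<in> A \<Longrightarrow> fs_represents s (D' i) (f' i) (u i)) \<Longrightarrow>
      (\<And>i. i \<in> A \<Longrightarrow> fs_represents s (D' i) (g' i) (v i)) \<Longrightarrow>
      (\<lambda>x. f x * g x) \<in> Gamma_dom s D \<and>
      sqrt (inner_dom s D (\<lambda>x. f x * g x) (\<lambda>x. f x * g x)) \<le> C * (\<Sum>i\<in>A.
        sqrt (inner_dom t (D' i) (f' i) (f' i)) * sqrt (inner_dom s (D' i) (g' i) (g' i))
        + sqrt (inner_dom s (D' i) (f' i) (f' i)) * sqrt (inner_dom t (D' i) (g' i) (g' i)))"
proof -
  have "\<forall>i\<in>A. \<exists>C. 0 \<le> C \<and> (\<forall>u v :: 'n R2n1 \<Rightarrow> real. smooth_closure (D' i) u \<longrightarrow> smooth_closure (D' i) v \<longrightarrow>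
    pre_norm s D (\<lambda>x. \<psi> i x * (u (T i x) * v (T i x)))
      \<le> C * (pre_norm t (D' i) u * pre_norm s (D' i) v + pre_norm s (D' i) u * pre_norm t (D' i) v))"
  proof
    fix i assume i: "i \<in> A"
    show "\<exists>C. 0 \<le> C \<and> (\<forall>u v :: 'n R2n1 \<Rightarrow> real. smooth_closure (D' i) u \<longrightarrow> smooth_closure (D' i) v \<longrightarrow>
      pre_norm s D (\<lambda>x. \<psi> i x * (u (T i x) * v (T i x)))
      \<le> C * (pre_norm t (D' i) u * pre_norm s (D' i) v + pre_norm s (D' i) u * pre_norm t (D' i) v))"
      by (rule chart_piece.pre_norm_pullback_product[OF piece[OF i] t(1)]) blast
  qed
  from bchoice[OF this] obtain C where C': "\<forall>i\<in>A. 0 \<le> C i \<and> (\<forall>u v :: 'n R2n1 \<Rightarrow> real. smooth_closure (D' i) u \<longrightarrow> smooth_closure (D' i) v \<longrightarrow>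
    pre_norm s D (\<lambda>x. \<psi> i x * (u (T i x) * v (T i x)))
      \<le> C i * (pre_norm t (D' i) u * pre_norm s (D' i) v + pre_norm s (D' i) u * pre_norm t (D' i) v))" ..
  define C0 where "C0 = (\<Sum>i\<in>A. C i)"
  have C0: "0 \<le> C0" unfolding C0_def using C' by (intro sum_nonneg) auto
  have CC0: "C i \<le> C0" if "i \<in> A" for i
    unfolding C0_def using A C' that by (intro member_le_sum) auto
  have D': "open (D' i)" "compact (closure (D' i))" if "i \<in> A" for i
    using chart_piece.D'[OF piece[OF that]] by auto
  show ?thesis
  proof (rule that[OF C0])
    fix f g :: "'n R2n1 \<Rightarrow> real" and f' g' u v
    assume fm: "set_borel_measurable dV0 D f" and gm: "set_borel_measurable dV0 D g"
      and ff: "\<And>i x. i \<in> A \<Longrightarrow> x \<in> W i \<Longrightarrow> f x = f' i (T i x)"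
      and gg: "\<And>i x. i \<in> A \<Longrightarrow> x \<in> W i \<Longrightarrow> g x = g' i (T i x)"
      and u: "\<And>i. i \<in> A \<Longrightarrow> fs_represents s (D' i) (f' i) (u i)"
      and v: "\<And>i. i \<in> A \<Longrightarrow> fs_represents s (D' i) (g' i) (v i)"
    let ?p = "\<lambda>i k x. \<psi> i x * (u i k (T i x) * v i k (T i x))"
    \<comment> \<open>The representing sequence of \<open>f g\<close> on \<open>D\<close>. Each
      summand is smooth up to the boundary, and the weights add up to 1 on \<open>D\<close>.\<close>
    define P where "P = (\<lambda>k x. \<Sum>i\<in>A. ?p i k x)"
    note us = fs_representsD[OF D' u] and vs = fs_representsD[OF D' v]
    have sp: "smooth_closure D (?p i k)" if "i \<in> A" for i k
      using chart_piece.smooth_closure_pullback[OF piece[OF that] smooth_closure_smooth_on[OF smooth_closure_mult[OF us(1) vs(1)]], of k k] that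
      by simp
    have sP: "smooth_closure D (P k)" for k unfolding P_def by (intro smooth_closure_sum sp)
    have cauchy: "\<exists>N. \<forall>k\<ge>N. \<forall>l\<ge>N. pre_norm s D (\<lambda>x. P k x - P l x) < e" if e: "0 < e" for e
    proof -
      define d where "d = e / (card A + 1)"
      have d: "0 < d" using e by (simp add: d_def)
      have "\<forall>i\<in>A. \<exists>N. \<forall>k\<ge>N. \<forall>l\<ge>N. pre_norm s D (\<lambda>x. ?p i k x - ?p i l x) < d"
      proof
        fix i assume i: "i \<in> A"
        show "\<exists>N. \<forall>k\<ge>N. \<forall>l\<ge>N. pre_norm s D (\<lambda>x. ?p i k x - ?p i l x) < d"
          by (rule chart_piece.product_cauchy[OF piece[OF i] t u[OF i] v[OF i] d]) blast
      qed
      from bchoice[OF this] obtain N where N: "\<forall>i\<in>A. \<forall>k\<ge>N i. \<forall>l\<ge>N i. pre_norm s D (\<lambda>x. ?p i k x - ?p i l x) < d" ..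
      obtain n where n: "\<And>i. i \<in> A \<Longrightarrow> N i \<le> n" using ex_uniform_bound[OF A] by blast
      have "pre_norm s D (\<lambda>x. P k x - P l x) < e" if kl: "k \<ge> n" "l \<ge> n" for k l
      proof -
        have "pre_norm s D (\<lambda>x. P k x - P l x) = pre_norm s D (\<lambda>x. \<Sum>i\<in>A. ?p i k x - ?p i l x)"
          by (simp add: P_def sum_subtractf)
        also have "\<dots> \<le> (\<Sum>i\<in>A. pre_norm s D (\<lambda>x. ?p i k x - ?p i l x))"
          by (intro pre_norm_sum[OF D] smooth_closure_diff sp)
        also have "\<dots> \<le> (\<Sum>i\<in>A. d)"
          using N n kl order_trans by (intro sum_mono less_imp_le) blast
        also have "\<dots> = card A * d" by simp
        also have "\<dots> < (card A + 1) * d" using d by simp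
        also have "\<dots> = e" by (simp add: d_def)
        finally show ?thesis .
      qed
      then show ?thesis by blast
    qed
    have "\<forall>i\<in>A. \<exists>G. uniform_limit D (?p i) G sequentially \<and>
        (AE x in lebesgue. x \<in> D \<longrightarrow> \<psi> i x * (f' i (T i x) * g' i (T i x)) = G x)"
    proof
      fix i assume i: "i \<in> A"
      have "CARD('n) + 2 \<le> s" using t by simp
      then show "\<exists>G. uniform_limit D (?p i) G sequentially \<and>
        (AE x in lebesgue. x \<in> D \<longrightarrow> \<psi> i x * (f' i (T i x) * g' i (T i x)) = G x)"
        by (rule chart_piece.product_uniform[OF piece[OF i] _ u[OF i] v[OF i]]) blast
    qed
    from bchoice[OF this] obtain G where G: "\<forall>i\<in>A. uniform_limit D (?p i) (G i) sequentially \<and>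
        (AE x in lebesgue. x \<in> D \<longrightarrow> \<psi> i x * (f' i (T i x) * g' i (T i x)) = G i x)" ..
    have unif: "uniform_limit D P (\<lambda>x. \<Sum>i\<in>A. G i x) sequentially"
      unfolding P_def using G by (intro uniform_limit_sum) blast
    have "AE x in lebesgue. \<forall>i\<in>A. x \<in> D \<longrightarrow> \<psi> i x * (f' i (T i x) * g' i (T i x)) = G i x"
      using G by (intro AE_finite_allI A) blast
    then have ae: "AE x in lebesgue. x \<in> D \<longrightarrow> f x * g x = (\<Sum>i\<in>A. G i x)"
    proof eventually_elim
      case (elim x)
      show ?case
      proof
        assume x: "x \<in> D"
        have "f x * g x = (\<Sum>i\<in>A. \<psi> i x * (f x * g x))"
          using one[OF x] by (simp add: sum_distrib_right[symmetric])
        also have "\<dots> = (\<Sum>i\<in>A. G i x)"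
        proof (rule sum.cong[OF refl])
          fix i assume i: "i \<in> A"
          interpret chart_piece D V "W i" "L i" "D' i" "L' i" "T i" "B i" "\<psi> i" by (rule piece[OF i])
          show "\<psi> i x * (f x * g x) = G i x"
          \<comment> \<open>\<open>f\<close> is known to equal \<open>f' i \<circ> T i\<close> on
            \<open>W i\<close>, hence on \<open>L i\<close>; elsewhere in \<open>D\<close> the
            weight is 0.\<close>
          proof (cases "x \<in> L i")
            case True
            then show ?thesis using ff[OF i, of x] gg[OF i, of x] L(2) elim i x by force
          next
            case False
            then have "\<psi> i x = 0" using \<psi>(2) V(2) closure_subset[of D] x by blast
            moreover have "\<psi> i x * (f' i (T i x) * g' i (T i x)) = G i x" using elim i x by blast
            ultimately show ?thesis by simp
          qed
        qed
        finally show "f x * g x = (\<Sum>i\<in>A. G i x)" .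
      qed
    qed
    have fgm: "set_borel_measurable dV0 D (\<lambda>x. f x * g x)"
    proof -
      have "(\<lambda>x. (indicator D x *\<^sub>R f x) * (indicator D x *\<^sub>R g x)) \<in> borel_measurable dV0"
        using fm gm unfolding set_borel_measurable_def by (rule borel_measurable_times)
      moreover have "(\<lambda>x. (indicator D x *\<^sub>R f x) * (indicator D x *\<^sub>R g x)) = (\<lambda>x. indicator D x *\<^sub>R (f x * g x))"
        by (intro ext) (simp add: indicator_def)
      ultimately show ?thesis by (simp only: set_borel_measurable_def)
    qed
    have lim: "(\<lambda>k. \<integral>\<^sup>+x\<in>D. ennreal ((P k x - f x * g x)\<^sup>2) \<partial>dV0) \<longlonglongrightarrow> 0"
    proof -
      have "bounded D" using D(2) compact_imp_bounded bounded_subset closure_subset by blast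
      then have "D \<in> lmeasurable" using D(1) by (intro bounded_set_imp_lmeasurable) auto
      then have "(\<lambda>k. \<integral>\<^sup>+x\<in>D. ennreal ((P k x - (\<Sum>i\<in>A. G i x))\<^sup>2) \<partial>dV0) \<longlonglongrightarrow> 0"
        using D(1) by (intro nn_integral_uniform_limit unif emeasure_dV0_finite) auto
      moreover have "(\<integral>\<^sup>+x\<in>D. ennreal ((P k x - (\<Sum>i\<in>A. G i x))\<^sup>2) \<partial>dV0) = (\<integral>\<^sup>+x\<in>D. ennreal ((P k x - f x * g x)\<^sup>2) \<partial>dV0)" for k
      proof (rule nn_integral_cong_AE)
        have "AE x in dV0. x \<in> D \<longrightarrow> f x * g x = (\<Sum>i\<in>A. G i x)" using ae AE_dV0 by blast
        then show "AE x in dV0. ennreal ((P k x - (\<Sum>i\<in>A. G i x))\<^sup>2) * indicator D x = ennreal ((P k x - f x * g x)\<^sup>2) * indicator D x"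
          by eventually_elim (auto simp: indicator_def)
      qed
      ultimately show ?thesis by simp
    qed
    have rep: "fs_represents s D (\<lambda>x. f x * g x) P"
      unfolding fs_represents_def using sP cauchy fgm lim by simp
    have le: "pre_norm s D (P k) \<le> C0 * (\<Sum>i\<in>A. pre_norm t (D' i) (u i k) * pre_norm s (D' i) (v i k) + pre_norm s (D' i) (u i k) * pre_norm t (D' i) (v i k))" for k
    proof -
      have "pre_norm s D (P k) \<le> (\<Sum>i\<in>A. pre_norm s D (?p i k))"
        unfolding P_def by (intro pre_norm_sum[OF D] sp)
      also have "\<dots> \<le> (\<Sum>i\<in>A. C0 * (pre_norm t (D' i) (u i k) * pre_norm s (D' i) (v i k) + pre_norm s (D' i) (u i k) * pre_norm t (D' i) (v i k)))"
      proof (rule sum_mono)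
        fix i assume i: "i \<in> A"
        let ?E = "pre_norm t (D' i) (u i k) * pre_norm s (D' i) (v i k) + pre_norm s (D' i) (u i k) * pre_norm t (D' i) (v i k)"
        have "pre_norm s D (?p i k) \<le> C i * ?E" using C' i us(1)[OF i] vs(1)[OF i] by blast
        also have "\<dots> \<le> C0 * ?E"
          by (intro mult_right_mono CC0[OF i] add_nonneg_nonneg mult_nonneg_nonneg pre_norm_nonneg[OF D'[OF i]] us(1) vs(1) i)
        finally show "pre_norm s D (?p i k) \<le> C0 * ?E" .
      qed
      finally show ?thesis by (simp add: sum_distrib_left)
    qed
    have "(\<lambda>k. C0 * (\<Sum>i\<in>A. pre_norm t (D' i) (u i k) * pre_norm s (D' i) (v i k) + pre_norm s (D' i) (u i k) * pre_norm t (D' i) (v i k)))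
      \<longlonglongrightarrow> C0 * (\<Sum>i\<in>A. sqrt (inner_dom t (D' i) (f' i) (f' i)) * sqrt (inner_dom s (D' i) (g' i) (g' i))
        + sqrt (inner_dom s (D' i) (f' i) (f' i)) * sqrt (inner_dom t (D' i) (g' i) (g' i)))"
    proof (intro tendsto_mult_left tendsto_sum tendsto_add tendsto_mult)
      fix i assume i: "i \<in> A"
      show "(\<lambda>k. pre_norm s (D' i) (u i k)) \<longlonglongrightarrow> sqrt (inner_dom s (D' i) (f' i) (f' i))"
        "(\<lambda>k. pre_norm s (D' i) (v i k)) \<longlonglongrightarrow> sqrt (inner_dom s (D' i) (g' i) (g' i))"
        "(\<lambda>k. pre_norm t (D' i) (u i k)) \<longlonglongrightarrow> sqrt (inner_dom t (D' i) (f' i) (f' i))"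
        "(\<lambda>k. pre_norm t (D' i) (v i k)) \<longlonglongrightarrow> sqrt (inner_dom t (D' i) (g' i) (g' i))"
        by (rule pre_norm_limit[OF D'[OF i] u[OF i]] pre_norm_limit[OF D'[OF i] v[OF i]]
            pre_norm_limit[OF D'[OF i] fs_represents_mono[OF D'[OF i] u[OF i] t(2)]]
            pre_norm_limit[OF D'[OF i] fs_represents_mono[OF D'[OF i] v[OF i] t(2)]])+
    qed
    from LIMSEQ_le[OF pre_norm_limit[OF D rep] this] le rep
    show "(\<lambda>x. f x * g x) \<in> Gamma_dom s D \<and>
      sqrt (inner_dom s D (\<lambda>x. f x * g x) (\<lambda>x. f x * g x)) \<le> C0 * (\<Sum>i\<in>A.
        sqrt (inner_dom t (D' i) (f' i) (f' i)) * sqrt (inner_dom s (D' i) (g' i) (g' i))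
        + sqrt (inner_dom s (D' i) (f' i) (f' i)) * sqrt (inner_dom t (D' i) (g' i) (g' i)))"
      unfolding Gamma_dom_def by blast
  qed
qed

section \<open>Pieces of an adapted atlas\<close>

text \<open>The derivative is bounded on the compact set, and convexity permits the mean value
  inequality. Applied to the inverse of a transition map, it supplies the constant \<open>B\<close>
  of a chart piece.\<close>

lemma smooth_on_lipschitz:
  fixes S :: "'e::euclidean_space \<Rightarrow> 'b::real_normed_vector"
  assumes S: "open U" "smooth_on U S" and K: "compact K" "convex K" "K \<subseteq> U"
  obtains B where "0 < B" "\<And>x y. x \<in> K \<Longrightarrow> y \<in> K \<Longrightarrow> dist (S x) (S y) \<le> B * dist x y"
proof -
  have "continuous_on K (\<lambda>x. \<Sum>b\<in>Basis. norm (frechet_derivative S (at x) b))"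
    using continuous_on_subset[OF smooth_on_imp_continuous_on[OF smooth_on_frechet_derivative[OF S(2)]] K(3)]
    by (intro continuous_on_sum continuous_on_norm)
  then have "bounded ((\<lambda>x. \<Sum>b\<in>Basis. norm (frechet_derivative S (at x) b)) ` K)"
    using K(1) compact_imp_bounded compact_continuous_image by blast
  then obtain B where B: "0 < B" "\<And>x. x \<in> K \<Longrightarrow> \<bar>\<Sum>b\<in>Basis. norm (frechet_derivative S (at x) b)\<bar> \<le> B"
    unfolding bounded_pos by auto
  have hd: "(S has_derivative frechet_derivative S (at x)) (at x within K)" if "x \<in> K" for x
    using smooth_on_imp_has_derivative[OF S(2), of x] K(3) that by (auto intro: has_derivative_at_withinI)
  have on: "onorm (frechet_derivative S (at x)) \<le> B" if x: "x \<in> K" for x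
  proof (rule onorm_le)
    fix v
    have lin: "linear (frechet_derivative S (at x))"
      using has_derivative_linear[OF hd[OF x]] .
    have "frechet_derivative S (at x) v = frechet_derivative S (at x) (\<Sum>b\<in>Basis. (v \<bullet> b) *\<^sub>R b)"
      by (simp add: euclidean_representation)
    also have "\<dots> = (\<Sum>b\<in>Basis. (v \<bullet> b) *\<^sub>R frechet_derivative S (at x) b)"
      by (simp add: linear_sum[OF lin] linear_scale[OF lin])
    finally have "norm (frechet_derivative S (at x) v) \<le> (\<Sum>b\<in>Basis. norm ((v \<bullet> b) *\<^sub>R frechet_derivative S (at x) b))"
      by (simp only: norm_sum)
    also have "\<dots> \<le> (\<Sum>b\<in>Basis. norm (frechet_derivative S (at x) b) * norm v)"
      by (intro sum_mono) (simp add: Basis_le_norm mult.commute mult_right_mono)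
    also have "\<dots> \<le> B * norm v"
      unfolding sum_distrib_right[symmetric] using B(2)[OF x] by (intro mult_right_mono) auto
    finally show "norm (frechet_derivative S (at x) v) \<le> B * norm v" .
  qed
  have "dist (S x) (S y) \<le> B * dist x y" if "x \<in> K" "y \<in> K" for x y
    using differentiable_bound[OF K(2) hd on that] by (simp add: dist_norm)
  then show ?thesis using that B(1) by blast
qed

section \<open>Charts and transition maps\<close>

lemma chart_inv_map:
  assumes "is_chart M c" "p \<in> chart_dom c"
  shows "chart_inv c (chart_map c p) = p"
proof -
  have "topspace (subtopology M (chart_dom c)) = chart_dom c"
    using assms(1) openin_subset unfolding is_chart_def by fastforce
  then have "inj_on (chart_map c) (chart_dom c)"
    using assms(1) homeomorphic_imp_injective_map unfolding is_chart_def by metis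
  then show ?thesis using assms(2) by (simp add: chart_inv_def)
qed

lemma chart_map_inv:
  assumes "x \<in> chart_img c"
  shows "chart_map c (chart_inv c x) = x" "chart_inv c x \<in> chart_dom c"
  using assms f_inv_into_f[of x "chart_map c" "chart_dom c"] inv_into_into[of x "chart_map c" "chart_dom c"]
  by (auto simp: chart_img_def chart_inv_def)

lemma overlap_eq:
  assumes "is_chart M c"
  shows "x \<in> overlap c d \<longleftrightarrow> x \<in> chart_img c \<and> chart_inv c x \<in> chart_dom d"
  using chart_inv_map[OF assms] by (auto simp: overlap_def chart_img_def)

lemma open_overlap:
  assumes c: "is_chart M c" and d: "is_chart M d"
  shows "open (overlap c d)"
proof -
  have 1: "openin (subtopology M (chart_dom c)) (chart_dom c \<inter> chart_dom d)"
    using c d unfolding is_chart_def by (metis inf_commute openin_Int openin_subtopology)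
  then have "openin (top_of_set (chart_img c)) (overlap c d)"
    using c homeomorphic_map_openness[of "subtopology M (chart_dom c)" "top_of_set (chart_img c)" "chart_map c"] openin_subset[OF 1]
    unfolding is_chart_def overlap_def by blast
  then show ?thesis using c openin_open_eq unfolding is_chart_def by blast
qed

lemma transition_inverse:
  assumes c: "is_chart M c" and d: "is_chart M d" and x: "x \<in> overlap c d"
  shows "transition d c (transition c d x) = x" "transition c d x \<in> overlap d c"
    "chart_inv d (transition c d x) = chart_inv c x"
proof -
  have p: "chart_inv c x \<in> chart_dom c" "chart_inv c x \<in> chart_dom d" "chart_map c (chart_inv c x) = x"
    using x chart_map_inv[of x c] overlap_eq[OF c, of x d] by blast+
  then show "transition d c (transition c d x) = x" "chart_inv d (transition c d x) = chart_inv c x"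
    using chart_inv_map[OF d] by (auto simp: transition_def)
  show "transition c d x \<in> overlap d c"
    using p by (auto simp: transition_def overlap_def)
qed

text \<open>Adaptedness of both charts, read in the chart \<open>c\<close>, shows that the pullbacks
  of \<open>eta0\<close> by \<open>transition c d\<close> and by \<open>transition c c\<close> are
  the same form \<open>\<eta> c\<close>; the second map is the identity where it is defined.\<close>

lemma transition_contact:
  assumes m: "compact_contact_manifold M \<A> \<eta>" and c: "adapted_chart \<A> \<eta> c" and d: "adapted_chart \<A> \<eta> d"
    and x: "x \<in> overlap c d"
  shows "eta0 (transition c d x) (frechet_derivative (transition c d) (at x) v) = eta0 x v"
proof -
  interpret compact_contact_manifold M \<A> \<eta> by (rule m)
  have cA: "c \<in> \<A>" "d \<in> \<A>" using c d by (auto simp: adapted_chart_def)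
  have xc: "x \<in> overlap c c" using x chart_map_inv[of x c] by (simp add: overlap_eq[OF charts[OF cA(1)]])
  have oc: "open (overlap c c)" by (rule open_overlap[OF charts[OF cA(1)] charts[OF cA(1)]])
  have id: "transition c c y = y" if "y \<in> overlap c c" for y
    using that chart_map_inv[of y c] by (simp add: overlap_eq[OF charts[OF cA(1)]] transition_def)
  have D: "frechet_derivative (transition c c) (at x) v = v"
    using frechet_derivative_cong_open[OF oc xc id] by (simp add: frechet_derivative_ident)
  have "pullback (transition c d) eta0 x v = pullback (transition c c) eta0 x v"
    using c d cA x xc by (simp add: adapted_chart_def)
  then show ?thesis by (simp add: pullback_def id[OF xc] D)
qed

lemma ex_pieces:
  fixes M :: "'a topology" and \<A> :: "('a, 'n::finite R2n1) chart set" and \<phi> :: "'k \<Rightarrow> ('a, 'n R2n1) chart"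
  assumes m: "compact_contact_manifold M \<A> \<eta>" and at: "adapted_atlas M \<A> \<eta> K \<phi> D" and \<alpha>: "\<alpha> \<in> K"
  obtains A :: "'n R2n1 set" and \<beta> V W L L' T B \<psi> where "finite A" "\<And>i. i \<in> A \<Longrightarrow> \<beta> i \<in> K"
    "\<And>i. i \<in> A \<Longrightarrow> chart_piece (D \<alpha>) V (W i) (L i) (D (\<beta> i)) (L' i) (T i) (B i) (\<psi> i)"
    "\<And>x. x \<in> D \<alpha> \<Longrightarrow> (\<Sum>i\<in>A. \<psi> i x) = 1"
    "\<And>i x. i \<in> A \<Longrightarrow> x \<in> W i \<Longrightarrow> chart_inv (\<phi> \<alpha>) x = chart_inv (\<phi> (\<beta> i)) (T i x)"
proof -
  interpret compact_contact_manifold M \<A> \<eta> by (rule m)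
  have ad: "adapted_chart \<A> \<eta> (\<phi> \<gamma>)" "open (D \<gamma>)" "compact (closure (D \<gamma>))" "closure (D \<gamma>) \<subseteq> chart_img (\<phi> \<gamma>)"
    if "\<gamma> \<in> K" for \<gamma>
    using at that unfolding adapted_atlas_def by auto
  have inA: "\<phi> \<gamma> \<in> \<A>" and chart: "is_chart M (\<phi> \<gamma>)" if "\<gamma> \<in> K" for \<gamma>
    using ad(1)[OF that] charts by (auto simp: adapted_chart_def)
  \<comment> \<open>The data attached to a centre \<open>x\<close>: a region, a ball that becomes
    the set \<open>L\<close> of the piece, its target \<open>L'\<close> and the Lipschitz constant.
    Bundling them allows a single choice.\<close>
  define P where "P = (\<lambda>x \<beta> e L' B. \<beta> \<in> K \<and> 0 < e \<and> cball x e \<subseteq> {y \<in> overlap (\<phi> \<alpha>) (\<phi> \<beta>). transition (\<phi> \<alpha>) (\<phi> \<beta>) y \<in> D \<beta>}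
      \<and> compact L' \<and> L' \<subseteq> D \<beta> \<and> transition (\<phi> \<alpha>) (\<phi> \<beta>) ` cball x e \<subseteq> L' \<and> (0::real) < B \<and>
      (\<forall>y\<in>cball x e. \<forall>z\<in>cball x e. dist y z \<le> B * dist (transition (\<phi> \<alpha>) (\<phi> \<beta>) y) (transition (\<phi> \<alpha>) (\<phi> \<beta>) z)))"
  have Wopen: "open {y \<in> overlap (\<phi> \<alpha>) (\<phi> \<beta>). transition (\<phi> \<alpha>) (\<phi> \<beta>) y \<in> X}"
    if "\<beta> \<in> K" "open X" for \<beta> X
  proof -
    have "continuous_on (overlap (\<phi> \<alpha>) (\<phi> \<beta>)) (transition (\<phi> \<alpha>) (\<phi> \<beta>))"
      using compat[OF inA[OF \<alpha>] inA[OF that(1)]] unfolding compatible_def by (blast intro: smooth_on_imp_continuous_on)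
    then have "open (overlap (\<phi> \<alpha>) (\<phi> \<beta>) \<inter> transition (\<phi> \<alpha>) (\<phi> \<beta>) -` X)"
      using continuous_on_open_vimage[OF open_overlap[OF chart[OF \<alpha>] chart[OF that(1)]]] that(2)
      by (metis inf_commute)
    moreover have "overlap (\<phi> \<alpha>) (\<phi> \<beta>) \<inter> transition (\<phi> \<alpha>) (\<phi> \<beta>) -` X = {y \<in> overlap (\<phi> \<alpha>) (\<phi> \<beta>). transition (\<phi> \<alpha>) (\<phi> \<beta>) y \<in> X}"
      by auto
    ultimately show ?thesis by simp
  qed
  have "\<exists>\<beta> e L' B. P x \<beta> e L' B" if x: "x \<in> closure (D \<alpha>)" for x
  proof -
    have xi: "x \<in> chart_img (\<phi> \<alpha>)" using ad(4)[OF \<alpha>] x by blast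
    have dom: "chart_inv (\<phi> \<alpha>) x \<in> chart_dom (\<phi> \<alpha>)" by (rule chart_map_inv(2)[OF xi])
    have "chart_dom (\<phi> \<alpha>) \<subseteq> topspace M"
      using chart[OF \<alpha>] openin_subset unfolding is_chart_def by blast
    then have "chart_inv (\<phi> \<alpha>) x \<in> (\<Union>\<beta>\<in>K. chart_inv (\<phi> \<beta>) ` D \<beta>)"
      using dom at unfolding adapted_atlas_def by blast
    then obtain \<beta> y where b: "\<beta> \<in> K" "y \<in> D \<beta>" "chart_inv (\<phi> \<alpha>) x = chart_inv (\<phi> \<beta>) y" by blast
    have yi: "y \<in> chart_img (\<phi> \<beta>)" using ad(4)[OF b(1)] b(2) closure_subset by blast
    let ?T = "transition (\<phi> \<alpha>) (\<phi> \<beta>)" and ?S = "transition (\<phi> \<beta>) (\<phi> \<alpha>)"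
    let ?O = "overlap (\<phi> \<alpha>) (\<phi> \<beta>)" and ?O' = "overlap (\<phi> \<beta>) (\<phi> \<alpha>)"
    have Tx: "?T x = y" using b(3) chart_map_inv(1)[OF yi] by (simp add: transition_def)
    have xO: "x \<in> ?O" unfolding overlap_eq[OF chart[OF \<alpha>]] using xi b(3) chart_map_inv(2)[OF yi] by simp
    have yO: "y \<in> ?O'" using transition_inverse(2)[OF chart[OF \<alpha>] chart[OF b(1)] xO] Tx by simp
    have oO': "open ?O'" by (rule open_overlap[OF chart[OF b(1)] chart[OF \<alpha>]])
    then have "open (D \<beta> \<inter> ?O')" using ad(2)[OF b(1)] by blast
    \<comment> \<open>The ball is chosen on the target side first: it is convex, so the inverse
      transition is Lipschitz on it, and it becomes \<open>L'\<close>. The ball around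
      \<open>x\<close> is then shrunk until the transition maps it there.\<close>
    then obtain \<rho> where \<rho>: "0 < \<rho>" "cball y \<rho> \<subseteq> D \<beta> \<inter> ?O'" using b(2) yO open_contains_cball by (metis IntI)
    have sS: "smooth_on ?O' ?S" using compat[OF inA[OF \<alpha>] inA[OF b(1)]] by (simp add: compatible_def)
    have cK: "cball y \<rho> \<subseteq> ?O'" using \<rho>(2) by blast
    obtain B where B: "0 < B" "\<And>p q. p \<in> cball y \<rho> \<Longrightarrow> q \<in> cball y \<rho> \<Longrightarrow> dist (?S p) (?S q) \<le> B * dist p q"
      by (rule smooth_on_lipschitz[OF oO' sS compact_cball convex_cball cK]) blast
    have "open {z \<in> ?O. ?T z \<in> ball y \<rho>}" by (rule Wopen[OF b(1) open_ball])
    moreover have "x \<in> {z \<in> ?O. ?T z \<in> ball y \<rho>}" using xO Tx \<rho>(1) by simp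
    ultimately obtain e where e: "0 < e" "cball x e \<subseteq> {z \<in> ?O. ?T z \<in> ball y \<rho>}"
      using open_contains_cball by meson
    have S: "?S (?T z) = z" if "z \<in> cball x e" for z
      using transition_inverse(1)[OF chart[OF \<alpha>] chart[OF b(1)]] e(2) that by blast
    have TL: "?T z \<in> cball y \<rho>" if "z \<in> cball x e" for z using e(2) that by auto
    have "dist p q \<le> B * dist (?T p) (?T q)" if "p \<in> cball x e" "q \<in> cball x e" for p q
      using B(2)[OF TL[OF that(1)] TL[OF that(2)]] S that by simp
    then have "P x \<beta> e (cball y \<rho>) B"
      unfolding P_def using b(1) e B(1) \<rho>(2) TL by auto
    then show ?thesis by blast
  qed
  then obtain \<beta> e L' B where P: "\<And>x. x \<in> closure (D \<alpha>) \<Longrightarrow> P x (\<beta> x) (e x) (L' x) (B x)" by metis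
  have e: "0 < e x" if "x \<in> closure (D \<alpha>)" for x using P[OF that] by (simp add: P_def)
  have "\<forall>x\<in>closure (D \<alpha>). \<exists>f. smooth_on UNIV f \<and> (\<forall>y. 0 \<le> f y) \<and> (\<forall>y\<in>ball x (e x). 0 < f y) \<and>
           (\<forall>y. y \<notin> cball x (e x) \<longrightarrow> f y = (0::real))"
    using ex_bump[OF e] by blast
  from bchoice[OF this] obtain f where f: "\<forall>x\<in>closure (D \<alpha>). smooth_on UNIV (f x) \<and> (\<forall>y. 0 \<le> f x y) \<and>
     (\<forall>y\<in>ball x (e x). 0 < f x y) \<and> (\<forall>y. y \<notin> cball x (e x) \<longrightarrow> f x y = (0::real))" ..
  have cov: "closure (D \<alpha>) \<subseteq> (\<Union>x\<in>closure (D \<alpha>). ball x (e x))" using e by fastforce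
  obtain A where A: "A \<subseteq> closure (D \<alpha>)" "finite A" "closure (D \<alpha>) \<subseteq> (\<Union>x\<in>A. ball x (e x))"
    by (rule compactE_image[OF ad(3)[OF \<alpha>] open_ball cov])
  define s where "s = (\<lambda>y. \<Sum>x\<in>A. f x y)"
  have ss: "smooth_on UNIV s" unfolding s_def using f A by (intro smooth_on_sum) auto
  \<comment> \<open>On \<open>V\<close> the sum can be inverted. \<open>V\<close> is open and
    contains the closure of \<open>D \<alpha>\<close>, so the normalised weights are smooth up to
    the boundary.\<close>
  define V where "V = {y. 0 < s y}"
  have oV: "open V" unfolding V_def
    using smooth_on_imp_continuous_on[OF ss] by (intro open_Collect_less continuous_on_const)
  have cV: "closure (D \<alpha>) \<subseteq> V"
  proof
    fix y assume "y \<in> closure (D \<alpha>)"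
    then obtain x where x: "x \<in> A" "y \<in> ball x (e x)" using A(3) by blast
    then have "0 < f x y" using f A(1) by blast
    moreover have "0 \<le> f z y" if "z \<in> A" for z using f A(1) that by blast
    ultimately show "y \<in> V" unfolding V_def s_def mem_Collect_eq by (intro sum_pos2[OF A(2) x(1)])
  qed
  define \<psi> where "\<psi> = (\<lambda>x y. f x y * inverse (s y))"
  have s\<psi>: "smooth_on V (\<psi> x)" if "x \<in> A" for x
  proof -
    have "smooth_on V (\<lambda>y. inverse (s y))"
      by (rule smooth_on_compose[OF oV open_greaterThan _ smooth_on_subset[OF ss] smooth_on_inverse_pos])
        (auto simp: V_def)
    moreover have "smooth_on V (f x)" using f A that smooth_on_subset by blast
    ultimately show ?thesis unfolding \<psi>_def by (intro smooth_on_mult oV)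
  qed
  let ?W = "\<lambda>x. {y \<in> overlap (\<phi> \<alpha>) (\<phi> (\<beta> x)). transition (\<phi> \<alpha>) (\<phi> (\<beta> x)) y \<in> D (\<beta> x)}"
  show ?thesis
  proof (rule that[of A \<beta> V ?W "\<lambda>x. cball x (e x)" L' "\<lambda>x. transition (\<phi> \<alpha>) (\<phi> (\<beta> x))" B \<psi>])
    show "finite A" by (rule A)
    show bK: "\<beta> i \<in> K" if "i \<in> A" for i using P[of i] A(1) that by (auto simp: P_def)
    show "chart_piece (D \<alpha>) V (?W i) (cball i (e i)) (D (\<beta> i)) (L' i) (transition (\<phi> \<alpha>) (\<phi> (\<beta> i))) (B i) (\<psi> i)"
      if i: "i \<in> A" for i
    proof -
      have Pi: "P i (\<beta> i) (e i) (L' i) (B i)" using P A(1) i by blast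
      show ?thesis
      proof
        show "open (?W i)" by (rule Wopen[OF bK[OF i] ad(2)[OF bK[OF i]]])
        show "smooth_on (?W i) (transition (\<phi> \<alpha>) (\<phi> (\<beta> i)))"
          using compat[OF inA[OF \<alpha>] inA[OF bK[OF i]]] unfolding compatible_def by (blast intro: smooth_on_subset)
        show "eta0 (transition (\<phi> \<alpha>) (\<phi> (\<beta> i)) x) (frechet_derivative (transition (\<phi> \<alpha>) (\<phi> (\<beta> i))) (at x) v) = eta0 x v"
          if "x \<in> ?W i" for x v
          using that by (intro transition_contact[OF m ad(1)[OF \<alpha>] ad(1)[OF bK[OF i]]]) simp
        show "\<psi> i x = 0" if "x \<in> V" "x \<notin> cball i (e i)" for x
        proof -
          have "f i x = 0" using f i A(1) that(2) by blast
          then show ?thesis by (simp add: \<psi>_def)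
        qed
      qed (use Pi ad[OF \<alpha>] ad[OF bK[OF i]] oV cV s\<psi>[OF i] in \<open>auto simp: P_def\<close>)
    qed
    show "(\<Sum>i\<in>A. \<psi> i x) = 1" if "x \<in> D \<alpha>" for x
    proof -
      have "0 < s x" using cV closure_subset[of "D \<alpha>"] that by (auto simp: V_def)
      moreover have "(\<Sum>i\<in>A. \<psi> i x) = s x * inverse (s x)"
        unfolding \<psi>_def sum_distrib_right[symmetric] s_def ..
      ultimately show ?thesis by simp
    qed
    show "chart_inv (\<phi> \<alpha>) x = chart_inv (\<phi> (\<beta> i)) (transition (\<phi> \<alpha>) (\<phi> (\<beta> i)) x)"
      if "i \<in> A" "x \<in> ?W i" for i x
      using transition_inverse(3)[OF chart[OF \<alpha>] chart[OF bK[OF that(1)]], of x] that(2) by simp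
  qed
qed

section \<open>The product estimates on the manifold\<close>

abbreviation chart_norm :: "('k \<Rightarrow> ('a, 'n::finite R2n1) chart) \<Rightarrow> ('k \<Rightarrow> 'n R2n1 set) \<Rightarrow> nat \<Rightarrow> ('a \<Rightarrow> real) \<Rightarrow> 'k \<Rightarrow> real" where
  "chart_norm \<phi> D s f \<alpha> \<equiv> sqrt (inner_dom s (D \<alpha>) (f \<circ> chart_inv (\<phi> \<alpha>)) (f \<circ> chart_inv (\<phi> \<alpha>)))"

context
  fixes M :: "'a topology" and \<A> :: "('a, 'n::finite R2n1) chart set" and \<eta> :: "('a, 'n R2n1) form1"
    and K :: "'k set" and \<phi> :: "'k \<Rightarrow> ('a, 'n R2n1) chart" and D :: "'k \<Rightarrow> 'n R2n1 set"
  assumes man: "compact_contact_manifold M \<A> \<eta>" and atlas: "adapted_atlas M \<A> \<eta> K \<phi> D"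
begin

lemma finite_K: "finite K"
  using atlas by (simp add: adapted_atlas_def)

lemma region: "\<alpha> \<in> K \<Longrightarrow> open (D \<alpha>)" "\<alpha> \<in> K \<Longrightarrow> compact (closure (D \<alpha>))"
  using atlas by (auto simp: adapted_atlas_def)

lemma Gamma_man_represents:
  fixes f :: "'a \<Rightarrow> real"
  assumes "f \<in> Gamma_man K \<phi> D s" "\<alpha> \<in> K"
  obtains u where "fs_represents s (D \<alpha>) (f \<circ> chart_inv (\<phi> \<alpha>)) u"
  using assms unfolding Gamma_man_def Gamma_dom_def by blast

lemma chart_norm_nonneg:
  assumes "f \<in> Gamma_man K \<phi> D s" "\<alpha> \<in> K"
  shows "0 \<le> chart_norm \<phi> D s f \<alpha>"
  using Gamma_man_represents[OF assms] inner_dom_nonneg[OF region[OF assms(2)]] by metis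

lemma norm_man_eq:
  fixes f :: "'a \<Rightarrow> real"
  assumes "f \<in> Gamma_man K \<phi> D s"
  shows "norm_man K \<phi> D s f = L2_set (chart_norm \<phi> D s f) K"
proof -
  have "inner_man K \<phi> D s f f = (\<Sum>\<alpha>\<in>K. (chart_norm \<phi> D s f \<alpha>)\<^sup>2)"
    unfolding inner_man_def using chart_norm_nonneg[OF assms] by (intro sum.cong) auto
  then show ?thesis by (simp add: norm_man_def L2_set_def)
qed

lemma norm_man_nonneg:
  fixes f :: "'a \<Rightarrow> real"
  shows "f \<in> Gamma_man K \<phi> D s \<Longrightarrow> 0 \<le> norm_man K \<phi> D s f"
  by (simp add: norm_man_eq L2_set_nonneg)

lemma chart_norm_le:
  fixes f :: "'a \<Rightarrow> real"
  assumes "f \<in> Gamma_man K \<phi> D s" "\<alpha> \<in> K"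
  shows "chart_norm \<phi> D s f \<alpha> \<le> norm_man K \<phi> D s f"
  unfolding norm_man_eq[OF assms(1)] by (intro member_le_L2_set finite_K assms)

text \<open>A sequence representing \<open>f\<close> to order \<open>s\<close> also represents it to
  order \<open>t\<close>, and the comparison of norms passes to the limit.\<close>

lemma Gamma_man_mono:
  fixes f :: "'a \<Rightarrow> real"
  assumes f: "f \<in> Gamma_man K \<phi> D s" and t: "t \<le> s"
  shows "f \<in> Gamma_man K \<phi> D t" "norm_man K \<phi> D t f \<le> norm_man K \<phi> D s f"
proof -
  have *: "f \<circ> chart_inv (\<phi> \<alpha>) \<in> Gamma_dom t (D \<alpha>) \<and> chart_norm \<phi> D t f \<alpha> \<le> chart_norm \<phi> D s f \<alpha>"
    if \<alpha>: "\<alpha> \<in> K" for \<alpha>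
  proof -
    obtain u where u: "fs_represents s (D \<alpha>) (f \<circ> chart_inv (\<phi> \<alpha>)) u" by (rule Gamma_man_represents[OF f \<alpha>])
    note ut = fs_represents_mono[OF region[OF \<alpha>] u t]
    have "pre_norm t (D \<alpha>) (u k) \<le> pre_norm s (D \<alpha>) (u k)" for k
      by (rule pre_norm_mono[OF region[OF \<alpha>] fs_representsD(1)[OF region[OF \<alpha>] u] t])
    then have "chart_norm \<phi> D t f \<alpha> \<le> chart_norm \<phi> D s f \<alpha>"
      by (intro LIMSEQ_le[OF pre_norm_limit[OF region[OF \<alpha>] ut] pre_norm_limit[OF region[OF \<alpha>] u]]) blast
    then show ?thesis using ut unfolding Gamma_dom_def by blast
  qed
  then show ft: "f \<in> Gamma_man K \<phi> D t" by (simp add: Gamma_man_def)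
  show "norm_man K \<phi> D t f \<le> norm_man K \<phi> D s f"
    unfolding norm_man_eq[OF ft] norm_man_eq[OF f]
    using * chart_norm_nonneg[OF ft] by (intro L2_set_mono) auto
qed

lemma chart_product_estimate:
  assumes t: "s div 2 + CARD('n) + 2 \<le> t" "t \<le> s" and \<alpha>: "\<alpha> \<in> K"
  obtains C where "0 \<le> C" "\<And>f g :: 'a \<Rightarrow> real. f \<in> Gamma_man K \<phi> D s \<Longrightarrow> g \<in> Gamma_man K \<phi> D s \<Longrightarrow>
    (\<lambda>x. f x * g x) \<circ> chart_inv (\<phi> \<alpha>) \<in> Gamma_dom s (D \<alpha>) \<and>
    chart_norm \<phi> D s (\<lambda>x. f x * g x) \<alpha>
      \<le> C * (norm_man K \<phi> D t f * norm_man K \<phi> D s g + norm_man K \<phi> D s f * norm_man K \<phi> D t g)"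
proof -
  obtain A :: "'n R2n1 set" and \<beta> V W L L' T B \<psi> where A: "finite A" "\<And>i. i \<in> A \<Longrightarrow> \<beta> i \<in> K"
    "\<And>i. i \<in> A \<Longrightarrow> chart_piece (D \<alpha>) V (W i) (L i) (D (\<beta> i)) (L' i) (T i) (B i) (\<psi> i)"
    "\<And>x. x \<in> D \<alpha> \<Longrightarrow> (\<Sum>i\<in>A. \<psi> i x) = 1"
    "\<And>i x. i \<in> A \<Longrightarrow> x \<in> W i \<Longrightarrow> chart_inv (\<phi> \<alpha>) x = chart_inv (\<phi> (\<beta> i)) (T i x)"
    by (rule ex_pieces[OF man atlas \<alpha>]) blast
  obtain C where C: "0 \<le> C"
    "\<And>(f :: 'n R2n1 \<Rightarrow> real) g f' g' u v.
      set_borel_measurable dV0 (D \<alpha>) f \<Longrightarrow> set_borel_measurable dV0 (D \<alpha>) g \<Longrightarrow>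
      (\<And>i x. i \<in> A \<Longrightarrow> x \<in> W i \<Longrightarrow> f x = f' i (T i x)) \<Longrightarrow>
      (\<And>i x. i \<in> A \<Longrightarrow> x \<in> W i \<Longrightarrow> g x = g' i (T i x)) \<Longrightarrow>
      (\<And>i. i \<in> A \<Longrightarrow> fs_represents s (D (\<beta> i)) (f' i) (u i)) \<Longrightarrow>
      (\<And>i. i \<in> A \<Longrightarrow> fs_represents s (D (\<beta> i)) (g' i) (v i)) \<Longrightarrow>
      (\<lambda>x. f x * g x) \<in> Gamma_dom s (D \<alpha>) \<and>
      sqrt (inner_dom s (D \<alpha>) (\<lambda>x. f x * g x) (\<lambda>x. f x * g x)) \<le> C * (\<Sum>i\<in>A.
        sqrt (inner_dom t (D (\<beta> i)) (f' i) (f' i)) * sqrt (inner_dom s (D (\<beta> i)) (g' i) (g' i))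
        + sqrt (inner_dom s (D (\<beta> i)) (f' i) (f' i)) * sqrt (inner_dom t (D (\<beta> i)) (g' i) (g' i)))"
    by (rule glue_product[OF A(1,3) region[OF \<alpha>] A(4) t]) blast+
  show ?thesis
  proof (rule that[of "C * card A"])
    show "0 \<le> C * card A" using C(1) by simp
    fix f g :: "'a \<Rightarrow> real" assume f: "f \<in> Gamma_man K \<phi> D s" and g: "g \<in> Gamma_man K \<phi> D s"
    let ?f = "\<lambda>\<alpha>. f \<circ> chart_inv (\<phi> \<alpha>)" and ?g = "\<lambda>\<alpha>. g \<circ> chart_inv (\<phi> \<alpha>)"
    let ?E = "norm_man K \<phi> D t f * norm_man K \<phi> D s g + norm_man K \<phi> D s f * norm_man K \<phi> D t g"
    have "\<forall>\<beta>\<in>K. \<exists>u. fs_represents s (D \<beta>) (?f \<beta>) u" using Gamma_man_represents[OF f] by metis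
    from bchoice[OF this] obtain u where u: "\<forall>\<beta>\<in>K. fs_represents s (D \<beta>) (?f \<beta>) (u \<beta>)" ..
    have "\<forall>\<beta>\<in>K. \<exists>v. fs_represents s (D \<beta>) (?g \<beta>) v" using Gamma_man_represents[OF g] by metis
    from bchoice[OF this] obtain v where v: "\<forall>\<beta>\<in>K. fs_represents s (D \<beta>) (?g \<beta>) (v \<beta>)" ..
    have fm: "set_borel_measurable dV0 (D \<alpha>) (?f \<alpha>)" and gm: "set_borel_measurable dV0 (D \<alpha>) (?g \<alpha>)"
      using fs_representsD(2)[OF region[OF \<alpha>]] u v \<alpha> by blast+
    have fg: "(\<lambda>x. ?f \<alpha> x * ?g \<alpha> x) = (\<lambda>x. f x * g x) \<circ> chart_inv (\<phi> \<alpha>)" by (simp add: o_def)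
    have 1: "(\<lambda>x. f x * g x) \<circ> chart_inv (\<phi> \<alpha>) \<in> Gamma_dom s (D \<alpha>) \<and>
      chart_norm \<phi> D s (\<lambda>x. f x * g x) \<alpha> \<le> C * (\<Sum>i\<in>A. chart_norm \<phi> D t f (\<beta> i) * chart_norm \<phi> D s g (\<beta> i)
        + chart_norm \<phi> D s f (\<beta> i) * chart_norm \<phi> D t g (\<beta> i))"
      using C(2)[OF fm gm, of "\<lambda>i. ?f (\<beta> i)" "\<lambda>i. ?g (\<beta> i)" "\<lambda>i. u (\<beta> i)" "\<lambda>i. v (\<beta> i)"] A(2,5) u v
      unfolding fg by simp
    have "(\<Sum>i\<in>A. chart_norm \<phi> D t f (\<beta> i) * chart_norm \<phi> D s g (\<beta> i) + chart_norm \<phi> D s f (\<beta> i) * chart_norm \<phi> D t g (\<beta> i))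
       \<le> (\<Sum>i\<in>A. ?E)"
    proof (intro sum_mono add_mono mult_mono)
      fix i assume "i \<in> A"
      then have i: "\<beta> i \<in> K" by (rule A(2))
      note ft = Gamma_man_mono(1)[OF f t(2)] and gt = Gamma_man_mono(1)[OF g t(2)]
      show "chart_norm \<phi> D t f (\<beta> i) \<le> norm_man K \<phi> D t f" "chart_norm \<phi> D s f (\<beta> i) \<le> norm_man K \<phi> D s f"
        "chart_norm \<phi> D t g (\<beta> i) \<le> norm_man K \<phi> D t g" "chart_norm \<phi> D s g (\<beta> i) \<le> norm_man K \<phi> D s g"
        by (intro chart_norm_le f g ft gt i)+
      show "0 \<le> norm_man K \<phi> D t f" "0 \<le> norm_man K \<phi> D s f" by (intro norm_man_nonneg f ft)+
      show "0 \<le> chart_norm \<phi> D s g (\<beta> i)" "0 \<le> chart_norm \<phi> D t g (\<beta> i)"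
        by (intro chart_norm_nonneg g gt i)+
    qed
    then have "C * (\<Sum>i\<in>A. chart_norm \<phi> D t f (\<beta> i) * chart_norm \<phi> D s g (\<beta> i) + chart_norm \<phi> D s f (\<beta> i) * chart_norm \<phi> D t g (\<beta> i))
       \<le> C * (\<Sum>i\<in>A. ?E)"
      by (rule mult_left_mono[OF _ C(1)])
    also have "\<dots> = C * card A * ?E" by simp
    finally show "(\<lambda>x. f x * g x) \<circ> chart_inv (\<phi> \<alpha>) \<in> Gamma_dom s (D \<alpha>) \<and>
      chart_norm \<phi> D s (\<lambda>x. f x * g x) \<alpha> \<le> C * card A * ?E"
      using 1 order_trans by blast
  qed
qed

text \<open>The case of two factors, with \<open>t\<close> left open: \<open>t = s\<close> gives the
  first estimate and \<open>t = s - 1\<close> the second. Membership of the product is part of the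
  conclusion so that the estimate can be iterated.\<close>

lemma product_estimate:
  assumes t: "s div 2 + CARD('n) + 2 \<le> t" "t \<le> s"
  obtains C where "0 < C" "\<And>f g :: 'a \<Rightarrow> real. f \<in> Gamma_man K \<phi> D s \<Longrightarrow> g \<in> Gamma_man K \<phi> D s \<Longrightarrow>
    (\<lambda>x. f x * g x) \<in> Gamma_man K \<phi> D s \<and>
    norm_man K \<phi> D s (\<lambda>x. f x * g x)
      \<le> C * (norm_man K \<phi> D t f * norm_man K \<phi> D s g + norm_man K \<phi> D s f * norm_man K \<phi> D t g)"
proof -
  let ?E = "\<lambda>f g. norm_man K \<phi> D t f * norm_man K \<phi> D s g + norm_man K \<phi> D s f * norm_man K \<phi> D t g"
  have "\<forall>\<alpha>\<in>K. \<exists>C. 0 \<le> C \<and> (\<forall>f g :: 'a \<Rightarrow> real. f \<in> Gamma_man K \<phi> D s \<longrightarrow> g \<in> Gamma_man K \<phi> D s \<longrightarrow>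
    (\<lambda>x. f x * g x) \<circ> chart_inv (\<phi> \<alpha>) \<in> Gamma_dom s (D \<alpha>) \<and> chart_norm \<phi> D s (\<lambda>x. f x * g x) \<alpha> \<le> C * ?E f g)"
  proof
    fix \<alpha> assume \<alpha>: "\<alpha> \<in> K"
    show "\<exists>C. 0 \<le> C \<and> (\<forall>f g :: 'a \<Rightarrow> real. f \<in> Gamma_man K \<phi> D s \<longrightarrow> g \<in> Gamma_man K \<phi> D s \<longrightarrow>
      (\<lambda>x. f x * g x) \<circ> chart_inv (\<phi> \<alpha>) \<in> Gamma_dom s (D \<alpha>) \<and> chart_norm \<phi> D s (\<lambda>x. f x * g x) \<alpha> \<le> C * ?E f g)"
      by (rule chart_product_estimate[OF t \<alpha>]) blast
  qed
  from bchoice[OF this] obtain C where C: "\<forall>\<alpha>\<in>K. 0 \<le> C \<alpha> \<and> (\<forall>f g :: 'a \<Rightarrow> real. f \<in> Gamma_man K \<phi> D s \<longrightarrow> g \<in> Gamma_man K \<phi> D s \<longrightarrow>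
    (\<lambda>x. f x * g x) \<circ> chart_inv (\<phi> \<alpha>) \<in> Gamma_dom s (D \<alpha>) \<and> chart_norm \<phi> D s (\<lambda>x. f x * g x) \<alpha> \<le> C \<alpha> * ?E f g)" ..
  have C0: "0 \<le> sum C K" using C by (intro sum_nonneg) blast
  show ?thesis
  proof (rule that[of "sum C K + 1"])
    show "0 < sum C K + 1" using C0 by simp
    fix f g :: "'a \<Rightarrow> real" assume f: "f \<in> Gamma_man K \<phi> D s" and g: "g \<in> Gamma_man K \<phi> D s"
    have fg: "(\<lambda>x. f x * g x) \<in> Gamma_man K \<phi> D s" using C f g unfolding Gamma_man_def by blast
    have E: "0 \<le> ?E f g"
      by (intro add_nonneg_nonneg mult_nonneg_nonneg norm_man_nonneg f g Gamma_man_mono(1)[OF _ t(2)])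
    have "norm_man K \<phi> D s (\<lambda>x. f x * g x) \<le> (\<Sum>\<alpha>\<in>K. chart_norm \<phi> D s (\<lambda>x. f x * g x) \<alpha>)"
      unfolding norm_man_eq[OF fg] by (intro L2_set_le_sum chart_norm_nonneg fg)
    also have "\<dots> \<le> (\<Sum>\<alpha>\<in>K. C \<alpha> * ?E f g)" using C f g by (intro sum_mono) blast
    also have "\<dots> = sum C K * ?E f g" by (simp add: sum_distrib_right)
    also have "\<dots> \<le> (sum C K + 1) * ?E f g" using E by (intro mult_right_mono) auto
    finally show "(\<lambda>x. f x * g x) \<in> Gamma_man K \<phi> D s \<and> norm_man K \<phi> D s (\<lambda>x. f x * g x) \<le> (sum C K + 1) * ?E f g"
      using fg by blast
  qed
qed

lemma product_norm_bound:
  assumes s: "2 * CARD('n) + 4 \<le> s" and p: "1 \<le> p"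
  shows "\<exists>C>0. \<forall>f :: nat \<Rightarrow> 'a \<Rightarrow> real. (\<forall>j\<in>{1..p}. f j \<in> Gamma_man K \<phi> D s) \<longrightarrow>
    (\<lambda>x. \<Prod>j=1..p. f j x) \<in> Gamma_man K \<phi> D s \<and>
    norm_man K \<phi> D s (\<lambda>x. \<Prod>j=1..p. f j x) \<le> C * (\<Prod>j=1..p. norm_man K \<phi> D s (f j))"
  using p
proof (induction p rule: dec_induct)
  case base
  show ?case by (intro exI[of _ 1]) simp
next
  case (step p)
  let ?N = "norm_man K \<phi> D s"
  obtain C1 where C1: "0 < C1" "\<And>f :: nat \<Rightarrow> 'a \<Rightarrow> real. (\<forall>j\<in>{1..p}. f j \<in> Gamma_man K \<phi> D s) \<Longrightarrow>
    (\<lambda>x. \<Prod>j=1..p. f j x) \<in> Gamma_man K \<phi> D s \<and> ?N (\<lambda>x. \<Prod>j=1..p. f j x) \<le> C1 * (\<Prod>j=1..p. ?N (f j))"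
    using step.IH by blast
  obtain C2 where C2: "0 < C2" "\<And>f g :: 'a \<Rightarrow> real. f \<in> Gamma_man K \<phi> D s \<Longrightarrow> g \<in> Gamma_man K \<phi> D s \<Longrightarrow>
    (\<lambda>x. f x * g x) \<in> Gamma_man K \<phi> D s \<and> ?N (\<lambda>x. f x * g x) \<le> C2 * (?N f * ?N g + ?N f * ?N g)"
    by (rule product_estimate[of s s]) (use s in auto)
  show ?case
  \<comment> \<open>The factor 2 appears because for \<open>t = s\<close> the two terms of the
    product estimate coincide.\<close>
  proof (intro exI[of _ "2 * C2 * C1"] conjI allI impI)
    show "0 < 2 * C2 * C1" using C1(1) C2(1) by simp
    fix f :: "nat \<Rightarrow> 'a \<Rightarrow> real" assume f: "\<forall>j\<in>{1..Suc p}. f j \<in> Gamma_man K \<phi> D s"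
    let ?F = "\<lambda>x. \<Prod>j=1..p. f j x"
    have F: "?F \<in> Gamma_man K \<phi> D s" "?N ?F \<le> C1 * (\<Prod>j=1..p. ?N (f j))" using C1(2)[of f] f by auto
    have fp: "f (Suc p) \<in> Gamma_man K \<phi> D s" using f by simp
    have e: "(\<lambda>x. \<Prod>j=1..Suc p. f j x) = (\<lambda>x. ?F x * f (Suc p) x)" by simp
    show "(\<lambda>x. \<Prod>j=1..Suc p. f j x) \<in> Gamma_man K \<phi> D s" unfolding e using C2(2)[OF F(1) fp] by blast
    have "?N (\<lambda>x. \<Prod>j=1..Suc p. f j x) \<le> 2 * C2 * (?N ?F * ?N (f (Suc p)))"
      unfolding e using C2(2)[OF F(1) fp] by (simp add: mult_ac)
    also have "\<dots> \<le> 2 * C2 * (C1 * (\<Prod>j=1..p. ?N (f j)) * ?N (f (Suc p)))"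
      using C2(1) by (intro mult_left_mono mult_right_mono F(2) norm_man_nonneg fp) simp
    also have "\<dots> = 2 * C2 * C1 * (\<Prod>j=1..Suc p. ?N (f j))" by simp
    finally show "?N (\<lambda>x. \<Prod>j=1..Suc p. f j x) \<le> 2 * C2 * C1 * (\<Prod>j=1..Suc p. ?N (f j))" .
  qed
qed

text \<open>In the step the product of the first \<open>p\<close> factors occurs in both norms. Its
  norm of order \<open>s\<close> is bounded by the induction hypothesis, its norm of order
  \<open>s - 1\<close> by the estimate already proved, used at order \<open>s - 1\<close>.\<close>

lemma product_norm_bound_tame:
  assumes s: "2 * CARD('n) + 4 < s" and p: "1 \<le> p"
  shows "\<exists>C>0. \<forall>f :: nat \<Rightarrow> 'a \<Rightarrow> real. (\<forall>j\<in>{1..p}. f j \<in> Gamma_man K \<phi> D s) \<longrightarrow>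
    (\<lambda>x. \<Prod>j=1..p. f j x) \<in> Gamma_man K \<phi> D s \<and>
    norm_man K \<phi> D s (\<lambda>x. \<Prod>j=1..p. f j x)
      \<le> C * (\<Sum>j=1..p. (\<Prod>i=1..<j. norm_man K \<phi> D (s - 1) (f i)) * norm_man K \<phi> D s (f j) *
                        (\<Prod>i=j+1..p. norm_man K \<phi> D (s - 1) (f i)))"
  using p
proof (induction p rule: dec_induct)
  case base
  show ?case by (intro exI[of _ 1]) simp
next
  case (step p)
  let ?N = "norm_man K \<phi> D s" and ?n = "norm_man K \<phi> D (s - 1)"
  let ?S = "\<lambda>p f. \<Sum>j=1..p. (\<Prod>i=1..<j. ?n (f i)) * ?N (f j) * (\<Prod>i=j+1..p. ?n (f i))"
  obtain C1 where C1: "0 < C1" "\<And>f :: nat \<Rightarrow> 'a \<Rightarrow> real. (\<forall>j\<in>{1..p}. f j \<in> Gamma_man K \<phi> D s) \<Longrightarrow>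
    (\<lambda>x. \<Prod>j=1..p. f j x) \<in> Gamma_man K \<phi> D s \<and> ?N (\<lambda>x. \<Prod>j=1..p. f j x) \<le> C1 * ?S p f"
    using step.IH by blast
  obtain C2 where C2: "0 < C2" "\<And>f g :: 'a \<Rightarrow> real. f \<in> Gamma_man K \<phi> D s \<Longrightarrow> g \<in> Gamma_man K \<phi> D s \<Longrightarrow>
    (\<lambda>x. f x * g x) \<in> Gamma_man K \<phi> D s \<and> ?N (\<lambda>x. f x * g x) \<le> C2 * (?n f * ?N g + ?N f * ?n g)"
    by (rule product_estimate[of s "s - 1"]) (use s in auto)
  \<comment> \<open>The strict inequality enters here, as well as in the choice
    \<open>t = s - 1\<close> above.\<close>
  have s1: "2 * CARD('n) + 4 \<le> s - 1" using s by simp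
  obtain C3 where C3: "0 < C3" "\<And>f :: nat \<Rightarrow> 'a \<Rightarrow> real. (\<forall>j\<in>{1..p}. f j \<in> Gamma_man K \<phi> D (s - 1)) \<Longrightarrow>
    ?n (\<lambda>x. \<Prod>j=1..p. f j x) \<le> C3 * (\<Prod>j=1..p. ?n (f j))"
    using product_norm_bound[OF s1 step.hyps(1)] by blast
  show ?case
  \<comment> \<open>\<open>C1\<close> and \<open>C3\<close> bound different terms; their sum is a
    common bound, which can be factored out.\<close>
  proof (intro exI[of _ "C2 * (C1 + C3)"] conjI allI impI)
    show "0 < C2 * (C1 + C3)" using C1(1) C2(1) C3(1) by simp
    fix f :: "nat \<Rightarrow> 'a \<Rightarrow> real" assume f: "\<forall>j\<in>{1..Suc p}. f j \<in> Gamma_man K \<phi> D s"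
    have f': "f j \<in> Gamma_man K \<phi> D (s - 1)" if "j \<in> {1..Suc p}" for j
      using f that Gamma_man_mono(1)[of "f j" s "s - 1"] by simp
    let ?F = "\<lambda>x. \<Prod>j=1..p. f j x" and ?P = "\<Prod>j=1..p. ?n (f j)"
    have F: "?F \<in> Gamma_man K \<phi> D s" "?N ?F \<le> C1 * ?S p f" using C1(2)[of f] f by auto
    have nF: "?n ?F \<le> C3 * ?P" using C3(2)[of f] f' by auto
    have fp: "f (Suc p) \<in> Gamma_man K \<phi> D s" "f (Suc p) \<in> Gamma_man K \<phi> D (s - 1)" using f f' by auto
    have n0: "0 \<le> ?n (f j)" and N0: "0 \<le> ?N (f j)" if "j \<in> {1..Suc p}" for j
      using that f f' norm_man_nonneg by blast+
    have P0: "0 \<le> ?P" using n0 by (intro prod_nonneg) auto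
    have S0: "0 \<le> ?S p f"
      using n0 N0 by (intro sum_nonneg mult_nonneg_nonneg prod_nonneg) auto
    \<comment> \<open>In the summands with \<open>j \<le> p\<close> the last factor is measured in
      order \<open>s - 1\<close> and splits off; the summand \<open>j = p + 1\<close> is the one
      where it carries order \<open>s\<close>. These are the two terms of the product
      estimate.\<close>
    have Sp: "?S (Suc p) f = ?S p f * ?n (f (Suc p)) + ?P * ?N (f (Suc p))"
    proof -
      have "?S (Suc p) f = (\<Sum>j=1..p. (\<Prod>i=1..<j. ?n (f i)) * ?N (f j) * (\<Prod>i=j+1..Suc p. ?n (f i))) + ?P * ?N (f (Suc p))"
        by (simp add: atLeastLessThanSuc_atLeastAtMost)
      also have "(\<Sum>j=1..p. (\<Prod>i=1..<j. ?n (f i)) * ?N (f j) * (\<Prod>i=j+1..Suc p. ?n (f i)))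
        = (\<Sum>j=1..p. (\<Prod>i=1..<j. ?n (f i)) * ?N (f j) * (\<Prod>i=j+1..p. ?n (f i)) * ?n (f (Suc p)))"
        by (intro sum.cong refl) simp
      finally show ?thesis by (simp add: sum_distrib_right)
    qed
    have e: "(\<lambda>x. \<Prod>j=1..Suc p. f j x) = (\<lambda>x. ?F x * f (Suc p) x)" by simp
    show "(\<lambda>x. \<Prod>j=1..Suc p. f j x) \<in> Gamma_man K \<phi> D s" unfolding e using C2(2)[OF F(1) fp(1)] by blast
    have "?N (\<lambda>x. \<Prod>j=1..Suc p. f j x) \<le> C2 * (?n ?F * ?N (f (Suc p)) + ?N ?F * ?n (f (Suc p)))"
      unfolding e using C2(2)[OF F(1) fp(1)] by blast
    also have "\<dots> \<le> C2 * ((C1 + C3) * ?P * ?N (f (Suc p)) + (C1 + C3) * ?S p f * ?n (f (Suc p)))"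
    proof (intro mult_left_mono add_mono mult_right_mono)
      show "?n ?F \<le> (C1 + C3) * ?P"
        using C1(1) P0 by (intro order_trans[OF nF] mult_right_mono) auto
      show "?N ?F \<le> (C1 + C3) * ?S p f"
        using C3(1) S0 by (intro order_trans[OF F(2)] mult_right_mono) auto
    qed (use C2(1) n0 N0 in auto)
    also have "\<dots> = C2 * (C1 + C3) * ?S (Suc p) f" unfolding Sp by (simp add: algebra_simps)
    finally show "?N (\<lambda>x. \<Prod>j=1..Suc p. f j x) \<le> C2 * (C1 + C3) * ?S (Suc p) f" .
  qed
qed

end

theorem lemma2p3p2:
  fixes M :: "'a topology"
    and \<A> :: "('a, 'n::finite R2n1) chart set"
    and \<eta> :: "('a, 'n R2n1) form1"
    and K :: "'k set"
    and \<phi> :: "'k \<Rightarrow> ('a, 'n R2n1) chart"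
    and D :: "'k \<Rightarrow> 'n R2n1 set"
    and p s :: nat
  assumes "compact_contact_manifold M \<A> \<eta>"
    and "adapted_atlas M \<A> \<eta> K \<phi> D"
    and "p \<ge> 1"
  shows
    "(s \<ge> 2 * CARD('n) + 4 \<longrightarrow>
       (\<exists>C>0. \<forall>f :: nat \<Rightarrow> 'a \<Rightarrow> real.
          (\<forall>j\<in>{1..p}. f j \<in> Gamma_man K \<phi> D s) \<longrightarrow>
            (\<lambda>x. \<Prod>j=1..p. f j x) \<in> Gamma_man K \<phi> D s \<and>
            norm_man K \<phi> D s (\<lambda>x. \<Prod>j=1..p. f j x)
              \<le> C * (\<Prod>j=1..p. norm_man K \<phi> D s (f j)))) \<and>
     (s > 2 * CARD('n) + 4 \<longrightarrow>
       (\<exists>C>0. \<forall>f :: nat \<Rightarrow> 'a \<Rightarrow> real.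
          (\<forall>j\<in>{1..p}. f j \<in> Gamma_man K \<phi> D s) \<longrightarrow>
            (\<lambda>x. \<Prod>j=1..p. f j x) \<in> Gamma_man K \<phi> D s \<and>
            norm_man K \<phi> D s (\<lambda>x. \<Prod>j=1..p. f j x)
              \<le> C * (\<Sum>j=1..p. (\<Prod>i=1..<j. norm_man K \<phi> D (s - 1) (f i)) *
                                norm_man K \<phi> D s (f j) *
                                (\<Prod>i=j+1..p. norm_man K \<phi> D (s - 1) (f i)))))"
  using product_norm_bound[OF assms(1,2) _ assms(3)] product_norm_bound_tame[OF assms(1,2) _ assms(3)]
  by blast

end
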